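(* There exist arithmetically equivalent number fields $K_1$ and $K_2$ and a prime number $p$ such that the product of the ramification indices of the primes of $K_1$ above $p$ equals the product of the ramification indices of the primes of $K_2$ above $p$, but the sum of the ramification indices of the primes of $K_1$ above $p$ differs from the sum of the ramification indices of the primes of $K_2$ above $p$.
   Context: Number fields $K_1$ and $K_2$ are arithmetically equivalent if they have the same Dedekind zeta function. *)

theory Defs
  imports
    "HOL-Algebra.Algebra"
    "HOL-Algebra.Algebraic_Closure_Type"
    "HOL-Analysis.Analysis"
begin

text \<open>
  Number fields are taken inside the complex numbers, which loses nothing up to isomorphism.
\<close>

definition number_field :: "complex set \<Rightarrow> bool" where
  "number_field K \<longleftrightarrow>
     subfield K ring_of_type_algebra \<and> ring.finite_dimension ring_of_type_algebra \<rat> K"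

definition ring_of_integers :: "complex set \<Rightarrow> complex ring" where
  "ring_of_integers K = ring_of_type_algebra \<lparr>carrier := {x \<in> K. algebraic_int x}\<rparr>"

definition ideal_norm :: "complex set \<Rightarrow> complex set \<Rightarrow> nat" where
  "ideal_norm K I = card (carrier (ring_of_integers K Quot I))"

text \<open>
  The series converges absolutely for \<open>Re s > 1\<close>. Outside this half-plane the value below
  is not the one given by analytic continuation.
\<close>

definition dedekind_zeta :: "complex set \<Rightarrow> complex \<Rightarrow> complex" where
  "dedekind_zeta K s =
     (\<Sum>\<^sub>\<infinity>I\<in>{I. ideal I (ring_of_integers K) \<and> I \<noteq> {0}}. 1 / of_nat (ideal_norm K I) powr s)"

text \<open>
  By the identity theorem, agreement on the half-plane of convergence is the same as agreement
  of the meromorphic continuations.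
\<close>

definition arithmetically_equivalent :: "complex set \<Rightarrow> complex set \<Rightarrow> bool" where
  "arithmetically_equivalent K L \<longleftrightarrow>
     (\<forall>s. Re s > 1 \<longrightarrow> dedekind_zeta K s = dedekind_zeta L s)"

definition primes_above :: "complex set \<Rightarrow> nat \<Rightarrow> complex set set" where
  "primes_above K p =
     {P. primeideal P (ring_of_integers K) \<and> P \<inter> \<int> = range (\<lambda>k::int. of_int (int p * k))}"

text \<open>
  The exponent of \<open>P\<close> in the factorisation of the ideal generated by \<open>p\<close>; powers and
  divisibility are those of the monoid of ideals.
\<close>

definition ramification_index :: "complex set \<Rightarrow> nat \<Rightarrow> complex set \<Rightarrow> nat" where
  "ramification_index K p P =
     (let R = ring_of_integers K in
      GREATEST n::nat. (P [^]\<^bsub>ideals_set R\<^esub> n) divides\<^bsub>ideals_set R\<^esub> (PIdl\<^bsub>R\<^esub> (of_nat p)))"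

end

theory Submission
  imports Defs "Jordan_Normal_Form.Char_Poly" "HOL-Library.Equipollence" "HOL-Number_Theory.Number_Theory"
begin

text \<open>
  The fields are generated by $\alpha = \sqrt[8]{17}$ and $\beta = \sqrt[8]{272} = \sqrt 2\,\alpha$, and $p = 2$.

  Zeta functions: 16 is an eighth power modulo every odd $m$ (one of 2, $-1$, $-2$ is a square
  modulo each odd prime power), so the two rings of integers become isomorphic modulo $m$ and have
  equally many ideals of index $m$. At 2 both rings have three primes, of norms 4, 2, 2, hence
  equally many ideals of each index $2^k$. The Chinese remainder theorem then gives a
  norm-preserving bijection between the nonzero ideals, and no analysis is needed.

  Ramification: $17 \equiv 5^4$ modulo eighth powers in $\mathbb{Z}_2$, so over $\mathbb{Q}_2$ the polynomials split as
  $x^8 - 17 \sim (x^2-5)(x^2+5)(x^4+25)$ and $x^8 - 272 \sim (x^2-10)(x^2+10)(x^4+100)$, which gives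
  ramification indices 1, 2, 4 and 2, 2, 2: both products are 8, but the sums are 7 and 6.
  These factorisations are realised by explicit elements of the localisation at 2. Since the
  quotient of this ring by 2 has $2^8$ elements, a factorisation of 2 with the right exponents into
  nonunits forces the norms of the factors, so no integral basis is required.
\<close>

subsection \<open>Algebraic integers\<close>

text \<open>The pair rests on the fact behind Wang's counterexample to Grunwald's theorem: 16 is an
  eighth power in every completion of the rationals except the 2-adic one, so only the prime 2 can
  tell the two fields apart. The factor 17 is congruent to 1 modulo 16 and hence a 2-adic fourth
  power, which makes both polynomials split into small factors there; it also makes both polynomials
  Eisenstein at 17, so that Z[\<beta>] differs from the ring of integers at 2 only. The obstacle is
  2 itself, where Z[\<beta>] is not maximal. The only information about integral elements there is
  that their coefficients have denominators dividing 128. Integrality is therefore proved by monic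
  quadratic equations over elements already known to be integral, and non-integrality by raising to
  the eighth power until a denominator outgrows 128. The rest at 2 is counting: the 256 residues
  modulo 2 leave no room for larger residue rings.\<close>

lemma algebraic_int_eigenvalue:
  fixes z :: complex and v :: "nat \<Rightarrow> complex"
  assumes step: "\<And>i. i < N \<Longrightarrow> \<exists>a :: nat \<Rightarrow> int. z * v i = (\<Sum>j<N. of_int (a j) * v j)"
    and nz: "k < N" "v k \<noteq> 0"
  shows "algebraic_int z"
proof -
  from step obtain a :: "nat \<Rightarrow> nat \<Rightarrow> int" where
    a: "\<And>i. i < N \<Longrightarrow> z * v i = (\<Sum>j<N. of_int (a i j) * v j)"
    by metis
  define A where "A = Matrix.mat N N (\<lambda>(i, j). a i j)"
  have A: "A \<in> carrier_mat N N"
    by (simp add: A_def)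
  define B :: "complex Matrix.mat" where "B = map_mat of_int A"
  have B: "B \<in> carrier_mat N N"
    using A by (simp add: B_def)
  \<comment> \<open>Determinant trick: \<open>z\<close> is an eigenvalue of an integer matrix, whose
    characteristic polynomial is monic with integer coefficients.\<close>
  have "eigenvector B (Matrix.vec N v) z"
    unfolding eigenvector_def
  proof (intro conjI)
    show "Matrix.vec N v \<in> carrier_vec (dim_row B)"
      using B by auto
    show "Matrix.vec N v \<noteq> 0\<^sub>v (dim_row B)"
      using B nz by (auto simp: vec_eq_iff)
    show "B *\<^sub>v Matrix.vec N v = z \<cdot>\<^sub>v Matrix.vec N v"
      using a A B by (intro eq_vecI) (auto simp: scalar_prod_def B_def A_def atLeast0LessThan)
  qed
  hence "poly (char_poly B) z = 0"
    using eigenvalue_root_char_poly[OF B] by (auto simp: eigenvalue_def)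
  moreover have "char_poly B = of_int_poly (char_poly A)"
    unfolding B_def by (rule of_int_hom.char_poly_hom[OF A])
  ultimately show ?thesis
    using degree_monic_char_poly[OF A]
    by (auto simp: algebraic_int_altdef_ipoly intro!: exI[of _ "char_poly A"])
qed

definition int_span :: "complex set \<Rightarrow> complex set" where
  "int_span V = {w. \<exists>c :: complex \<Rightarrow> int. w = (\<Sum>v\<in>V. of_int (c v) * v)}"

lemma int_span_add: "w \<in> int_span V \<Longrightarrow> w' \<in> int_span V \<Longrightarrow> w + w' \<in> int_span V"
proof -
  assume "w \<in> int_span V" "w' \<in> int_span V"
  then obtain c c' where "w = (\<Sum>v\<in>V. of_int (c v) * v)" "w' = (\<Sum>v\<in>V. of_int (c' v) * v)"
    by (auto simp: int_span_def)
  hence "w + w' = (\<Sum>v\<in>V. of_int (c v + c' v) * v)"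
    by (simp add: sum.distrib ring_distribs)
  thus ?thesis unfolding int_span_def by (intro CollectI exI)
qed

lemma int_span_scale: "w \<in> int_span V \<Longrightarrow> of_int d * w \<in> int_span V"
proof -
  assume "w \<in> int_span V"
  then obtain c where "w = (\<Sum>v\<in>V. of_int (c v) * v)"
    by (auto simp: int_span_def)
  hence "of_int d * w = (\<Sum>v\<in>V. of_int (d * c v) * v)"
    by (simp add: sum_distrib_left mult_ac)
  thus ?thesis unfolding int_span_def by (intro CollectI exI)
qed

lemma int_span_sum:
  "(\<And>i. i \<in> I \<Longrightarrow> f i \<in> int_span V) \<Longrightarrow> (\<Sum>i\<in>I. of_int (d i) * f i) \<in> int_span V"
proof (induction I rule: infinite_finite_induct)
  case (insert x F)
  then show ?case by (auto intro: int_span_add int_span_scale)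
qed (auto simp: int_span_def intro!: exI[of _ "\<lambda>_. 0"])

lemma int_span_base:
  assumes "finite V" "u \<in> V"
  shows "u \<in> int_span V"
proof -
  have "u = (\<Sum>v\<in>V. of_int (if v = u then 1 else 0) * v)"
    using assms by (simp add: if_distrib[of "\<lambda>k. of_int k * _"] sum.delta cong: if_cong)
  thus ?thesis unfolding int_span_def by (intro CollectI exI)
qed

text \<open>Subrings that are finitely generated as abelian groups. All their elements are algebraic
  integers, and adjoining an algebraic integer stays in this class; together this gives closure
  under sums and products.\<close>

definition finite_int_ring :: "complex set \<Rightarrow> bool" where
  "finite_int_ring A \<longleftrightarrow> 1 \<in> A \<and> (\<forall>a\<in>A. \<forall>b\<in>A. a + b \<in> A \<and> a * b \<in> A) \<and> (\<forall>a\<in>A. -a \<in> A)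
     \<and> (\<exists>V. finite V \<and> V \<subseteq> A \<and> A \<subseteq> int_span V)"

lemma finite_int_ring_algebraic_int:
  assumes "finite_int_ring A" "z \<in> A"
  shows "algebraic_int z"
proof -
  from assms obtain V where V: "finite V" "V \<subseteq> A" "A \<subseteq> int_span V"
    by (auto simp: finite_int_ring_def)
  obtain h where h: "bij_betw h {..<card V} V"
    using ex_bij_betw_nat_finite[OF V(1)] by (auto simp: atLeast0LessThan)
  have "\<exists>a :: nat \<Rightarrow> int. z * h i = (\<Sum>j<card V. of_int (a j) * h j)" if "i < card V" for i
  proof -
    have "h i \<in> V" using h that by (auto simp: bij_betw_def)
    hence "z * h i \<in> int_span V"
      using assms V by (auto simp: finite_int_ring_def)
    then obtain c :: "complex \<Rightarrow> int" where "z * h i = (\<Sum>v\<in>V. of_int (c v) * v)"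
      by (auto simp: int_span_def)
    also have "\<dots> = (\<Sum>j<card V. of_int (c (h j)) * h j)"
      by (rule sum.reindex_bij_betw[OF h, symmetric])
    finally show ?thesis by (rule exI[of _ "\<lambda>j. c (h j)"])
  qed
  moreover have "\<exists>k<card V. h k \<noteq> 0"
  proof (rule ccontr)
    assume "\<not> ?thesis"
    hence "\<forall>v\<in>V. v = 0" using h by (auto simp: bij_betw_def)
    moreover have "1 \<in> int_span V" using assms V by (auto simp: finite_int_ring_def)
    ultimately have "(0::complex) = 1"
      by (auto simp: int_span_def sum.neutral)
    thus False by simp
  qed
  ultimately show ?thesis using algebraic_int_eigenvalue by blast
qed

text \<open>The polynomials in \<open>x\<close> of degree below \<open>n\<close> with coefficients
  in \<open>A\<close> form a ring, generated by the products of generators of \<open>A\<close> with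
  powers of \<open>x\<close>. The monic relation has coefficients in \<open>A\<close> and not just
  in the integers, which is what \<open>algebraic_int_quadratic\<close> relies on.\<close>

lemma finite_int_ring_adjoin:
  assumes A: "finite_int_ring A"
    and x: "x ^ n = (\<Sum>i<n. a i * x ^ i)" "\<And>i. i < n \<Longrightarrow> a i \<in> A"
  shows "\<exists>B. finite_int_ring B \<and> A \<subseteq> B \<and> x \<in> B"
proof -
  from A obtain V where V: "finite V" "V \<subseteq> A" "A \<subseteq> int_span V"
    by (auto simp: finite_int_ring_def)
  have A_add: "u + v \<in> A" and A_mult: "u * v \<in> A" and A_neg: "-u \<in> A" and A_1: "1 \<in> A"
    if "u \<in> A" "v \<in> A" for u v
    using A that by (auto simp: finite_int_ring_def)
  have A_1: "1 \<in> A" using A by (auto simp: finite_int_ring_def)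
  have A_0: "0 \<in> A" using A_add[OF A_1 A_neg[OF A_1 A_1]] by simp
  define B where "B = {w. \<exists>c. (\<forall>i. c i \<in> A) \<and> w = (\<Sum>i<n. c i * x ^ i)}"
  have BI: "w \<in> B" if "\<And>i. c i \<in> A" "w = (\<Sum>i<n. c i * x ^ i)" for c w
    using that by (auto simp: B_def)
  have B_add: "u + v \<in> B" if "u \<in> B" "v \<in> B" for u v
  proof -
    from that obtain c c' where "\<forall>i. c i \<in> A" "u = (\<Sum>i<n. c i * x ^ i)"
      "\<forall>i. c' i \<in> A" "v = (\<Sum>i<n. c' i * x ^ i)" unfolding B_def by blast
    thus ?thesis
      by (intro BI[of "\<lambda>i. c i + c' i"]) (auto simp: sum.distrib ring_distribs intro: A_add)
  qed
  have B_scale: "k * u \<in> B" if "u \<in> B" "k \<in> A" for u k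
  proof -
    from that obtain c where "\<forall>i. c i \<in> A" "u = (\<Sum>i<n. c i * x ^ i)" unfolding B_def by blast
    thus ?thesis using that
      by (intro BI[of "\<lambda>i. k * c i"]) (auto simp: sum_distrib_left mult_ac intro: A_mult)
  qed
  have B_0: "0 \<in> B"
    by (rule BI[of "\<lambda>_. 0"]) (auto intro: A_0)
  have B_sum: "(\<Sum>i\<in>I. k i * f i) \<in> B" if "\<And>i. i \<in> I \<Longrightarrow> f i \<in> B" "\<And>i. i \<in> I \<Longrightarrow> k i \<in> A"
    for I :: "nat set" and k f
    using that by (induction I rule: infinite_finite_induct) (auto intro: B_0 B_add B_scale)
  have pow_small: "x ^ i \<in> B" if "i < n" for i
  proof -
    have "(\<Sum>j<n. (if j = i then 1 else 0) * x ^ j) = x ^ i"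
      using that by (simp add: if_distrib[of "\<lambda>u. u * _"] sum.delta cong: if_cong)
    thus ?thesis by (intro BI[of "\<lambda>j. if j = i then 1 else 0"]) (auto intro: A_0 A_1)
  qed
  have x_mult: "x * w \<in> B" if "w \<in> B" for w
  proof -
    from that obtain c where c: "\<forall>i. c i \<in> A" "w = (\<Sum>i<n. c i * x ^ i)" unfolding B_def by blast
    have "x ^ n \<in> B" unfolding x(1) using x(2) by (intro B_sum pow_small) auto
    hence "x ^ Suc i \<in> B" if "i < n" for i
      using that pow_small[of "Suc i"] by (cases "Suc i = n") auto
    moreover have "x * w = (\<Sum>i<n. c i * x ^ Suc i)"
      by (simp add: c sum_distrib_left mult_ac)
    ultimately show ?thesis using c by (auto intro!: B_sum simp del: power_Suc)
  qed
  have 1: "1 \<in> B"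
  proof (cases "n = 0")
    case True
    hence "(1::complex) = 0" using x(1) by simp
    thus ?thesis by simp
  qed (use pow_small[of 0] in auto)
  have pow: "x ^ i * w \<in> B" if "w \<in> B" for i w
    using that by (induction i) (auto intro: x_mult simp: mult.assoc)
  have B_mult: "u * v \<in> B" if "u \<in> B" "v \<in> B" for u v
  proof -
    from that obtain c where c: "\<forall>i. c i \<in> A" "u = (\<Sum>i<n. c i * x ^ i)" unfolding B_def by blast
    have "u * v = (\<Sum>i<n. c i * (x ^ i * v))"
      by (simp only: c(2) sum_distrib_right mult.assoc)
    also have "\<dots> \<in> B" using pow that c by (auto intro!: B_sum)
    finally show ?thesis .
  qed
  have B_A: "A \<subseteq> B"
    using B_scale[OF 1] by auto
  define W where "W = (\<lambda>(v, i). v * x ^ i) ` (V \<times> {..<n})"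
  have "finite W" using V by (auto simp: W_def)
  moreover have "W \<subseteq> B"
    using V B_A by (auto simp: W_def intro!: B_scale pow_small)
  moreover have "B \<subseteq> int_span W"
  proof
    fix w assume "w \<in> B"
    then obtain c where c: "\<forall>i. c i \<in> A" "w = (\<Sum>i<n. c i * x ^ i)" unfolding B_def by blast
    have "c i * x ^ i \<in> int_span W" if "i < n" for i
    proof -
      obtain d :: "complex \<Rightarrow> int" where "c i = (\<Sum>v\<in>V. of_int (d v) * v)"
        using c V by (fastforce simp: int_span_def)
      hence "c i * x ^ i = (\<Sum>v\<in>V. of_int (d v) * (v * x ^ i))"
        by (simp only: sum_distrib_right mult.assoc)
      also have "\<dots> \<in> int_span W"
        using that \<open>finite W\<close> by (intro int_span_sum int_span_base) (auto simp: W_def)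
      finally show ?thesis .
    qed
    hence "(\<Sum>i<n. of_int 1 * (c i * x ^ i)) \<in> int_span W"
      by (intro int_span_sum) auto
    thus "w \<in> int_span W" using c by simp
  qed
  ultimately have "\<exists>W. finite W \<and> W \<subseteq> B \<and> B \<subseteq> int_span W" by blast
  moreover have "-u \<in> B" if "u \<in> B" for u
    using B_scale[OF that A_neg[OF A_1 A_1]] by simp
  ultimately have "finite_int_ring B"
    unfolding finite_int_ring_def using B_add B_mult 1 by blast
  moreover have "x \<in> B" using x_mult[OF 1] by simp
  ultimately show ?thesis using B_A by blast
qed

lemma finite_int_ring_Ints: "finite_int_ring \<int>"
  unfolding finite_int_ring_def
proof (intro conjI ballI exI[of _ "{1}"])
  show "(\<int> :: complex set) \<subseteq> int_span {1}"
    by (auto simp: int_span_def Ints_def intro!: exI[of _ "\<lambda>_. _"])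
qed auto

lemma finite_int_ring_adjoin_algebraic_int:
  assumes "finite_int_ring A" "algebraic_int x"
  shows "\<exists>B. finite_int_ring B \<and> A \<subseteq> B \<and> x \<in> B"
proof -
  have "of_nat k \<in> A" for k
  proof (induction k)
    case 0
    have "1 + (-1) \<in> A" using assms(1) unfolding finite_int_ring_def by blast
    then show ?case by simp
  next
    case (Suc k)
    thus ?case using assms(1) by (auto simp: finite_int_ring_def)
  qed
  hence Ints: "of_int k \<in> A" for k
    using assms(1) by (cases k) (auto simp: finite_int_ring_def simp del: of_nat_Suc)
  from assms obtain p :: "int poly"
    where p: "poly (of_int_poly p) x = 0" "lead_coeff p = 1"
    by (auto simp: algebraic_int_altdef_ipoly)
  define m where "m = Polynomial.degree p"
  have "0 = (\<Sum>i\<le>m. of_int (poly.coeff p i) * x ^ i)"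
    using p by (simp add: poly_altdef m_def)
  also have "\<dots> = x ^ m + (\<Sum>i<m. of_int (poly.coeff p i) * x ^ i)"
    using p by (simp add: m_def lessThan_Suc_atMost [symmetric])
  finally have "x ^ m = (\<Sum>i<m. of_int (- poly.coeff p i) * x ^ i)"
    by (simp add: sum_negf eq_neg_iff_add_eq_0)
  from finite_int_ring_adjoin[OF assms(1) this] Ints show ?thesis by blast
qed

lemma algebraic_int_arith:
  fixes x y :: complex
  assumes "algebraic_int x" "algebraic_int y"
  shows algebraic_int_add [intro]: "algebraic_int (x + y)"
    and algebraic_int_mult [intro]: "algebraic_int (x * y)"
proof -
  obtain A where "finite_int_ring A" "x \<in> A"
    using finite_int_ring_adjoin_algebraic_int[OF finite_int_ring_Ints assms(1)] by blast
  then obtain B where "finite_int_ring B" "x \<in> B" "y \<in> B"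
    using finite_int_ring_adjoin_algebraic_int[OF _ assms(2)] by blast
  thus "algebraic_int (x + y)" "algebraic_int (x * y)"
    using finite_int_ring_algebraic_int unfolding finite_int_ring_def by blast+
qed

lemma algebraic_int_diff [intro]:
  "algebraic_int x \<Longrightarrow> algebraic_int y \<Longrightarrow> algebraic_int (x - y :: complex)"
  using algebraic_int_add[of x "- y"] by simp

lemma algebraic_int_power [intro]: "algebraic_int x \<Longrightarrow> algebraic_int (x ^ n :: complex)"
  by (induction n) (auto intro: int_imp_algebraic_int)

lemma algebraic_int_sum [intro]:
  "(\<And>i. i \<in> I \<Longrightarrow> algebraic_int (f i :: complex)) \<Longrightarrow> algebraic_int (\<Sum>i\<in>I. f i)"
  by (induction I rule: infinite_finite_induct) auto

text \<open>Transitivity of integrality in degree 2. All later integrality proofs for explicit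
  elements go through it.\<close>

lemma algebraic_int_quadratic:
  fixes x :: complex
  assumes "algebraic_int b" "algebraic_int c" "x\<^sup>2 = b * x + c"
  shows "algebraic_int x"
proof -
  obtain A where "finite_int_ring A" "b \<in> A"
    using finite_int_ring_adjoin_algebraic_int[OF finite_int_ring_Ints assms(1)] by blast
  then obtain B where B: "finite_int_ring B" "b \<in> B" "c \<in> B"
    using finite_int_ring_adjoin_algebraic_int[OF _ assms(2)] by blast
  have "\<exists>C. finite_int_ring C \<and> B \<subseteq> C \<and> x \<in> C"
  proof (rule finite_int_ring_adjoin[OF B(1), of x 2 "\<lambda>i. if i = 0 then c else b"])
    show "x ^ 2 = (\<Sum>i<2. (if i = 0 then c else b) * x ^ i)"
      using assms(3) by (simp add: numeral_2_eq_2)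
  qed (use B in auto)
  thus ?thesis using finite_int_ring_algebraic_int by blast
qed

subsection \<open>Index of additive subgroups\<close>

definition coset :: "'a::ab_group_add set \<Rightarrow> 'a \<Rightarrow> 'a set" where
  "coset H x = (\<lambda>h. h + x) ` H"

text \<open>An infinite index has the value 0, so for a subgroup \<open>G\<close> the condition
  \<open>idx G H > 0\<close> expresses finiteness. Plain subsets of a type are used in place of
  algebraic structures, so that ordinary arithmetic applies; \<open>ideal_norm_eq_idx\<close> is the
  bridge to \<open>ideal_norm\<close>.\<close>

definition idx :: "'a::ab_group_add set \<Rightarrow> 'a set \<Rightarrow> nat" where
  "idx G H = card (coset H ` G)"

definition addgrp :: "'a::ab_group_add set \<Rightarrow> bool" where
  "addgrp H \<longleftrightarrow> 0 \<in> H \<and> (\<forall>x\<in>H. \<forall>y\<in>H. x - y \<in> H)"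

lemma addgrpD:
  assumes "addgrp H"
  shows "0 \<in> H" "x \<in> H \<Longrightarrow> y \<in> H \<Longrightarrow> x - y \<in> H" "x \<in> H \<Longrightarrow> - x \<in> H"
    "x \<in> H \<Longrightarrow> y \<in> H \<Longrightarrow> x + y \<in> H"
proof -
  show 0: "0 \<in> H" and d: "\<And>x y. x \<in> H \<Longrightarrow> y \<in> H \<Longrightarrow> x - y \<in> H"
    using assms by (auto simp: addgrp_def)
  show n: "\<And>x. x \<in> H \<Longrightarrow> - x \<in> H"
    using d[OF 0] by simp
  show "x \<in> H \<Longrightarrow> y \<in> H \<Longrightarrow> x + y \<in> H"
    using d[of x "- y"] n by simp
qed

lemma coset_eq_iff:
  assumes "addgrp H"
  shows "coset H x = coset H y \<longleftrightarrow> x - y \<in> H"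
proof
  assume "coset H x = coset H y"
  moreover have "x \<in> coset H x"
    using addgrpD(1)[OF assms] by (force simp: coset_def)
  ultimately obtain h where "h \<in> H" "x = h + y"
    by (auto simp: coset_def)
  thus "x - y \<in> H" by simp
next
  have *: "coset H x \<subseteq> coset H y" if "x - y \<in> H" for x y
  proof
    fix z assume "z \<in> coset H x"
    then obtain h where "h \<in> H" "z = h + x" by (auto simp: coset_def)
    hence "h + (x - y) \<in> H" "z = (h + (x - y)) + y"
      using addgrpD(4)[OF assms] that by auto
    thus "z \<in> coset H y" unfolding coset_def by blast
  qed
  assume "x - y \<in> H"
  moreover from this have "y - x \<in> H"
    using addgrpD(3)[OF assms, of "x - y"] by simp
  ultimately show "coset H x = coset H y" using * by blast
qed

lemma image_bij_betw_image:
  assumes "\<And>x y. x \<in> U \<Longrightarrow> y \<in> U \<Longrightarrow> f x = f y \<longleftrightarrow> g x = g y"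
  shows "\<exists>b. bij_betw b (f ` U) (g ` U)"
proof -
  define b where "b = (\<lambda>u. g (SOME x. x \<in> U \<and> f x = u))"
  have b: "b (f x) = g x" if "x \<in> U" for x
  proof -
    have "\<exists>y. y \<in> U \<and> f y = f x" using that by blast
    from someI_ex[OF this] assms that show ?thesis unfolding b_def by blast
  qed
  have "bij_betw b (f ` U) (g ` U)"
    unfolding bij_betw_def inj_on_def using assms b by (auto simp: image_iff)
  thus ?thesis by blast
qed

text \<open>Two maps with the same fibres have equipollent images. This also covers infinite images,
  so the index formulas built on it hold with the value 0 for infinite indices.\<close>

lemma card_image_eq:
  assumes "\<And>x y. x \<in> U \<Longrightarrow> y \<in> U \<Longrightarrow> f x = f y \<longleftrightarrow> g x = g y"
  shows "card (f ` U) = card (g ` U)"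
proof -
  obtain b where "bij_betw b (f ` U) (g ` U)"
    using image_bij_betw_image[of U f g] assms by metis
  thus ?thesis by (rule bij_betw_same_card)
qed

text \<open>\<open>h\<close> induces an isomorphism of quotient groups. Surjectivity is asked modulo
  \<open>I\<close>, the form in which reductions modulo an integer and localisation provide
  it.\<close>

lemma idx_vimage:
  assumes P: "addgrp P" and I: "addgrp I" and h: "\<And>x y. x \<in> P \<Longrightarrow> y \<in> P \<Longrightarrow> h (x - y) = h x - h y"
    and hA: "h ` P \<subseteq> A" and surj: "\<And>a. a \<in> A \<Longrightarrow> \<exists>p\<in>P. a - h p \<in> I"
  shows "idx P {p\<in>P. h p \<in> I} = idx A I"
proof -
  let ?J = "{p\<in>P. h p \<in> I}"
  have J: "addgrp ?J"
    using addgrpD[OF P] addgrpD[OF I] h[of 0 0] by (auto simp: addgrp_def h)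
  have "card (coset ?J ` P) = card ((\<lambda>p. coset I (h p)) ` P)"
    by (rule card_image_eq) (auto simp: coset_eq_iff[OF J] coset_eq_iff[OF I] h addgrpD(2)[OF P])
  also have "(\<lambda>p. coset I (h p)) ` P = coset I ` A"
  proof (intro equalityI subsetI)
    fix c assume "c \<in> coset I ` A"
    then obtain a where a: "a \<in> A" "c = coset I a" by blast
    with surj obtain p where "p \<in> P" "a - h p \<in> I" by blast
    with a have "c = coset I (h p)" by (simp only: coset_eq_iff[OF I])
    with \<open>p \<in> P\<close> show "c \<in> (\<lambda>p. coset I (h p)) ` P" by blast
  qed (use hA in auto)
  finally show ?thesis by (simp add: idx_def)
qed

lemma idx_inj_image:
  assumes G: "addgrp G" and H: "addgrp H" "H \<subseteq> G"
    and h: "\<And>x y. x \<in> G \<Longrightarrow> y \<in> G \<Longrightarrow> h (x - y) = h x - h y" and inj: "inj_on h G"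
  shows "idx (h ` G) (h ` H) = idx G H"
proof -
  have h0: "h 0 = 0" using h[of 0 0] addgrpD(1)[OF G] by simp
  have 1: "{p\<in>G. h p \<in> h ` H} = H"
    using inj H by (auto simp: inj_on_def)
  have 2: "addgrp (h ` H)"
    unfolding addgrp_def
  proof (intro conjI ballI)
    show "0 \<in> h ` H" using h0 addgrpD(1)[OF H(1)] by force
    fix x y assume "x \<in> h ` H" "y \<in> h ` H"
    then obtain u v where uv: "u \<in> H" "v \<in> H" "x = h u" "y = h v" by blast
    hence "x - y = h (u - v)" using h[OF subsetD[OF H(2) uv(1)] subsetD[OF H(2) uv(2)]] by simp
    thus "x - y \<in> h ` H" using addgrpD(2)[OF H(1) uv(1,2)] by blast
  qed
  have "idx G {p\<in>G. h p \<in> h ` H} = idx (h ` G) (h ` H)"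
  proof (rule idx_vimage[OF G 2 h subset_refl])
    fix a assume "a \<in> h ` G"
    then obtain p where "p \<in> G" "a = h p" by blast
    thus "\<exists>p\<in>G. a - h p \<in> h ` H" using addgrpD(1)[OF 2] by (intro bexI[of _ p]) simp_all
  qed
  thus ?thesis by (simp add: 1)
qed

text \<open>A coset of \<open>K\<close> in \<open>G\<close> is encoded by its coset modulo
  \<open>H\<close> together with the coset modulo \<open>K\<close> of the difference to a
  representative that depends on the coset modulo \<open>H\<close> only.\<close>

lemma idx_mult:
  assumes G: "addgrp G" and H: "addgrp H" and K: "addgrp K" and sub: "K \<subseteq> H" "H \<subseteq> G"
  shows "idx G K = idx G H * idx H K"
proof -
  define rep where "rep = (\<lambda>x. SOME y. y \<in> G \<and> coset H y = coset H x)"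
  have rep: "rep x \<in> G" "coset H (rep x) = coset H x" if "x \<in> G" for x
  proof -
    have "\<exists>y. y \<in> G \<and> coset H y = coset H x" using that by blast
    from someI_ex[OF this] show "rep x \<in> G" "coset H (rep x) = coset H x" by (simp_all add: rep_def)
  qed
  have rep_cong: "rep x = rep y" if "coset H x = coset H y" for x y
    using that by (simp add: rep_def)
  have repH: "x - rep x \<in> H" if "x \<in> G" for x
    using rep[OF that] coset_eq_iff[OF H, of x "rep x"] by simp
  define g where "g = (\<lambda>x. (coset H x, coset K (x - rep x)))"
  have "card (coset K ` G) = card (g ` G)"
  proof (rule card_image_eq)
    fix x y assume xy: "x \<in> G" "y \<in> G"
    show "coset K x = coset K y \<longleftrightarrow> g x = g y"
    proof
      assume "coset K x = coset K y"
      hence *: "x - y \<in> K" by (simp add: coset_eq_iff[OF K])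
      hence c: "coset H x = coset H y" using sub by (auto simp: coset_eq_iff[OF H])
      have "(x - rep x) - (y - rep y) = x - y" using rep_cong[OF c] by simp
      with * have "coset K (x - rep x) = coset K (y - rep y)" by (simp add: coset_eq_iff[OF K])
      with c show "g x = g y" by (simp add: g_def)
    next
      assume "g x = g y"
      hence c: "coset H x = coset H y" and *: "(x - rep x) - (y - rep y) \<in> K"
        by (auto simp: g_def coset_eq_iff[OF K])
      with rep_cong[OF c] show "coset K x = coset K y" by (simp add: coset_eq_iff[OF K])
    qed
  qed
  also have "g ` G = (coset H ` G) \<times> (coset K ` H)"
  proof (intro equalityI subsetI)
    fix z assume "z \<in> (coset H ` G) \<times> (coset K ` H)"
    then obtain x y where xy: "x \<in> G" "y \<in> H" "z = (coset H x, coset K y)" by auto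
    define w where "w = rep x + y"
    have w: "w \<in> G" using xy rep sub addgrpD(4)[OF G] by (auto simp: w_def)
    have "w - rep x \<in> H" using xy by (simp add: w_def)
    hence c: "coset H w = coset H x"
      using rep(2)[OF xy(1)] coset_eq_iff[OF H, of w "rep x"] by simp
    have "w - rep w = y" using rep_cong[OF c] by (simp add: w_def)
    hence "g w = z" using c xy by (simp add: g_def)
    with w show "z \<in> g ` G" by blast
  qed (use repH in \<open>auto simp: g_def\<close>)
  finally show ?thesis by (simp add: idx_def card_cartesian_product)
qed

lemma idx_self: "addgrp G \<Longrightarrow> idx G G = 1"
proof -
  assume G: "addgrp G"
  have "coset G ` G = {coset G 0}"
    using addgrpD(1)[OF G] addgrpD(2)[OF G] coset_eq_iff[OF G] by blast
  thus ?thesis by (simp add: idx_def)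
qed

lemma idx_eq_1_iff:
  assumes "addgrp G" "addgrp H" "H \<subseteq> G"
  shows "idx G H = 1 \<longleftrightarrow> H = G"
proof
  assume "idx G H = 1"
  then obtain c where c: "coset H ` G = {c}" by (auto simp: idx_def card_1_singleton_iff)
  have "x \<in> H" if "x \<in> G" for x
  proof -
    have "coset H x = coset H 0" using c that addgrpD(1)[OF assms(1)] by blast
    thus ?thesis using coset_eq_iff[OF assms(2)] by simp
  qed
  with assms show "H = G" by blast
qed (use assms idx_self in auto)

text \<open>Lagrange's theorem for the quotient group: translation by \<open>x\<close> permutes the
  cosets, so adding up representatives before and after the translation shows that the index times
  \<open>x\<close> is trivial modulo \<open>H\<close>. For infinite index the factor is 0.\<close>

lemma idx_times_mem:
  fixes G H :: "'a::comm_ring_1 set"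
  assumes G: "addgrp G" and H: "addgrp H" "H \<subseteq> G" and x: "x \<in> G"
  shows "of_nat (idx G H) * x \<in> H"
proof (cases "finite (coset H ` G)")
  case False
  thus ?thesis using addgrpD(1)[OF H(1)] by (simp add: idx_def)
next
  case fin: True
  let ?C = "coset H ` G"
  define rep where "rep = (\<lambda>c. SOME y. y \<in> G \<and> coset H y = c)"
  have rep: "rep c \<in> G" "coset H (rep c) = c" if "c \<in> ?C" for c
  proof -
    have "\<exists>y. y \<in> G \<and> coset H y = c" using that by blast
    from someI_ex[OF this] show "rep c \<in> G" "coset H (rep c) = c" by (simp_all add: rep_def)
  qed
  define t where "t = (\<lambda>c. coset H (rep c + x))"
  have t: "t c \<in> ?C" if "c \<in> ?C" for c
    using rep[OF that] x addgrpD(4)[OF G] by (auto simp: t_def)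
  have "inj_on t ?C"
  proof (rule inj_onI)
    fix c d assume cd: "c \<in> ?C" "d \<in> ?C" "t c = t d"
    hence "rep c - rep d \<in> H" by (simp add: t_def coset_eq_iff[OF H(1)])
    hence "coset H (rep c) = coset H (rep d)" by (simp only: coset_eq_iff[OF H(1)])
    thus "c = d" using rep(2)[OF cd(1)] rep(2)[OF cd(2)] by simp
  qed
  hence "bij_betw t ?C ?C"
    using endo_inj_surj[OF fin, of t] t by (simp add: bij_betw_def image_subset_iff)
  hence "(\<Sum>c\<in>?C. rep (t c)) = (\<Sum>c\<in>?C. rep c)"
    by (rule sum.reindex_bij_betw)
  hence "(\<Sum>c\<in>?C. rep c + x - rep (t c)) = of_nat (card ?C) * x"
    by (simp add: sum_subtractf sum.distrib)
  moreover have "rep c + x - rep (t c) \<in> H" if "c \<in> ?C" for c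
    using rep(2)[OF t[OF that]] coset_eq_iff[OF H(1), of "rep c + x" "rep (t c)"] by (simp add: t_def)
  hence "(\<Sum>c\<in>?C. rep c + x - rep (t c)) \<in> H"
  proof -
    have "(\<Sum>c\<in>D. rep c + x - rep (t c)) \<in> H" if "D \<subseteq> ?C" for D
      using finite_subset[OF that fin] that
      by (induction D) (auto intro: addgrpD[OF H(1)] \<open>\<And>c. c \<in> ?C \<Longrightarrow> rep c + x - rep (t c) \<in> H\<close>)
    thus ?thesis by blast
  qed
  ultimately show ?thesis by (simp add: idx_def)
qed

subsection \<open>Ideals of a given index\<close>

definition unit_subring :: "'a::comm_ring_1 set \<Rightarrow> bool" where
  "unit_subring A \<longleftrightarrow> 1 \<in> A \<and> addgrp A \<and> (\<forall>x\<in>A. \<forall>y\<in>A. x * y \<in> A)"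

definition ideal_of :: "'a::comm_ring_1 set \<Rightarrow> 'a set \<Rightarrow> bool" where
  "ideal_of A I \<longleftrightarrow> addgrp I \<and> I \<subseteq> A \<and> (\<forall>a\<in>A. \<forall>x\<in>I. a * x \<in> I)"

definition principal_ideal :: "'a::comm_ring_1 set \<Rightarrow> 'a \<Rightarrow> 'a set" where
  "principal_ideal A x = (\<lambda>s. x * s) ` A"

lemma unit_subringD:
  assumes "unit_subring A"
  shows "0 \<in> A" "1 \<in> A" "x \<in> A \<Longrightarrow> y \<in> A \<Longrightarrow> x * y \<in> A"
    "x \<in> A \<Longrightarrow> y \<in> A \<Longrightarrow> x + y \<in> A" "x \<in> A \<Longrightarrow> y \<in> A \<Longrightarrow> x - y \<in> A" "x \<in> A \<Longrightarrow> - x \<in> A"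
    "x \<in> A \<Longrightarrow> x ^ n \<in> A" "of_nat m \<in> A" "of_int k \<in> A" "numeral w \<in> A" "addgrp A"
proof -
  have A: "addgrp A" and 1: "1 \<in> A" and m: "\<And>x y. x \<in> A \<Longrightarrow> y \<in> A \<Longrightarrow> x * y \<in> A"
    using assms by (auto simp: unit_subring_def)
  show 0: "0 \<in> A" and "1 \<in> A" "addgrp A" "x \<in> A \<Longrightarrow> y \<in> A \<Longrightarrow> x * y \<in> A"
    "x \<in> A \<Longrightarrow> y \<in> A \<Longrightarrow> x + y \<in> A" "x \<in> A \<Longrightarrow> y \<in> A \<Longrightarrow> x - y \<in> A" "x \<in> A \<Longrightarrow> - x \<in> A"
    using addgrpD[OF A] A 1 m by auto
  show "x \<in> A \<Longrightarrow> x ^ n \<in> A"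
    using 1 m by (induction n) auto
  show nat: "of_nat m \<in> A" for m
    using 0 1 addgrpD(4)[OF A] by (induction m) auto
  show "of_int k \<in> A"
    using nat addgrpD(3)[OF A] by (cases k) (auto simp del: of_nat_Suc)
  show "numeral w \<in> A"
    using nat[of "numeral w"] by simp
qed

lemma ideal_ofD:
  assumes "ideal_of A I"
  shows "addgrp I" "0 \<in> I" "x \<in> I \<Longrightarrow> y \<in> I \<Longrightarrow> x + y \<in> I" "x \<in> I \<Longrightarrow> y \<in> I \<Longrightarrow> x - y \<in> I"
    "x \<in> I \<Longrightarrow> - x \<in> I" "a \<in> A \<Longrightarrow> x \<in> I \<Longrightarrow> a * x \<in> I" "a \<in> A \<Longrightarrow> x \<in> I \<Longrightarrow> x * a \<in> I" "x \<in> I \<Longrightarrow> x \<in> A"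
proof -
  have I: "addgrp I" "I \<subseteq> A" and m: "\<And>a x. a \<in> A \<Longrightarrow> x \<in> I \<Longrightarrow> a * x \<in> I"
    using assms by (auto simp: ideal_of_def)
  show "addgrp I" "0 \<in> I" "x \<in> I \<Longrightarrow> y \<in> I \<Longrightarrow> x + y \<in> I" "x \<in> I \<Longrightarrow> y \<in> I \<Longrightarrow> x - y \<in> I"
    "x \<in> I \<Longrightarrow> - x \<in> I" "x \<in> I \<Longrightarrow> x \<in> A"
    using addgrpD[OF I(1)] I by auto
  show "a \<in> A \<Longrightarrow> x \<in> I \<Longrightarrow> a * x \<in> I" by (rule m)
  thus "a \<in> A \<Longrightarrow> x \<in> I \<Longrightarrow> x * a \<in> I" by (simp add: mult.commute)
qed

lemma ideal_of_eqI_1: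
  assumes "ideal_of A I" "1 \<in> I"
  shows "I = A"
proof
  show "A \<subseteq> I" using ideal_ofD(6)[OF assms(1) _ assms(2)] by force
qed (use ideal_ofD(8)[OF assms(1)] in auto)

lemma ideal_of_principal:
  assumes A: "unit_subring A" and x: "x \<in> A"
  shows "ideal_of A (principal_ideal A x)"
  unfolding ideal_of_def addgrp_def principal_ideal_def
proof (intro conjI ballI)
  show "0 \<in> (*) x ` A" using unit_subringD(1)[OF A] by force
  show "(*) x ` A \<subseteq> A" using unit_subringD(3)[OF A x] by auto
next
  fix u v assume "u \<in> (*) x ` A" "v \<in> (*) x ` A"
  then obtain s t where "s \<in> A" "t \<in> A" "u = x * s" "v = x * t" by blast
  hence "u - v = x * (s - t)" "s - t \<in> A" using unit_subringD(5)[OF A] by (auto simp: algebra_simps)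
  thus "u - v \<in> (*) x ` A" by blast
next
  fix a u assume "a \<in> A" "u \<in> (*) x ` A"
  then obtain s where "s \<in> A" "u = x * s" by blast
  hence "a * u = x * (a * s)" "a * s \<in> A" using unit_subringD(3)[OF A] \<open>a \<in> A\<close> by (auto simp: algebra_simps)
  thus "a * u \<in> (*) x ` A" by blast
qed

lemma principal_self: "unit_subring A \<Longrightarrow> x \<in> principal_ideal A x"
  using unit_subringD(2)[of A] by (force simp: principal_ideal_def)

lemma principal_le_ideal: "ideal_of A I \<Longrightarrow> x \<in> I \<Longrightarrow> principal_ideal A x \<subseteq> I"
  using ideal_ofD(7)[of A I] by (auto simp: principal_ideal_def)

text \<open>Correspondence theorem for the map from \<open>P\<close> to \<open>A\<close> modulo
  \<open>M\<close>: taking preimages is inverse to J \<mapsto> h(J) + M. It is applied to the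
  evaluation of integer polynomials modulo an odd number and to the inclusion of the ring of
  integers into its localisation at 2.\<close>

lemma ideal_correspondence:
  fixes P :: "'a::comm_ring_1 set" and A :: "'b::comm_ring_1 set"
  assumes P: "unit_subring P" and A: "unit_subring A" and M: "ideal_of A M"
    and h_diff: "\<And>x y. x \<in> P \<Longrightarrow> y \<in> P \<Longrightarrow> h (x - y) = h x - h y"
    and h_mult: "\<And>x y. x \<in> P \<Longrightarrow> y \<in> P \<Longrightarrow> h (x * y) = h x * h y"
    and hA: "h ` P \<subseteq> A" and surj: "\<And>a. a \<in> A \<Longrightarrow> \<exists>p\<in>P. a - h p \<in> M"
  shows "{I. ideal_of A I \<and> M \<subseteq> I \<and> idx A I = n} \<approx> {J. ideal_of P J \<and> {p\<in>P. h p \<in> M} \<subseteq> J \<and> idx P J = n}"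
    (is "?L \<approx> ?R")
proof -
  define f where "f = (\<lambda>I. {p\<in>P. h p \<in> I})"
  define g where "g = (\<lambda>J. {a\<in>A. \<exists>p\<in>J. a - h p \<in> M})"
  have h0: "h 0 = 0"
    using h_diff[of 0 0] unit_subringD(1)[OF P] by simp
  have f_ideal: "ideal_of P (f I)" if I: "ideal_of A I" for I
    unfolding ideal_of_def addgrp_def f_def
    using ideal_ofD[OF I] unit_subringD[OF P] h0 hA by (auto simp: h_diff h_mult)
  have idx_f: "idx P (f I) = idx A I" if I: "ideal_of A I" "M \<subseteq> I" for I
    unfolding f_def
  proof (rule idx_vimage)
    show "\<exists>p\<in>P. a - h p \<in> I" if "a \<in> A" for a using surj[OF that] I by blast
  qed (use unit_subringD(11)[OF P] ideal_ofD(1)[OF I(1)] h_diff hA in auto)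
  have g_ideal: "ideal_of A (g J)" "M \<subseteq> g J" if J: "ideal_of P J" for J
  proof -
    have "0 \<in> J" using ideal_ofD(2)[OF J] .
    thus "M \<subseteq> g J" using ideal_ofD(8)[OF M] h0 by (auto simp: g_def intro!: bexI[of _ 0])
    show "ideal_of A (g J)"
      unfolding ideal_of_def addgrp_def
    proof (intro conjI ballI)
      show "0 \<in> g J" using ideal_ofD(2)[OF M] \<open>M \<subseteq> g J\<close> by blast
      show "g J \<subseteq> A" by (auto simp: g_def)
    next
      fix a b assume "a \<in> g J" "b \<in> g J"
      then obtain p q where *: "a \<in> A" "b \<in> A" "p \<in> J" "q \<in> J" "a - h p \<in> M" "b - h q \<in> M"
        by (auto simp: g_def)
      have "(a - b) - h (p - q) = (a - h p) - (b - h q)"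
        using * ideal_ofD(8)[OF J] by (simp add: h_diff)
      hence "(a - b) - h (p - q) \<in> M" using * ideal_ofD(4)[OF M] by metis
      thus "a - b \<in> g J" using * ideal_ofD(4)[OF J] unit_subringD(5)[OF A] by (auto simp: g_def)
    next
      fix a b assume "a \<in> A" "b \<in> g J"
      then obtain q where *: "a \<in> A" "b \<in> A" "q \<in> J" "b - h q \<in> M"
        by (auto simp: g_def)
      obtain p where p: "p \<in> P" "a - h p \<in> M" using surj[OF *(1)] by blast
      have q: "q \<in> P" "h q \<in> A" using * ideal_ofD(8)[OF J] hA by auto
      have "a * b - h (p * q) = a * (b - h q) + h q * (a - h p)"
        using p q by (simp add: h_mult algebra_simps)
      also have "\<dots> \<in> M"
        by (rule ideal_ofD(3)[OF M ideal_ofD(6)[OF M *(1,4)] ideal_ofD(6)[OF M q(2) p(2)]])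
      finally show "a * b \<in> g J"
        using * p ideal_ofD(6)[OF J] unit_subringD(3)[OF A] by (auto simp: g_def)
    qed
  qed
  have fg: "f (g J) = J" if J: "ideal_of P J" "{p\<in>P. h p \<in> M} \<subseteq> J" for J
  proof (intro equalityI subsetI)
    fix p assume "p \<in> f (g J)"
    then obtain q where *: "p \<in> P" "q \<in> J" "h p - h q \<in> M" by (auto simp: f_def g_def)
    hence "q \<in> P" using ideal_ofD(8)[OF J(1)] by blast
    hence "p - q \<in> J" using J(2) * unit_subringD(5)[OF P] by (auto simp: h_diff)
    from ideal_ofD(3)[OF J(1) this \<open>q \<in> J\<close>] show "p \<in> J" by simp
  next
    fix p assume "p \<in> J"
    thus "p \<in> f (g J)" using ideal_ofD(8)[OF J(1)] hA ideal_ofD(2)[OF M]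
      by (auto simp: f_def g_def intro!: bexI[of _ p])
  qed
  have gf: "g (f I) = I" if I: "ideal_of A I" "M \<subseteq> I" for I
  proof (intro equalityI subsetI)
    fix a assume "a \<in> g (f I)"
    then obtain p where "h p \<in> I" "a - h p \<in> M" by (auto simp: f_def g_def)
    hence "(a - h p) + h p \<in> I" using I ideal_ofD(3)[OF I(1)] by blast
    thus "a \<in> I" by simp
  next
    fix a assume a: "a \<in> I"
    hence "a \<in> A" using ideal_ofD(8)[OF I(1)] by blast
    then obtain p where p: "p \<in> P" "a - h p \<in> M" using surj by blast
    hence "a - (a - h p) \<in> I" using I a ideal_ofD(4)[OF I(1)] by blast
    thus "a \<in> g (f I)" using p \<open>a \<in> A\<close> by (auto simp: f_def g_def)
  qed
  have "bij_betw f ?L ?R"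
  proof (rule bij_betw_byWitness[where f' = g])
    show "f ` ?L \<subseteq> ?R" using f_ideal idx_f by (auto simp: f_def)
    show "g ` ?R \<subseteq> ?L"
    proof (intro image_subsetI CollectI conjI)
      fix J assume J: "J \<in> ?R"
      show "ideal_of A (g J)" "M \<subseteq> g J" using g_ideal J by blast+
      from idx_f[OF this] show "idx A (g J) = n" using fg J by simp
    qed
  qed (use fg gf in blast)+
  thus ?thesis unfolding eqpoll_def by blast
qed

lemma idx_mem_ideal:
  assumes R: "unit_subring R" and I: "ideal_of R I" and x: "x \<in> R"
  shows "of_nat (idx R I) * x \<in> I"
  using idx_times_mem[OF unit_subringD(11)[OF R] ideal_ofD(1)[OF I] _ x] ideal_ofD(8)[OF I] by blast

lemma ideal_of_sum:
  assumes "ideal_of R I" "ideal_of R J" "unit_subring R"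
  shows "ideal_of R {x + y | x y. x \<in> I \<and> y \<in> J}"
  unfolding ideal_of_def addgrp_def
proof (intro conjI ballI)
  show "0 \<in> {x + y | x y. x \<in> I \<and> y \<in> J}"
    using ideal_ofD(2)[OF assms(1)] ideal_ofD(2)[OF assms(2)] by force
  show "{x + y | x y. x \<in> I \<and> y \<in> J} \<subseteq> R"
    using ideal_ofD(8)[OF assms(1)] ideal_ofD(8)[OF assms(2)] unit_subringD(4)[OF assms(3)] by blast
next
  fix u v assume "u \<in> {x + y | x y. x \<in> I \<and> y \<in> J}" "v \<in> {x + y | x y. x \<in> I \<and> y \<in> J}"
  then obtain x y x' y' where "x \<in> I" "y \<in> J" "x' \<in> I" "y' \<in> J" "u = x + y" "v = x' + y'" by blast
  moreover from this have "u - v = (x - x') + (y - y')" by simp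
  ultimately show "u - v \<in> {x + y | x y. x \<in> I \<and> y \<in> J}"
    using ideal_ofD(4)[OF assms(1)] ideal_ofD(4)[OF assms(2)] by blast
next
  fix a u assume "a \<in> R" "u \<in> {x + y | x y. x \<in> I \<and> y \<in> J}"
  then obtain x y where "x \<in> I" "y \<in> J" "u = x + y" by blast
  moreover from this have "a * u = a * x + a * y" by (simp add: ring_distribs)
  ultimately show "a * u \<in> {x + y | x y. x \<in> I \<and> y \<in> J}"
    using ideal_ofD(6)[OF assms(1) \<open>a \<in> R\<close>] ideal_ofD(6)[OF assms(2) \<open>a \<in> R\<close>] by blast
qed

lemma ideal_of_Int: "ideal_of R I \<Longrightarrow> ideal_of R J \<Longrightarrow> ideal_of R (I \<inter> J)"
  by (auto simp: ideal_of_def addgrp_def)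

text \<open>Since the two ideals add up to \<open>R\<close>, the inclusion of \<open>I\<close>
  induces an isomorphism from I modulo the intersection onto R modulo J.\<close>

lemma idx_Int_comaximal:
  assumes R: "unit_subring R" and I: "ideal_of R I" and J: "ideal_of R J"
    and uv: "u \<in> I" "v \<in> J" "u + v = 1"
  shows "idx R (I \<inter> J) = idx R I * idx R J"
proof -
  have "idx I {p\<in>I. id p \<in> J} = idx R J"
  proof (rule idx_vimage)
    fix a assume a: "a \<in> R"
    have "a - id (a * u) = a * (u + v) - a * u" using uv(3) by simp
    also have "\<dots> = a * v" by (simp add: algebra_simps)
    finally show "\<exists>p\<in>I. a - id p \<in> J"
      using ideal_ofD(6)[OF I a uv(1)] ideal_ofD(6)[OF J a uv(2)] by metis
  qed (use ideal_ofD[OF I] ideal_ofD[OF J] in auto)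
  moreover have "{p\<in>I. id p \<in> J} = I \<inter> J" by auto
  ultimately have "idx I (I \<inter> J) = idx R J" by simp
  moreover have "idx R (I \<inter> J) = idx R I * idx I (I \<inter> J)"
    using ideal_ofD(8)[OF I] by (intro idx_mult unit_subringD(11)[OF R] ideal_ofD(1)[OF I]
        ideal_ofD(1)[OF ideal_of_Int[OF I J]]) auto
  ultimately show ?thesis by simp
qed

text \<open>Chinese remainder theorem for ideals: \<open>I\<close> goes to the pair I + aR, I + bR,
  written \<open>S a I\<close> and \<open>S b I\<close>, and the inverse map is the intersection.
  The assumptions on the indices of aR and bR bound the prime factors of the indices of the two
  components.\<close>

lemma ideals_of_coprime_index:
  fixes R :: "'a::comm_ring_1 set"
  assumes R: "unit_subring R" and ab: "Rings.coprime a b" "a > 0" "b > 0"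
    and a: "idx R (principal_ideal R (of_nat a)) = a ^ d" and b: "idx R (principal_ideal R (of_nat b)) = b ^ d"
  shows "{I. ideal_of R I \<and> idx R I = a * b} \<approx>
    {I. ideal_of R I \<and> idx R I = a} \<times> {I. ideal_of R I \<and> idx R I = b}"
    (is "?L \<approx> ?A \<times> ?B")
proof -
  define S where "S = (\<lambda>c I. {x + y | x y. x \<in> I \<and> y \<in> principal_ideal R (of_nat c)})"
  have pr: "ideal_of R (principal_ideal R (of_nat c))" for c
    using ideal_of_principal[OF R unit_subringD(8)[OF R]] .
  have S_ideal: "ideal_of R (S c I)" if "ideal_of R I" for c I
    unfolding S_def by (rule ideal_of_sum[OF that pr R])
  have S_sub: "I \<subseteq> S c I" "principal_ideal R (of_nat c) \<subseteq> S c I" if "ideal_of R I" for c I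
    using ideal_ofD(2)[OF that] ideal_ofD(2)[OF pr[of c]] unfolding S_def by force+
  have idx_S: "idx R (S c I) dvd c ^ d"
    if I: "ideal_of R I" and c: "idx R (principal_ideal R (of_nat c)) = c ^ d" for c I
    using idx_mult[OF unit_subringD(11)[OF R] ideal_ofD(1)[OF S_ideal[OF I]] ideal_ofD(1)[OF pr] S_sub(2)[OF I], of c]
      ideal_ofD(8)[OF S_ideal[OF I]] c by (metis dvd_triv_left subsetI)
  obtain u v where uv: "u * int a + v * int b = 1"
    using ab(1) by (metis bezout_int coprime_int_iff coprime_imp_gcd_eq_1)
  hence uv': "of_int u * of_nat a + of_int v * of_nat b = (1::'a)"
    by (metis of_int_add of_int_mult of_int_of_nat_eq of_int_1)
  have c_mem: "of_nat c * x \<in> I" if "ideal_of R I" "idx R I = c" "x \<in> R" for c x I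
    using idx_mem_ideal[OF R that(1,3)] that(2) by simp
  have pr_mem: "of_nat c * x \<in> principal_ideal R (of_nat c)" if "x \<in> R" for c x
    using that by (auto simp: principal_ideal_def)
  have split: "of_int u * (of_nat a * x) + of_int v * (of_nat b * x) = x" for x :: 'a
    using uv' by (metis (no_types) mult.assoc ring_distribs(2) mult_1)
  have comax: "\<exists>u'\<in>I. \<exists>v'\<in>J. u' + v' = 1"
    if I: "ideal_of R I" "principal_ideal R (of_nat a) \<subseteq> I" and J: "ideal_of R J" "principal_ideal R (of_nat b) \<subseteq> J" for I J
    using split[of 1] ideal_ofD(6)[OF I(1) unit_subringD(9)[OF R, of u] subsetD[OF I(2) pr_mem[OF unit_subringD(2)[OF R]]]]
      ideal_ofD(6)[OF J(1) unit_subringD(9)[OF R, of v] subsetD[OF J(2) pr_mem[OF unit_subringD(2)[OF R]]]]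
    by blast
  have idx_SS: "idx R (S a I) = a \<and> idx R (S b I) = b \<and> S a I \<inter> S b I = I"
    if I: "ideal_of R I" "idx R I = a * b" for I
  proof -
    have eq: "S a I \<inter> S b I = I"
    proof (intro equalityI subsetI)
      fix x assume x: "x \<in> S a I \<inter> S b I"
      then obtain i s j t where *: "i \<in> I" "s \<in> R" "x = i + of_nat a * s" "j \<in> I" "t \<in> R" "x = j + of_nat b * t"
        by (auto simp: S_def principal_ideal_def)
      have ab_mem: "of_nat a * (of_nat b * y) \<in> I" "of_nat b * (of_nat a * y) \<in> I" if "y \<in> R" for y
        using c_mem[OF I that] by (simp_all add: mult_ac)
      have "of_nat a * x = of_nat a * j + of_nat a * (of_nat b * t)"
        by (simp add: *(6) ring_distribs)
      hence 1: "of_nat a * x \<in> I"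
        using ideal_ofD(3)[OF I(1)] ideal_ofD(6)[OF I(1) unit_subringD(8)[OF R]] * ab_mem by metis
      have "of_nat b * x = of_nat b * i + of_nat b * (of_nat a * s)"
        by (simp add: *(3) ring_distribs)
      hence 2: "of_nat b * x \<in> I"
        using ideal_ofD(3)[OF I(1)] ideal_ofD(6)[OF I(1) unit_subringD(8)[OF R]] * ab_mem by metis
      have "of_int u * (of_nat a * x) + of_int v * (of_nat b * x) \<in> I"
        using 1 2 by (intro ideal_ofD(3)[OF I(1)] ideal_ofD(6)[OF I(1) unit_subringD(9)[OF R]])
      thus "x \<in> I" by (simp only: split)
    qed (use S_sub[OF I(1)] in blast)
    obtain u' v' where "u' \<in> S a I" "v' \<in> S b I" "u' + v' = 1"
      using comax[OF S_ideal[OF I(1)] S_sub(2)[OF I(1)] S_ideal[OF I(1)] S_sub(2)[OF I(1)]] by blast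
    from idx_Int_comaximal[OF R S_ideal[OF I(1)] S_ideal[OF I(1)] this]
    have prod: "idx R (S a I) * idx R (S b I) = a * b" by (simp add: eq I)
    \<comment> \<open>The two indices divide powers of \<open>a\<close> and of \<open>b\<close>. As
      their product is a b with \<open>a\<close> and \<open>b\<close> coprime, they must be
      \<open>a\<close> and \<open>b\<close> themselves.\<close>
    have cop: "Rings.coprime (idx R (S a I)) b" "Rings.coprime a (idx R (S b I))"
      using idx_S[OF I(1) a] idx_S[OF I(1) b] ab(1)
      by (meson coprime_divisors coprime_power_left_iff coprime_power_right_iff dvd_refl)+
    have "idx R (S a I) dvd a"
      using prod cop(1) by (metis coprime_dvd_mult_left_iff dvd_triv_left)
    moreover have "a dvd idx R (S a I)"
      using prod cop(2) by (metis coprime_dvd_mult_left_iff dvd_triv_left)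
    ultimately have "idx R (S a I) = a" by (rule dvd_antisym)
    with prod ab eq show ?thesis by simp
  qed
  have I_prod: "ideal_of R (I \<inter> J) \<and> idx R (I \<inter> J) = a * b \<and> S a (I \<inter> J) = I \<and> S b (I \<inter> J) = J"
    if I: "ideal_of R I" "idx R I = a" and J: "ideal_of R J" "idx R J = b" for I J
  proof (intro conjI)
    have sub: "principal_ideal R (of_nat a) \<subseteq> I" "principal_ideal R (of_nat b) \<subseteq> J"
      using c_mem[OF I] c_mem[OF J] by (auto simp: principal_ideal_def)
    show "ideal_of R (I \<inter> J)" using ideal_of_Int I J by blast
    obtain u' v' where "u' \<in> I" "v' \<in> J" "u' + v' = 1"
      using comax[OF I(1) sub(1) J(1) sub(2)] by blast
    from idx_Int_comaximal[OF R I(1) J(1) this] show "idx R (I \<inter> J) = a * b"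
      by (simp add: I J)
    show "S a (I \<inter> J) = I"
    proof (intro equalityI subsetI)
      fix x assume "x \<in> S a (I \<inter> J)"
      thus "x \<in> I" using ideal_ofD(3)[OF I(1)] sub by (auto simp: S_def)
    next
      fix x assume x: "x \<in> I"
      hence xR: "x \<in> R" using ideal_ofD(8)[OF I(1)] by blast
      have "of_int v * (of_nat b * x) \<in> I \<inter> J"
        using x c_mem[OF J xR] ideal_ofD(6)[OF I(1)] ideal_ofD(6)[OF J(1)] unit_subringD(8,9)[OF R] by blast
      moreover have "of_int u * (of_nat a * x) \<in> principal_ideal R (of_nat a)"
        using ideal_ofD(6)[OF pr unit_subringD(9)[OF R] pr_mem[OF xR]] .
      moreover have "x = of_int v * (of_nat b * x) + of_int u * (of_nat a * x)"
        using split[of x] by (simp add: add.commute)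
      ultimately show "x \<in> S a (I \<inter> J)"
        unfolding S_def by blast
    qed
    show "S b (I \<inter> J) = J"
    proof (intro equalityI subsetI)
      fix x assume "x \<in> S b (I \<inter> J)"
      thus "x \<in> J" using ideal_ofD(3)[OF J(1)] sub by (auto simp: S_def)
    next
      fix x assume x: "x \<in> J"
      hence xR: "x \<in> R" using ideal_ofD(8)[OF J(1)] by blast
      have "of_int u * (of_nat a * x) \<in> I \<inter> J"
        using x c_mem[OF I xR] ideal_ofD(6)[OF I(1)] ideal_ofD(6)[OF J(1)] unit_subringD(8,9)[OF R] by blast
      moreover have "of_int v * (of_nat b * x) \<in> principal_ideal R (of_nat b)"
        using ideal_ofD(6)[OF pr unit_subringD(9)[OF R] pr_mem[OF xR]] .
      ultimately show "x \<in> S b (I \<inter> J)"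
        unfolding S_def using split[of x, symmetric] by blast
    qed
  qed
  have "bij_betw (\<lambda>I. (S a I, S b I)) ?L (?A \<times> ?B)"
    by (rule bij_betw_byWitness[where f' = "\<lambda>(I, J). I \<inter> J"])
       (use idx_SS I_prod S_ideal in auto)
  thus ?thesis unfolding eqpoll_def by blast
qed

subsection \<open>Dedekind zeta functions and ideal counts\<close>

definition integers_of :: "complex set \<Rightarrow> complex set" where
  "integers_of K = {x \<in> K. algebraic_int x}"

lemma unit_subring_integers_of:
  assumes "unit_subring K"
  shows "unit_subring (integers_of K)"
  unfolding unit_subring_def addgrp_def integers_of_def
  using unit_subringD(1,2,3,5)[OF assms] algebraic_int_diff algebraic_int_mult int_imp_algebraic_int[of 1]
  by simp

lemma ring_of_integers_simps:
  "carrier (ring_of_integers K) = integers_of K"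
  "x \<otimes>\<^bsub>ring_of_integers K\<^esub> y = x * y"
  "x \<oplus>\<^bsub>ring_of_integers K\<^esub> y = x + y"
  "\<one>\<^bsub>ring_of_integers K\<^esub> = 1" "\<zero>\<^bsub>ring_of_integers K\<^esub> = 0"
  by (simp_all add: ring_of_integers_def integers_of_def ring_of_type_algebra_def)

lemma cring_ring_of_integers:
  assumes "unit_subring K"
  shows "cring (ring_of_integers K)"
proof -
  note R = unit_subringD[OF unit_subring_integers_of[OF assms]]
  show ?thesis
  proof (intro cringI abelian_groupI comm_monoidI)
    fix x assume "x \<in> carrier (ring_of_integers K)"
    thus "\<exists>y\<in>carrier (ring_of_integers K). y \<oplus>\<^bsub>ring_of_integers K\<^esub> x = \<zero>\<^bsub>ring_of_integers K\<^esub>"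
      using R(6) by (intro bexI[of _ "-x"]) (auto simp: ring_of_integers_simps)
  qed (use R in \<open>auto simp: ring_of_integers_simps algebra_simps\<close>)
qed

lemma a_inv_ring_of_integers:
  assumes "unit_subring K" "x \<in> integers_of K"
  shows "\<ominus>\<^bsub>ring_of_integers K\<^esub> x = - x"
proof -
  interpret cring "ring_of_integers K" by (rule cring_ring_of_integers[OF assms(1)])
  show ?thesis
    using unit_subringD(6)[OF unit_subring_integers_of[OF assms(1)] assms(2)] assms(2)
    by (intro minus_equality) (auto simp: ring_of_integers_simps)
qed

lemma ideal_ring_of_integers_iff:
  assumes K: "unit_subring K"
  shows "ideal I (ring_of_integers K) \<longleftrightarrow> ideal_of (integers_of K) I"
proof
  interpret cring "ring_of_integers K" by (rule cring_ring_of_integers[OF K])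
  assume "ideal I (ring_of_integers K)"
  then interpret I: ideal I "ring_of_integers K" .
  have "I \<subseteq> integers_of K" using I.a_subset by (simp add: ring_of_integers_simps)
  moreover have "0 \<in> I" using I.zero_closed by (simp add: ring_of_integers_simps)
  moreover have "x - y \<in> I" if "x \<in> I" "y \<in> I" for x y
  proof -
    have "x \<oplus>\<^bsub>ring_of_integers K\<^esub> (\<ominus>\<^bsub>ring_of_integers K\<^esub> y) \<in> I"
      using that by (intro I.a_closed I.a_inv_closed)
    moreover have "y \<in> integers_of K" using that \<open>I \<subseteq> integers_of K\<close> by blast
    ultimately show ?thesis by (simp only: a_inv_ring_of_integers[OF K] ring_of_integers_simps add_uminus_conv_diff)
  qed
  moreover have "a * x \<in> I" if "a \<in> integers_of K" "x \<in> I" for a x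
    using I.I_l_closed[of x a] that by (simp only: ring_of_integers_simps)
  ultimately show "ideal_of (integers_of K) I"
    unfolding ideal_of_def addgrp_def by blast
next
  assume I: "ideal_of (integers_of K) I"
  show "ideal I (ring_of_integers K)"
  proof (rule idealI)
    show "ring (ring_of_integers K)" using cring_ring_of_integers[OF K] by (rule cring.axioms)
    show "subgroup I (add_monoid (ring_of_integers K))"
    proof (unfold_locales)
      fix x assume x: "x \<in> I"
      hence "inv\<^bsub>add_monoid (ring_of_integers K)\<^esub> x = - x"
        using a_inv_ring_of_integers[OF K ideal_ofD(8)[OF I x]] by (simp only: a_inv_def)
      thus "inv\<^bsub>add_monoid (ring_of_integers K)\<^esub> x \<in> I"
        using ideal_ofD(5)[OF I x] by simp
    qed (use ideal_ofD[OF I] in \<open>auto simp: ring_of_integers_simps\<close>)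
  qed (use ideal_ofD[OF I] in \<open>auto simp: ring_of_integers_simps\<close>)
qed

lemma ideal_norm_eq_idx:
  "ideal_norm K I = idx (integers_of K) I"
proof -
  have "carrier (ring_of_integers K Quot I) = coset I ` integers_of K"
    by (auto simp: FactRing_def A_RCOSETS_def RCOSETS_def r_coset_def coset_def ring_of_integers_simps)
  thus ?thesis by (simp add: ideal_norm_def idx_def)
qed

text \<open>The bijections for the single values of the norm are glued to one bijection between the
  index sets of the two infinite sums; reindexing preserves \<open>infsum\<close> whether or not the
  sum converges. \<open>finK\<close> and \<open>finL\<close> identify the nonzero ideals with those
  of positive \<open>idx\<close>, the value 0 standing for infinite index.\<close>

lemma arithmetically_equivalentI:
  assumes K: "unit_subring K" and L: "unit_subring L"
    and finK: "\<And>I. ideal_of (integers_of K) I \<Longrightarrow> I \<noteq> {0} \<longleftrightarrow> idx (integers_of K) I > 0"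
    and finL: "\<And>I. ideal_of (integers_of L) I \<Longrightarrow> I \<noteq> {0} \<longleftrightarrow> idx (integers_of L) I > 0"
    and count: "\<And>n. n > 0 \<Longrightarrow> {I. ideal_of (integers_of K) I \<and> idx (integers_of K) I = n} \<approx>
      {I. ideal_of (integers_of L) I \<and> idx (integers_of L) I = n}"
  shows "arithmetically_equivalent K L"
proof -
  define A where "A = (\<lambda>K n. {I. ideal_of (integers_of K) I \<and> idx (integers_of K) I = n})"
  have "\<exists>b. \<forall>n>0. bij_betw (b n) (A K n) (A L n)"
    using count unfolding A_def eqpoll_def by metis
  then obtain b where b: "\<And>n. n > 0 \<Longrightarrow> bij_betw (b n) (A K n) (A L n)" by blast
  define g where "g = (\<lambda>I. b (idx (integers_of K) I) I)"
  have norm_g: "idx (integers_of L) (g I) = idx (integers_of K) I" "ideal_of (integers_of L) (g I)"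
    if I: "ideal_of (integers_of K) I" "idx (integers_of K) I > 0" for I
  proof -
    have "I \<in> A K (idx (integers_of K) I)" using I by (simp add: A_def)
    hence "g I \<in> A L (idx (integers_of K) I)"
      using bij_betwE[OF b[OF I(2)]] by (simp add: g_def)
    thus "idx (integers_of L) (g I) = idx (integers_of K) I" "ideal_of (integers_of L) (g I)"
      by (simp_all add: A_def)
  qed
  have bij: "bij_betw g {I. ideal_of (integers_of K) I \<and> idx (integers_of K) I > 0}
      {I. ideal_of (integers_of L) I \<and> idx (integers_of L) I > 0}"
    (is "bij_betw g ?X ?Y")
  proof (intro bij_betw_imageI inj_onI)
    fix I J assume IJ: "I \<in> ?X" "J \<in> ?X" "g I = g J"
    hence n: "idx (integers_of K) I = idx (integers_of K) J" using norm_g by (metis mem_Collect_eq)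
    let ?n = "idx (integers_of K) J"
    have "I \<in> A K ?n" "J \<in> A K ?n" "b ?n I = b ?n J" "?n > 0" using IJ n by (auto simp: A_def g_def)
    thus "I = J" using b[of ?n] by (auto simp: bij_betw_def inj_on_def)
  next
    have "J \<in> g ` ?X" if J: "J \<in> ?Y" for J
    proof -
    let ?n = "idx (integers_of L) J"
    have "J \<in> A L ?n" "?n > 0" using J by (auto simp: A_def)
    then obtain I where "I \<in> A K ?n" "J = b ?n I" using b[of ?n] by (auto simp: bij_betw_def)
    hence "I \<in> ?X" "g I = J" using \<open>?n > 0\<close> by (auto simp: A_def g_def)
    thus "J \<in> g ` ?X" by blast
    qed
    thus "g ` ?X = ?Y" using norm_g by auto
  qed
  have dom: "{I. ideal I (ring_of_integers K) \<and> I \<noteq> {0}} = ?X" "{I. ideal I (ring_of_integers L) \<and> I \<noteq> {0}} = ?Y"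
    using finK finL by (auto simp: ideal_ring_of_integers_iff K L)
  show ?thesis
    unfolding arithmetically_equivalent_def dedekind_zeta_def dom
  proof (intro allI impI)
    fix s :: complex
    have "(\<Sum>\<^sub>\<infinity>I\<in>?Y. 1 / of_nat (ideal_norm L I) powr s) =
        (\<Sum>\<^sub>\<infinity>I\<in>?X. 1 / of_nat (ideal_norm L (g I)) powr s)"
      by (rule infsum_reindex_bij_betw[OF bij, symmetric])
    also have "\<dots> = (\<Sum>\<^sub>\<infinity>I\<in>?X. 1 / of_nat (ideal_norm K I) powr s)"
      using norm_g by (intro infsum_cong) (simp add: ideal_norm_eq_idx)
    finally show "(\<Sum>\<^sub>\<infinity>I\<in>?X. 1 / of_nat (ideal_norm K I) powr s) =
        (\<Sum>\<^sub>\<infinity>I\<in>?Y. 1 / of_nat (ideal_norm L I) powr s)" by simp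
  qed
qed

subsection \<open>The fields generated by eighth roots of 17 and 272\<close>

definition ev :: "complex \<Rightarrow> rat poly \<Rightarrow> complex" where
  "ev x f = poly (map_poly of_rat f) x"

lemma ev_pCons [simp]: "ev x (pCons a f) = of_rat a + x * ev x f"
  by (cases "a = 0 \<and> f = 0") (auto simp: ev_def map_poly_pCons)

lemma ev_0 [simp]: "ev x 0 = 0"
  by (simp add: ev_def)

lemma ev_1 [simp]: "ev x 1 = 1"
  by (simp add: ev_def)

lemma ev_add: "ev x (f + g) = ev x f + ev x g"
proof (induction f arbitrary: g)
  case (pCons a f)
  obtain b g' where g: "g = pCons b g'" by (cases g)
  show ?case by (simp add: g pCons.IH of_rat_add algebra_simps)
qed simp

lemma ev_smult: "ev x (smult a f) = of_rat a * ev x f"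
  by (induction f) (simp_all add: of_rat_mult algebra_simps)

lemma ev_diff: "ev x (f - g) = ev x f - ev x g"
  using ev_add[of x "f - g" g] by simp

lemma ev_mult: "ev x (f * g) = ev x f * ev x g"
  by (induction f) (simp_all add: ev_add ev_smult algebra_simps)

lemma ev_power: "ev x (f ^ n) = ev x f ^ n"
  by (induction n) (simp_all add: ev_mult)

lemma ev_sum: "ev x (\<Sum>i\<in>I. f i) = (\<Sum>i\<in>I. ev x (f i))"
  by (induction I rule: infinite_finite_induct) (simp_all add: ev_add)

lemma ev_monom [simp]: "ev x (Polynomial.monom a n) = of_rat a * x ^ n"
  by (simp add: ev_def map_poly_monom poly_monom)

lemma ev_sum_monom: "ev x (\<Sum>i<n. Polynomial.monom (a i) i) = (\<Sum>i<n. of_rat (a i) * x ^ i)"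
  by (simp add: ev_sum)

text \<open>The eighth power of the denominator divides 17^i with i < 8, and already a single factor
  17 in the denominator would be too many. This keeps 17 out of the denominators of integral
  elements.\<close>

lemma rat_power8_17:
  fixes r :: rat
  assumes "r ^ 8 * 17 ^ i \<in> \<int>" "i < 8"
  shows "r \<in> \<int>"
proof -
  obtain a b where ab: "r = of_int a / of_int b" "b > 0" "Rings.coprime a b"
    by (metis quotient_of_coprime quotient_of_denom_pos quotient_of_div surj_pair)
  from assms obtain z where "r ^ 8 * 17 ^ i = of_int z" by (auto elim: Ints_cases)
  hence "(of_int a :: rat) ^ 8 * 17 ^ i = of_int z * of_int b ^ 8"
    using ab by (simp add: field_simps)
  hence "of_int (a ^ 8 * 17 ^ i) = (of_int (z * b ^ 8) :: rat)" by simp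
  hence eq: "a ^ 8 * 17 ^ i = z * b ^ 8" by (simp only: of_int_eq_iff)
  have "b ^ 8 dvd 17 ^ i"
    using eq ab(3) by (metis coprime_commute coprime_dvd_mult_right_iff coprime_power_left_iff
        coprime_power_right_iff dvd_triv_right)
  have "b = 1"
  proof (rule ccontr)
    assume "b \<noteq> 1"
    then obtain p where p: "Factorial_Ring.prime p" "p dvd b"
      using ab(2) by (metis prime_divisor_exists int_one_le_iff_zero_less linorder_not_le abs_of_pos zdvd1_eq
          less_numeral_extra(3) abs_1)
    hence "p dvd 17 ^ i" using \<open>b ^ 8 dvd 17 ^ i\<close> by (meson dvd_trans dvd_power zero_less_numeral)
    hence "p dvd 17" using p(1) prime_dvd_power by blast
    moreover have "Factorial_Ring.prime (17 :: int)" by simp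
    ultimately have "p = 17" using p(1) primes_dvd_imp_eq by blast
    hence "17 ^ 8 dvd (17 ^ i :: int)"
      using p \<open>b ^ 8 dvd 17 ^ i\<close> by (meson dvd_power_same dvd_trans)
    hence "(17::int) ^ 8 \<le> 17 ^ i" by (intro zdvd_imp_le) auto
    moreover have "(17::int) ^ i < 17 ^ 8" using assms(2) by (intro power_strict_increasing) auto
    ultimately show False by linarith
  qed
  thus ?thesis using ab by simp
qed

text \<open>Both fields at once: \<open>c\<close> is 1 for the first and 16 for the second, and
  \<open>\<beta>\<close> may be any complex eighth root.\<close>

locale octic =
  fixes c :: nat and \<beta> :: complex
  assumes c: "c = 1 \<or> c = 16" and \<beta>8: "\<beta> ^ 8 = of_nat (17 * c)"
begin

definition K :: "complex set" where "K = range (ev \<beta>)"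

abbreviation R :: "complex set" where "R \<equiv> integers_of K"

lemma \<beta>_nz: "\<beta> \<noteq> 0"
  using \<beta>8 c by auto

lemma \<beta>_algint: "algebraic_int \<beta>"
proof (rule algebraic_int_root)
  show "poly (Polynomial.monom 1 8) \<beta> = of_nat (17 * c)" using \<beta>8 by (simp add: poly_monom)
qed (auto simp: coeff_monom degree_monom_eq int_imp_algebraic_int)

lemma KI: "ev \<beta> f \<in> K"
  by (simp add: K_def)

lemma subring_K: "unit_subring K"
  unfolding unit_subring_def addgrp_def
proof (intro conjI ballI)
  show "1 \<in> K" using KI[of 1] by simp
  show "0 \<in> K" using KI[of 0] by simp
  fix x y assume "x \<in> K" "y \<in> K"
  then obtain f g where "x = ev \<beta> f" "y = ev \<beta> g" by (auto simp: K_def)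
  thus "x - y \<in> K" "x * y \<in> K"
    using KI[of "f - g"] KI[of "f * g"] by (simp_all add: ev_diff ev_mult)
qed

lemma of_rat_K: "of_rat q \<in> K"
  using KI[of "[:q:]"] by simp

lemma \<beta>_K: "\<beta> \<in> K"
  using KI[of "[:0, 1:]"] by simp

lemma \<beta>_R: "\<beta> \<in> R"
  using \<beta>_K \<beta>_algint by (simp add: integers_of_def)

lemmas subring_R = unit_subring_integers_of[OF subring_K]

text \<open>The name anticipates irreducibility, which amounts to \<open>independent\<close> below;
  up to there it is only a monic polynomial vanishing at \<open>\<beta>\<close>.\<close>

definition minpol :: "rat poly" where
  "minpol = Polynomial.monom 1 8 - [:of_nat (17 * c):]"

lemma coeff_minpol: "poly.coeff minpol i = (if i = 8 then 1 else if i = 0 then - of_nat (17 * c) else 0)"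
  by (auto simp: minpol_def coeff_monom coeff_pCons split: nat.splits)

lemma degree_minpol: "Polynomial.degree minpol = 8"
proof (rule antisym)
  show "Polynomial.degree minpol \<le> 8" by (rule degree_le) (auto simp: coeff_minpol)
  show "8 \<le> Polynomial.degree minpol" by (rule le_degree) (simp add: coeff_minpol)
qed

lemma ev_minpol: "ev x minpol = x ^ 8 - of_nat (17 * c)"
  by (simp add: minpol_def ev_diff of_rat_mult)

text \<open>Stated for every root \<open>x\<close> of \<open>minpol\<close>, so that the same
  coefficients serve all conjugates.\<close>

lemma reduce:
  assumes "x ^ 8 = \<beta> ^ 8"
  shows "ev x f = (\<Sum>i<8. of_rat (poly.coeff (f mod minpol) i) * x ^ i)"
proof -
  have "f = minpol * (f div minpol) + f mod minpol" by simp
  hence "ev x f = ev x minpol * ev x (f div minpol) + ev x (f mod minpol)"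
    by (metis ev_add ev_mult)
  hence *: "ev x f = ev x (f mod minpol)" using assms \<beta>8 by (simp add: ev_minpol)
  have "minpol \<noteq> 0" using degree_minpol by auto
  hence "Polynomial.degree (f mod minpol) < 8"
    using degree_mod_less'[of minpol f] degree_minpol by (cases "f mod minpol = 0") auto
  hence "f mod minpol = (\<Sum>i<8. Polynomial.monom (poly.coeff (f mod minpol) i) i)"
    by (intro poly_eqI) (auto simp: coeff_sum coeff_monom coeff_eq_0)
  thus ?thesis using * ev_sum_monom by metis
qed

lemma K_cases:
  assumes "x \<in> K"
  obtains a where "x = (\<Sum>i<8. of_rat (a i) * \<beta> ^ i)"
  using assms reduce[OF refl] that by (auto simp: K_def)

text \<open>The Eisenstein argument for $x^8 - 17 c$ at 17, carried out on relations between powers.\<close>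

lemma relation_dvd_17:
  assumes "(\<Sum>i<8. of_int (z i) * \<beta> ^ i) = 0" "i < 8"
  shows "17 dvd z i"
  using assms(2)
proof (induction i rule: less_induct)
  case (less k)
  have "\<exists>y. \<forall>i<k. z i = 17 * y i"
    using less by (intro exI[of _ "\<lambda>i. z i div 17"]) auto
  then obtain y where y: "\<And>i. i < k \<Longrightarrow> z i = 17 * y i" by blast
  \<comment> \<open>The relation is multiplied by \<open>c\<close>. For i < k the coefficient
    supplies a factor 17, and 17 c = \<beta>^8 turns the term into a multiple of \<beta>^(k+1); the
    terms with i > k have this factor already. \<open>w\<close> is the resulting cofactor, so that c
    z_k \<beta>^k + \<beta>^(k+1) w = 0.\<close>
  define w where "w = (\<Sum>i<k. of_int (y i) * \<beta> ^ (7 - k + i)) + (\<Sum>i\<in>{k<..<8}. of_int (int c * z i) * \<beta> ^ (i - Suc k))"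
  have w: "algebraic_int w"
    unfolding w_def using \<beta>_algint
    by (intro algebraic_int_add algebraic_int_sum algebraic_int_mult algebraic_int_power) auto
  have "{..<8} = {..<k} \<union> insert k {k<..<8}" using less by auto
  moreover have "{..<k} \<inter> insert k {k<..<8} = {}" by auto
  ultimately have "(\<Sum>i<8. of_int (z i) * \<beta> ^ i) = (\<Sum>i<k. of_int (z i) * \<beta> ^ i) + (of_int (z k) * \<beta> ^ k + (\<Sum>i\<in>{k<..<8}. of_int (z i) * \<beta> ^ i))"
    by (simp add: sum.union_disjoint)
  hence 1: "of_nat c * ((\<Sum>i<k. of_int (z i) * \<beta> ^ i) + (of_int (z k) * \<beta> ^ k + (\<Sum>i\<in>{k<..<8}. of_int (z i) * \<beta> ^ i))) = 0"
    using assms(1) by simp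
  have "of_nat c * (\<Sum>i<k. of_int (z i) * \<beta> ^ i) = (\<Sum>i<k. \<beta> ^ Suc k * (of_int (y i) * \<beta> ^ (7 - k + i)))"
    unfolding sum_distrib_left
  proof (rule sum.cong)
    fix i assume i: "i \<in> {..<k}"
    have "Suc k + (7 - k + i) = 8 + i" using less.prems by simp
    hence "\<beta> ^ Suc k * \<beta> ^ (7 - k + i) = of_nat (17 * c) * \<beta> ^ i"
      by (metis power_add \<beta>8)
    thus "of_nat c * (of_int (z i) * \<beta> ^ i) = \<beta> ^ Suc k * (of_int (y i) * \<beta> ^ (7 - k + i))"
      using i by (simp add: y mult_ac)
  qed simp
  moreover have "of_nat c * (\<Sum>i\<in>{k<..<8}. of_int (z i) * \<beta> ^ i) =
      (\<Sum>i\<in>{k<..<8}. \<beta> ^ Suc k * (of_int (int c * z i) * \<beta> ^ (i - Suc k)))"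
    unfolding sum_distrib_left
  proof (rule sum.cong)
    fix i assume i: "i \<in> {k<..<8}"
    hence "i = Suc k + (i - Suc k)" by simp
    hence "\<beta> ^ i = \<beta> ^ Suc k * \<beta> ^ (i - Suc k)" by (metis power_add)
    thus "of_nat c * (of_int (z i) * \<beta> ^ i) = \<beta> ^ Suc k * (of_int (int c * z i) * \<beta> ^ (i - Suc k))"
      by (simp add: mult_ac)
  qed simp
  ultimately have "\<beta> ^ Suc k * w + of_int (int c * z k) * \<beta> ^ k = 0"
    using 1 by (simp add: w_def ring_distribs sum_distrib_left mult_ac add_ac)
  hence "\<beta> ^ k * (\<beta> * w + of_int (int c * z k)) = 0" by (simp add: algebra_simps)
  hence "of_int (int c * z k) = - (\<beta> * w)"
    using \<beta>_nz by (simp add: eq_neg_iff_add_eq_0 add.commute)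
  \<comment> \<open>Eighth powers replace \<open>\<beta>\<close> by 17 c, and w^8 becomes rational;
    being an algebraic integer, it is an integer. So 17 divides (c z_k)^8, while 17 does not divide
    \<open>c\<close>.\<close>
  hence "of_int (int c * z k) ^ 8 = \<beta> ^ 8 * w ^ 8" by (simp add: power_mult_distrib)
  hence eq: "of_int (int c ^ 8 * z k ^ 8) = of_int (17 * int c) * w ^ 8"
    by (simp add: \<beta>8 power_mult_distrib)
  have "of_int (17 * int c) \<noteq> (0 :: complex)" using c by auto
  hence "w ^ 8 = of_int (int c ^ 8 * z k ^ 8) / of_int (17 * int c)"
    by (metis eq nonzero_mult_div_cancel_left)
  hence "w ^ 8 \<in> \<rat>" by (simp only: Rats_divide Rats_of_int)
  with w have "w ^ 8 \<in> \<int>" by (intro rational_algebraic_int_is_int) auto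
  then obtain t where "w ^ 8 = of_int t" by (auto elim: Ints_cases)
  with eq have "(of_int (int c ^ 8 * z k ^ 8) :: complex) = of_int (17 * int c * t)" by simp
  hence "int c ^ 8 * z k ^ 8 = 17 * int c * t" by (simp only: of_int_eq_iff)
  hence "17 dvd int c ^ 8 * z k ^ 8" by simp
  moreover have p: "Factorial_Ring.prime (17::int)" by simp
  moreover have "\<not> 17 dvd int c" using c by auto
  ultimately show ?case
    using prime_dvd_multD prime_dvd_power by blast
qed

text \<open>Infinite descent: all coefficients of a relation are divisible by 17, and the quotients
  form a relation with smaller sum of absolute values.\<close>

lemma independent_int:
  assumes "(\<Sum>i<8. of_int (z i) * \<beta> ^ i) = 0" "i < 8"
  shows "z i = 0"
  using assms
proof (induction "\<Sum>i<8. nat \<bar>z i\<bar>" arbitrary: z i rule: less_induct)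
  case less
  have "\<exists>y. \<forall>i<8. z i = 17 * y i"
    using relation_dvd_17[OF less.prems(1)] by (intro exI[of _ "\<lambda>i. z i div 17"]) auto
  then obtain y where y: "\<And>i. i < 8 \<Longrightarrow> z i = 17 * y i" by blast
  show ?case
  proof (rule ccontr)
    assume nz: "z i \<noteq> 0"
    have "(\<Sum>i<8. nat \<bar>y i\<bar>) < (\<Sum>i<8. nat \<bar>z i\<bar>)"
      using nz less.prems(2) y by (intro sum_strict_mono_ex1) (auto intro!: bexI[of _ i])
    moreover have "17 * (\<Sum>i<8. of_int (y i) * \<beta> ^ i) = 0"
      using less.prems(1) y by (simp add: sum_distrib_left mult_ac)
    hence "(\<Sum>i<8. of_int (y i) * \<beta> ^ i) = 0" by simp
    ultimately have "y i = 0" using less.hyps less.prems(2) by blast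
    thus False using nz y less.prems(2) by simp
  qed
qed

lemma common_denominator:
  fixes a :: "nat \<Rightarrow> rat"
  obtains D :: int and z where "D > 0" "\<And>i. i < n \<Longrightarrow> of_int D * a i = of_int (z i)"
proof -
  have "\<exists>D::int. D > 0 \<and> (\<forall>i<n. of_int D * a i \<in> \<int>)"
  proof (induction n)
    case (Suc n)
    then obtain D :: int where D: "D > 0" "\<forall>i<n. of_int D * a i \<in> \<int>" by blast
    obtain p q where pq: "a n = of_int p / of_int q" "q > 0"
      by (metis quotient_of_denom_pos quotient_of_div surj_pair)
    have "of_int (D * q) * a i \<in> \<int>" if "i < Suc n" for i
    proof (cases "i = n")
      case True
      hence "of_int (D * q) * a i = of_int (D * p)" using pq by simp
      thus ?thesis by (simp only: Ints_of_int)
    next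
      case False
      hence "of_int q * (of_int D * a i) \<in> \<int>" using D that by auto
      thus ?thesis by (simp add: mult_ac)
    qed
    thus ?case using D pq by (intro exI[of _ "D * q"]) auto
  qed (auto intro: exI[of _ 1])
  then obtain D :: int where "D > 0" "\<forall>i<n. \<exists>z. of_int D * a i = of_int z" by (metis Ints_cases)
  thus ?thesis using that by metis
qed

lemma independent:
  assumes "(\<Sum>i<8. of_rat (a i) * \<beta> ^ i) = 0" "i < 8"
  shows "a i = 0"
proof -
  obtain D z where Dz: "D > 0" "\<And>i. i < 8 \<Longrightarrow> of_int D * a i = of_int (z i)"
    using common_denominator[where n = 8 and a = a] by blast
  have "(\<Sum>i<8. of_int (z i) * \<beta> ^ i) = (\<Sum>i<8. of_int D * (of_rat (a i) * \<beta> ^ i))"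
  proof (rule sum.cong)
    fix i :: nat assume "i \<in> {..<8}"
    hence "of_rat (of_int D * a i) = (of_rat (of_int (z i)) :: complex)" using Dz by simp
    thus "of_int (z i) * \<beta> ^ i = of_int D * (of_rat (a i) * \<beta> ^ i)"
      by (simp add: of_rat_mult)
  qed simp
  also have "\<dots> = 0" using assms(1) by (simp flip: sum_distrib_left)
  finally have "z i = 0" using independent_int assms(2) by blast
  thus ?thesis using Dz assms(2) by fastforce
qed

section \<open>Conjugates, and denominators of integral elements\<close>

lemma ev_conj_0:
  assumes "ev \<beta> f = 0" "x ^ 8 = \<beta> ^ 8"
  shows "ev x f = 0"
proof -
  have "poly.coeff (f mod minpol) i = 0" if "i < 8" for i
    using independent[of "poly.coeff (f mod minpol)"] assms(1) that reduce[OF refl, of f] by simp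
  thus ?thesis by (simp add: reduce[OF assms(2)])
qed

text \<open>A monic integer polynomial that kills an element of the field is a relation between
  powers of \<open>\<beta>\<close>, and \<open>ev_conj_0\<close> carries it to the
  conjugate.\<close>

lemma ev_conj_algint:
  assumes "algebraic_int (ev \<beta> f)" "x ^ 8 = \<beta> ^ 8"
  shows "algebraic_int (ev x f)"
proof -
  from assms(1) obtain p :: "int poly" where p: "poly (of_int_poly p) (ev \<beta> f) = 0" "lead_coeff p = 1"
    by (auto simp: algebraic_int_altdef_ipoly)
  define g where "g = (\<Sum>i\<le>Polynomial.degree p. smult (of_int (poly.coeff p i)) (f ^ i))"
  have g: "ev y g = poly (of_int_poly p) (ev y f)" for y
    by (simp add: g_def ev_sum ev_smult ev_power poly_altdef)
  have "ev \<beta> g = 0" using g p(1) by simp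
  hence "poly (of_int_poly p) (ev x f) = 0" using ev_conj_0[OF _ assms(2)] g by metis
  thus ?thesis using p(2) by (auto simp: algebraic_int_altdef_ipoly)
qed

text \<open>
  The twisted average over the conjugates \<open>\<zeta> ^ j * \<beta>\<close> isolates one term of the expansion.
\<close>

lemma coeff_algint:
  assumes "algebraic_int (\<Sum>i<8. of_rat (a i) * \<beta> ^ i)" "k < 8"
  shows "algebraic_int (8 * of_rat (a k) * \<beta> ^ k)"
proof -
  define \<zeta> where "\<zeta> = cis (pi / 4)"
  have \<zeta>8: "\<zeta> ^ 8 = 1"
    unfolding \<zeta>_def by (subst Complex.DeMoivre) simp
  have \<zeta>_ne: "\<zeta> ^ n \<noteq> 1" if "0 < n" "n < 8" for n
  proof
    assume "\<zeta> ^ n = 1"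
    hence "cis (real n * (pi / 4)) = 1" by (simp only: \<zeta>_def Complex.DeMoivre)
    hence "cos (real n * (pi / 4)) = 1" by (metis cis.sel(1) one_complex.sel(1))
    then obtain j :: int where "real n * (pi / 4) = of_int j * (2 * pi)"
      by (auto simp: cos_one_2pi_int)
    hence "real n = 8 * of_int j" by (simp add: field_simps)
    hence "int n = 8 * j" by linarith
    thus False using that by presburger
  qed
  define f where "f = (\<Sum>i<8. Polynomial.monom (a i) i)"
  have f: "ev x f = (\<Sum>i<8. of_rat (a i) * x ^ i)" for x
    by (simp add: f_def ev_sum)
  have \<zeta>_pow8: "(\<zeta> ^ j) ^ 8 = 1" for j
    by (metis \<zeta>8 power_commutes power_mult power_one mult.commute)
  have "algebraic_int \<zeta>"
  proof (rule algebraic_int_root)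
    show "poly (Polynomial.monom 1 8) \<zeta> = 1" using \<zeta>8 by (simp add: poly_monom)
  qed (auto simp: coeff_monom degree_monom_eq int_imp_algebraic_int)
  have "algebraic_int (ev (\<zeta> ^ j * \<beta>) f)" for j
  proof (rule ev_conj_algint)
    show "algebraic_int (ev \<beta> f)" using assms(1) by (simp only: f)
    show "(\<zeta> ^ j * \<beta>) ^ 8 = \<beta> ^ 8" by (simp only: power_mult_distrib \<zeta>_pow8 mult_1)
  qed
  \<comment> \<open>The weight \<zeta>^(j (8 - k)) stands for \<zeta>^(-j k), with the exponent kept
    a natural number.\<close>
  hence alg: "algebraic_int (\<Sum>j<8. \<zeta> ^ (j * (8 - k)) * ev (\<zeta> ^ j * \<beta>) f)"
    using \<open>algebraic_int \<zeta>\<close>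
    by (intro algebraic_int_sum algebraic_int_mult algebraic_int_power)
  have inner: "(\<Sum>j<8. (\<zeta> ^ (8 - k + i)) ^ j) = (if i = k then 8 else 0)" if "i < 8" for i
  proof (cases "i = k")
    case True
    hence "8 - k + i = 8" using assms(2) by simp
    thus ?thesis using True \<zeta>8 by simp
  next
    case False
    have "\<zeta> ^ (8 - k + i) \<noteq> 1"
    proof (cases "i < k")
      case True thus ?thesis using \<zeta>_ne[of "8 - k + i"] assms(2) by auto
    next
      case F: False
      hence "8 - k + i = 8 + (i - k)" using assms(2) by simp
      hence "\<zeta> ^ (8 - k + i) = \<zeta> ^ (i - k)" using \<zeta>8 by (simp add: power_add)
      thus ?thesis using \<zeta>_ne[of "i - k"] F False that by auto
    qed
    thus ?thesis using False \<zeta>_pow8[of "8 - k + i"] by (simp add: geometric_sum)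
  qed
  have "(\<Sum>j<8. \<zeta> ^ (j * (8 - k)) * ev (\<zeta> ^ j * \<beta>) f) =
      (\<Sum>j<8. \<Sum>i<8. of_rat (a i) * \<beta> ^ i * (\<zeta> ^ (8 - k + i)) ^ j)"
    unfolding f sum_distrib_left
    by (intro sum.cong refl) (simp add: power_mult_distrib power_add power_mult [symmetric] algebra_simps)
  also have "\<dots> = (\<Sum>i<8. of_rat (a i) * \<beta> ^ i * (\<Sum>j<8. (\<zeta> ^ (8 - k + i)) ^ j))"
    by (subst sum.swap) (simp add: sum_distrib_left)
  also have "\<dots> = (\<Sum>i<8. if i = k then 8 * of_rat (a i) * \<beta> ^ i else 0)"
    by (intro sum.cong) (auto simp: inner)
  also have "\<dots> = 8 * of_rat (a k) * \<beta> ^ k" using assms(2) by simp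
  finally show ?thesis using alg by simp
qed

text \<open>128 = 8 * 16. The factor 8 comes from summing over the eight conjugates in
  \<open>coeff_algint\<close>; the eighth power of that term is rational, hence an integer. The
  factor 16 absorbs the powers of \<open>c\<close>, because 16^8 = 16^k 16^(8-k), and
  \<open>rat_power8_17\<close> disposes of the powers of 17.\<close>

lemma coeff_bound:
  assumes "algebraic_int (\<Sum>i<8. of_rat (a i) * \<beta> ^ i)" "k < 8"
  shows "128 * a k \<in> \<int>"
proof -
  have "algebraic_int ((8 * of_rat (a k) * \<beta> ^ k) ^ 8)"
    using coeff_algint[OF assms] by blast
  moreover have eq: "(8 * of_rat (a k) * \<beta> ^ k) ^ 8 = (of_rat ((8 * a k) ^ 8 * (17 * of_nat c) ^ k) :: complex)"
  proof -
    have "(\<beta> ^ k) ^ 8 = (of_nat (17 * c)) ^ k" by (metis \<beta>8 power_commutes power_mult mult.commute)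
    thus ?thesis by (simp add: power_mult_distrib of_rat_mult of_rat_power)
  qed
  ultimately have "(of_rat ((8 * a k) ^ 8 * (17 * of_nat c) ^ k) :: complex) \<in> \<int>"
    by (intro rational_algebraic_int_is_int) auto
  then obtain t where "(of_rat ((8 * a k) ^ 8 * (17 * of_nat c) ^ k) :: complex) = of_int t"
    by (auto elim: Ints_cases)
  hence "(of_rat ((8 * a k) ^ 8 * (17 * of_nat c) ^ k) :: complex) = of_rat (of_int t)" by simp
  hence t: "(8 * a k) ^ 8 * (17 * of_nat c) ^ k = of_int t" by (simp only: of_rat_eq_iff)
  have "(128 * a k) ^ 8 * 17 ^ k \<in> \<int>"
    using c
  proof
    assume "c = 1"
    hence "(128 * a k) ^ 8 * 17 ^ k = of_int (16 ^ 8 * t)"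
      using t by (simp add: power_mult_distrib flip: t)
    thus ?thesis by (metis Ints_of_int)
  next
    assume "c = 16"
    have "(16::rat) ^ 8 = 16 ^ k * 16 ^ (8 - k)" using assms(2) by (simp flip: power_add)
    hence "(128 * a k) ^ 8 * 17 ^ k = 16 ^ (8 - k) * ((8 * a k) ^ 8 * (17 * 16) ^ k)"
      by (simp only: power_mult_distrib[of "16::rat", symmetric] power_mult_distrib)
         (simp add: power_mult_distrib[of "16::rat"])
    also have "\<dots> = of_int (16 ^ (8 - k) * t)" using t \<open>c = 16\<close> by simp
    finally show ?thesis by (metis Ints_of_int)
  qed
  thus ?thesis using rat_power8_17 assms(2) by blast
qed

end

lemma sum_rat_eq_int_sum:
  assumes "\<And>i. i < 8 \<Longrightarrow> r * a i = (of_int (z i) :: rat)"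
  shows "of_rat r * (\<Sum>i<8. of_rat (a i) * (x::complex) ^ i) = (\<Sum>i<8. of_int (z i) * x ^ i)"
  unfolding sum_distrib_left
proof (rule sum.cong)
  fix i :: nat assume "i \<in> {..<8}"
  hence "of_rat (r * a i) = (of_rat (of_int (z i)) :: complex)" using assms by simp
  thus "of_rat r * (of_rat (a i) * x ^ i) = of_int (z i) * x ^ i"
    by (simp add: of_rat_mult)
qed simp

section \<open>The order Z[\<beta>], the indices of principal ideals, and the field
  structure\<close>

context octic begin

text \<open>The order Z[\<beta>]. By \<open>R_128\<close> it contains 128 times the ring of
  integers, so the two agree away from 2.\<close>

definition L :: "complex set" where "L = {\<Sum>i<8. of_int (z i) * \<beta> ^ i | z :: nat \<Rightarrow> int. True}"

lemma LI: "(\<Sum>i<8. of_int (z i) * \<beta> ^ i) \<in> L"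
  by (auto simp: L_def)

lemma L_sub_R: "L \<subseteq> R"
proof
  fix x assume "x \<in> L"
  then obtain z :: "nat \<Rightarrow> int" where x: "x = (\<Sum>i<8. of_int (z i) * \<beta> ^ i)" by (auto simp: L_def)
  have "(\<Sum>i\<in>I. of_int (z i) * \<beta> ^ i) \<in> R" for I
    using unit_subringD[OF subring_R] \<beta>_R by (induction I rule: infinite_finite_induct) auto
  thus "x \<in> R" using x by blast
qed

lemma addgrp_L: "addgrp L"
  unfolding addgrp_def
proof (intro conjI ballI)
  show "0 \<in> L" using LI[of "\<lambda>_. 0"] by simp
  fix x y assume "x \<in> L" "y \<in> L"
  then obtain a b :: "nat \<Rightarrow> int" where "x = (\<Sum>i<8. of_int (a i) * \<beta> ^ i)" "y = (\<Sum>i<8. of_int (b i) * \<beta> ^ i)"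
    by (auto simp: L_def)
  hence "x - y = (\<Sum>i<8. of_int (a i - b i) * \<beta> ^ i)"
    by (simp add: sum_subtractf algebra_simps)
  thus "x - y \<in> L" using LI by metis
qed

lemma R_128: "x \<in> R \<Longrightarrow> 128 * x \<in> L"
proof -
  assume x: "x \<in> R"
  then obtain a where a: "x = (\<Sum>i<8. of_rat (a i) * \<beta> ^ i)"
    using K_cases by (auto simp: integers_of_def)
  have "\<exists>z :: int. 128 * a i = of_int z" if "i < 8" for i
    using coeff_bound[of a i] x a that by (auto simp: integers_of_def elim: Ints_cases)
  then obtain z where z: "\<And>i. i < 8 \<Longrightarrow> 128 * a i = of_int (z i)" by metis
  from sum_rat_eq_int_sum[of 128 a z \<beta>, OF z] show ?thesis using a LI[of z] by simp
qed

definition scale :: "nat \<Rightarrow> complex set \<Rightarrow> complex set" where "scale n A = (*) (of_nat n) ` A"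

lemma scale_eq_principal: "scale n R = principal_ideal R (of_nat n)"
  by (simp add: scale_def principal_ideal_def)

lemma addgrp_scale: "addgrp A \<Longrightarrow> addgrp (scale n A)"
  unfolding addgrp_def scale_def
  by (auto simp flip: right_diff_distrib)

lemma idx_scale: "addgrp G \<Longrightarrow> addgrp H \<Longrightarrow> H \<subseteq> G \<Longrightarrow> n > 0 \<Longrightarrow> idx (scale n G) (scale n H) = idx G H"
  unfolding scale_def by (rule idx_inj_image) (auto simp: inj_on_def algebra_simps)

lemma L_scale_iff:
  "(\<Sum>i<8. of_int (z i) * \<beta> ^ i) \<in> scale n L \<longleftrightarrow> (\<forall>i<8. int n dvd z i)"
proof
  assume "(\<Sum>i<8. of_int (z i) * \<beta> ^ i) \<in> scale n L"
  then obtain y :: "nat \<Rightarrow> int" where "(\<Sum>i<8. of_int (z i) * \<beta> ^ i) = of_nat n * (\<Sum>i<8. of_int (y i) * \<beta> ^ i)"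
    by (auto simp: scale_def L_def)
  hence "(\<Sum>i<8. of_int (z i - int n * y i) * \<beta> ^ i) = 0"
    by (simp add: sum_subtractf sum_distrib_left algebra_simps)
  from independent_int[OF this] show "\<forall>i<8. int n dvd z i" by auto
next
  assume "\<forall>i<8. int n dvd z i"
  then obtain y where "\<And>i. i < 8 \<Longrightarrow> z i = int n * y i" unfolding dvd_def by metis
  hence "(\<Sum>i<8. of_int (z i) * \<beta> ^ i) = of_nat n * (\<Sum>i<8. of_int (y i) * \<beta> ^ i)"
    by (simp add: sum_distrib_left mult_ac)
  thus "(\<Sum>i<8. of_int (z i) * \<beta> ^ i) \<in> scale n L" using LI by (auto simp: scale_def)
qed

lemma idx_L: "n > 0 \<Longrightarrow> idx L (scale n L) = n ^ 8"
proof -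
  assume n: "n > 0"
  let ?s = "\<lambda>z :: nat \<Rightarrow> int. (\<Sum>i<8. of_int (z i) * \<beta> ^ i)"
  let ?r = "\<lambda>z :: nat \<Rightarrow> int. \<lambda>i\<in>{..<8::nat}. z i mod int n"
  have L: "L = range ?s" by (auto simp: L_def)
  have "idx L (scale n L) = card ((\<lambda>z. coset (scale n L) (?s z)) ` UNIV)"
    by (simp add: idx_def L image_image)
  also have "\<dots> = card (range ?r)"
  proof (rule card_image_eq)
    fix y z :: "nat \<Rightarrow> int"
    have "?s y - ?s z = ?s (\<lambda>i. y i - z i)" by (simp add: sum_subtractf algebra_simps)
    hence "coset (scale n L) (?s y) = coset (scale n L) (?s z) \<longleftrightarrow> (\<forall>i<8. int n dvd y i - z i)"
      by (simp only: coset_eq_iff[OF addgrp_scale[OF addgrp_L]] L_scale_iff)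
    also have "\<dots> \<longleftrightarrow> (\<forall>i<8. y i mod int n = z i mod int n)"
      by (simp add: mod_eq_dvd_iff)
    also have "\<dots> \<longleftrightarrow> ?r y = ?r z"
      by (auto simp: restrict_def fun_eq_iff)
    finally show "coset (scale n L) (?s y) = coset (scale n L) (?s z) \<longleftrightarrow> ?r y = ?r z" .
  qed
  also have "range ?r = ({..<8} \<rightarrow>\<^sub>E {0..<int n})"
  proof (intro equalityI subsetI)
    fix f :: "nat \<Rightarrow> int" assume f: "f \<in> ({..<8} \<rightarrow>\<^sub>E {0..<int n})"
    hence "?r f = f" by (auto simp: restrict_def fun_eq_iff PiE_iff extensional_def)
    thus "f \<in> range ?r" by (metis rangeI)
  qed (use n in auto)
  also have "card \<dots> = n ^ 8" by (simp add: card_PiE)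
  finally show ?thesis .
qed

text \<open>The order L is free of rank 8, so nL has index n^8 in it. The index of nL in R is
  computed along R, L, nL and along R, nR, nL; the index of nL in nR equals that of L in R and
  cancels, being finite because 128 R lies in L.\<close>

lemma idx_R:
  assumes n: "n > 0"
  shows "idx R (principal_ideal R (of_nat n)) = n ^ 8"
proof -
  have R: "addgrp R" using unit_subringD(11)[OF subring_R] .
  note L = addgrp_L
  have sub: "scale m L \<subseteq> L" "scale m L \<subseteq> scale m R" for m
  proof -
    show "scale m L \<subseteq> scale m R" using L_sub_R by (auto simp: scale_def)
    have "of_nat m * x \<in> L" if "x \<in> L" for x
      using that addgrpD[OF L] by (induction m) (auto simp: algebra_simps)
    thus "scale m L \<subseteq> L" by (auto simp: scale_def)
  qed
  have sub2: "scale m R \<subseteq> R" for m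
    using unit_subringD[OF subring_R] by (auto simp: scale_def)
  have "scale 128 R \<subseteq> L" using R_128 by (auto simp: scale_def)
  hence "idx L (scale 128 L) = idx L (scale 128 R) * idx (scale 128 R) (scale 128 L)"
    by (intro idx_mult addgrp_scale L R sub)
  hence "idx R L > 0"
    by (cases "idx R L = 0") (simp_all add: idx_L idx_scale[OF R L L_sub_R])
  have "idx R (scale n L) = idx R L * idx L (scale n L)"
    by (intro idx_mult addgrp_scale L R L_sub_R sub)
  moreover have "idx R (scale n L) = idx R (scale n R) * idx (scale n R) (scale n L)"
    by (intro idx_mult addgrp_scale L R sub2 sub)
  ultimately have "idx R L * n ^ 8 = idx R L * idx R (scale n R)"
    using n by (auto simp: idx_L idx_scale[OF R L L_sub_R])
  thus ?thesis using \<open>idx R L > 0\<close> by (simp add: scale_eq_principal)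
qed

lemma K_multiple_in_R:
  assumes "x \<in> K"
  obtains D :: int where "D > 0" "of_int D * x \<in> R"
proof -
  obtain a where a: "x = (\<Sum>i<8. of_rat (a i) * \<beta> ^ i)" using K_cases[OF assms] .
  obtain D z where Dz: "D > 0" "\<And>i. i < 8 \<Longrightarrow> of_int D * a i = of_int (z i)"
    using common_denominator[where n = 8 and a = a] by blast
  from sum_rat_eq_int_sum[of "of_int D" a z \<beta>, OF Dz(2)] have "of_int D * x \<in> L"
    using a LI[of z] by simp
  with Dz(1) show ?thesis using that L_sub_R by blast
qed

text \<open>The constant coefficient of an integer polynomial vanishing at \<open>x\<close> is a
  multiple of \<open>x\<close>; the induction strips off factors of the variable until that
  coefficient is nonzero. The cofactor is a polynomial in \<open>x\<close>, hence integral.\<close>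

lemma R_divides_int:
  assumes x: "x \<in> R" "x \<noteq> 0"
  obtains w k where "w \<in> R" "k \<noteq> 0" "x * w = of_int k"
proof -
  from x have "algebraic_int x" by (simp add: integers_of_def)
  then obtain p :: "int poly" where p: "poly (of_int_poly p) x = 0" "lead_coeff p = 1"
    by (auto simp: algebraic_int_altdef_ipoly)
  have "\<exists>w k. w \<in> R \<and> k \<noteq> 0 \<and> x * w = of_int k"
    if "poly (of_int_poly q) x = 0" "q \<noteq> 0" for q :: "int poly"
    using that
  proof (induction q)
    case (pCons a q)
    have eq: "of_int a + x * poly (of_int_poly q) x = 0" using pCons.prems(1) by (simp add: of_int_hom.map_poly_pCons_hom)
    show ?case
    proof (cases "a = 0")
      case True
      hence "poly (of_int_poly q) x = 0" "q \<noteq> 0" using eq x(2) pCons.prems(2) by auto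
      thus ?thesis using pCons.IH by blast
    next
      case False
      have "poly (of_int_poly r) x \<in> R" for r :: "int poly"
        using unit_subringD[OF subring_R] x(1) by (induction r) (auto simp: of_int_hom.map_poly_pCons_hom)
      hence "poly (of_int_poly q) x \<in> R" .
      moreover have "x * poly (of_int_poly q) x = of_int (- a)" using eq by (simp add: eq_neg_iff_add_eq_0 add.commute)
      ultimately show ?thesis using False by (metis neg_equal_0_iff_equal)
    qed
  qed simp
  from this[OF p(1)] p(2) that show ?thesis by fastforce
qed

text \<open>A nonzero ideal contains a positive integer k, and kR has the finite index k^8.
  Conversely, a positive index is itself a nonzero element of the ideal.\<close>

lemma idx_ideal_pos:
  assumes I: "ideal_of R I"
  shows "I \<noteq> {0} \<longleftrightarrow> idx R I > 0"
proof
  assume "I \<noteq> {0}"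
  then obtain x where x: "x \<in> I" "x \<noteq> 0" using ideal_ofD(2)[OF I] by blast
  obtain w k where wk: "w \<in> R" "k \<noteq> 0" "x * w = of_int k"
    using R_divides_int[OF ideal_ofD(8)[OF I x(1)] x(2)] .
  have "of_int k \<in> I" using ideal_ofD(7)[OF I wk(1) x(1)] wk(3) by simp
  hence "of_int \<bar>k\<bar> \<in> I" using ideal_ofD(5)[OF I, of "of_int k"] by (cases "k \<ge> 0") auto
  hence "of_nat (nat \<bar>k\<bar>) \<in> I" by simp
  hence sub: "principal_ideal R (of_nat (nat \<bar>k\<bar>)) \<subseteq> I" by (rule principal_le_ideal[OF I])
  have "idx R (principal_ideal R (of_nat (nat \<bar>k\<bar>))) = idx R I * idx I (principal_ideal R (of_nat (nat \<bar>k\<bar>)))"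
    using ideal_ofD[OF I] by (intro idx_mult unit_subringD(11)[OF subring_R] ideal_ofD(1)[OF I] sub
        ideal_ofD(1)[OF ideal_of_principal[OF subring_R unit_subringD(8)[OF subring_R]]]) auto
  thus "idx R I > 0" using idx_R[of "nat \<bar>k\<bar>"] wk(2) by (metis gr0I mult_0 zero_less_abs_iff zero_less_nat_eq power_not_zero less_numeral_extra(3))
next
  assume "idx R I > 0"
  moreover have "of_nat (idx R I) * 1 \<in> I"
    by (rule idx_mem_ideal[OF subring_R I unit_subringD(2)[OF subring_R]])
  ultimately show "I \<noteq> {0}" by auto
qed

lemma inverse_K: "x \<in> K \<Longrightarrow> inverse x \<in> K"
proof (cases "x = 0")
  case False
  assume "x \<in> K"
  then obtain D :: int where D: "D > 0" "of_int D * x \<in> R" using K_multiple_in_R by blast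
  obtain w k where wk: "w \<in> R" "k \<noteq> 0" "of_int D * x * w = of_int k"
    using R_divides_int[OF D(2)] False D(1) by (metis mult_eq_0_iff of_int_eq_0_iff less_irrefl)
  have "inverse x = of_rat (of_int D / of_int k) * w"
    using wk False by (simp add: of_rat_divide field_simps)
  thus ?thesis using wk(1) of_rat_K unit_subringD(3)[OF subring_K] by (simp add: integers_of_def)
qed (use unit_subringD(1)[OF subring_K] in simp)

lemma number_field_K: "number_field K"
proof -
  let ?T = "ring_of_type_algebra :: complex ring"
  interpret T: field ?T by (rule field_from_type_algebra)
  have simps: "carrier ?T = UNIV" "x \<otimes>\<^bsub>?T\<^esub> y = x * y" "x \<oplus>\<^bsub>?T\<^esub> y = x + y" "\<one>\<^bsub>?T\<^esub> = 1" "\<zero>\<^bsub>?T\<^esub> = 0" for x y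
    by (simp_all add: ring_of_type_algebra_def)
  have minus: "\<ominus>\<^bsub>?T\<^esub> x = - x" for x
    by (rule T.minus_equality) (simp_all add: simps)
  have inv: "inv\<^bsub>?T\<^esub> x = inverse x" if "x \<noteq> 0" for x
    using that by (intro T.comm_inv_char) (auto simp: simps)
  have sf: "subfield F ?T" if "unit_subring F" "\<And>x. x \<in> F \<Longrightarrow> inverse x \<in> F" for F
  proof (rule T.subfieldI')
    show "subring F ?T"
      using unit_subringD[OF that(1)] by (intro T.subringI) (auto simp: simps minus)
    show "inv\<^bsub>?T\<^esub> k \<in> F" if "k \<in> F - {\<zero>\<^bsub>?T\<^esub>}" for k
      using that \<open>\<And>x. x \<in> F \<Longrightarrow> inverse x \<in> F\<close> by (auto simp: simps inv)
  qed
  have Q: "subfield \<rat> ?T"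
    by (rule sf) (auto simp: unit_subring_def addgrp_def)
  have comb: "T.combine (map (\<lambda>i. of_rat (a i)) xs) (map (\<lambda>i. \<beta> ^ i) xs) = (\<Sum>i\<leftarrow>xs. of_rat (a i) * \<beta> ^ i)" for a xs
    by (induction xs) (auto simp: simps)
  have "T.Span \<rat> (map (\<lambda>i. \<beta> ^ i) [0..<8]) = K"
  proof (intro equalityI subsetI)
    fix x assume "x \<in> K"
    then obtain a where "x = (\<Sum>i<8. of_rat (a i) * \<beta> ^ i)" using K_cases by blast
    hence "x = T.combine (map (\<lambda>i. of_rat (a i)) [0..<8]) (map (\<lambda>i. \<beta> ^ i) [0..<8])"
      by (simp add: comb interv_sum_list_conv_sum_set_nat atLeast0LessThan)
    moreover have "set (map (\<lambda>i. complex_of_rat (a i)) [0..<8]) \<subseteq> \<rat>" by auto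
    ultimately show "x \<in> T.Span \<rat> (map (\<lambda>i. \<beta> ^ i) [0..<8])"
      by (subst T.Span_eq_combine_set[OF Q]) (simp add: simps, blast)
  next
    fix x assume "x \<in> T.Span \<rat> (map (\<lambda>i. \<beta> ^ i) [0..<8])"
    then obtain Ks where Ks: "set Ks \<subseteq> \<rat>" "x = T.combine Ks (map (\<lambda>i. \<beta> ^ i) [0..<8])"
      by (subst (asm) T.Span_eq_combine_set[OF Q]) (auto simp: simps)
    have "T.combine Ks Us \<in> K" if "set Ks \<subseteq> \<rat>" "set Us \<subseteq> K" for Ks Us
      using that
    proof (induction Ks Us rule: T.combine.induct)
      case (1 k Ks u Us)
      thus ?case using unit_subringD[OF subring_K] of_rat_K by (auto simp: simps Rats_def)
    qed (use unit_subringD(1)[OF subring_K] in \<open>auto simp: simps\<close>)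
    moreover have "set (map (\<lambda>i. \<beta> ^ i) [0..<8]) \<subseteq> K"
      using \<beta>_K unit_subringD(7)[OF subring_K] by auto
    ultimately show "x \<in> K" using Ks by blast
  qed
  moreover have "T.finite_dimension \<rat> (T.Span \<rat> (map (\<lambda>i. \<beta> ^ i) [0..<8]))"
    by (rule T.Span_finite_dimension[OF Q]) (simp add: simps)
  ultimately show ?thesis
    unfolding number_field_def using sf[OF subring_K inverse_K] by simp
qed

end

subsection \<open>Ideals of odd index\<close>

text \<open>The unit group is cyclic. If 2 = g^a and -1 = g^b, then one of a, b and a + b is even,
  which makes 2, -1 or -2 a square.\<close>

lemma eighth_root_16_odd_prime_power:
  assumes p: "Factorial_Ring.prime p" "odd p" and k: "k > 0"
  shows "\<exists>e :: nat. [e ^ 8 = 16] (mod p ^ k)"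
proof -
  define q where "q = p ^ k"
  have "p > 1" using p(1) by (rule prime_gt_1_nat)
  hence "q > 1" using k unfolding q_def by (rule one_less_power)
  have "odd q" using p(2) by (simp add: q_def)
  obtain g where "\<forall>k>0. residue_primroot (p ^ k) g"
    using residue_primroot_odd_prime_power_exists[OF p] by blast
  hence g: "residue_primroot q g" using k by (simp add: q_def)
  have power: "\<exists>i. [g ^ i = x] (mod q)" if "x \<in> totatives q" for x
  proof -
    have "x \<in> (\<lambda>i. g ^ i mod q) ` {..<totient q}"
      using bij_betw_imp_surj_on[OF residue_primroot_is_generator[OF \<open>q > 1\<close> g]] that by simp
    then obtain i where "x = g ^ i mod q" by blast
    hence "[g ^ i = x] (mod q)" by (simp add: cong_def)
    thus ?thesis ..
  qed
  have "2 \<in> totatives q"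
    using \<open>q > 1\<close> \<open>odd q\<close> by (auto simp: totatives_def intro: Suc_leI)
  then obtain a where a: "[g ^ a = 2] (mod q)" using power by blast
  have "q - 1 \<in> totatives q"
    using \<open>q > 1\<close> coprime_diff_one_left_nat[of q] by (auto simp: totatives_def)
  then obtain b where b: "[g ^ b = q - 1] (mod q)" using power by blast
  have "[int g ^ a = 2] (mod int q)" using a by (metis cong_int_iff of_nat_numeral of_nat_power)
  hence a': "int q dvd int g ^ a - 2" by (simp add: cong_iff_dvd_diff)
  have "[int g ^ b = int q - 1] (mod int q)"
    using b \<open>q > 1\<close> by (metis cong_int_iff of_nat_1 of_nat_diff of_nat_power less_imp_le)
  hence "int q dvd int g ^ b - (int q - 1)" by (simp add: cong_iff_dvd_diff)
  hence "int q dvd (int g ^ b - (int q - 1)) + int q" by (rule dvd_add) simp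
  hence b': "int q dvd int g ^ b + 1" by (simp add: algebra_simps)
  have "\<exists>s :: int. s \<ge> 0 \<and> (int q dvd s\<^sup>2 - 2 \<or> int q dvd s\<^sup>2 + 1 \<or> int q dvd s\<^sup>2 + 2)"
  proof -
    consider "even a" | "even b" | "even (a + b)" by auto
    thus ?thesis
    proof cases
      case 1
      then obtain i where "a = 2 * i" by (rule evenE)
      hence "(int g ^ i)\<^sup>2 = int g ^ a" by (simp add: power_mult [symmetric] mult.commute)
      thus ?thesis using a' by (intro exI[of _ "int g ^ i"]) simp
    next
      case 2
      then obtain i where "b = 2 * i" by (rule evenE)
      hence "(int g ^ i)\<^sup>2 = int g ^ b" by (simp add: power_mult [symmetric] mult.commute)
      thus ?thesis using b' by (intro exI[of _ "int g ^ i"]) simp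
    next
      case 3
      then obtain i where "a + b = 2 * i" by (rule evenE)
      hence "(int g ^ i)\<^sup>2 = int g ^ (a + b)" by (simp add: power_mult [symmetric] mult.commute)
      hence "(int g ^ i)\<^sup>2 + 2 = int g ^ a * (int g ^ b + 1) - (int g ^ a - 2)"
        by (simp add: algebra_simps power_add)
      also have "int q dvd \<dots>" by (rule dvd_diff[OF dvd_mult[OF b'] a'])
      finally show ?thesis by (intro exI[of _ "int g ^ i"]) simp
    qed
  qed
  then obtain s :: int where s: "s \<ge> 0" "int q dvd s\<^sup>2 - 2 \<or> int q dvd s\<^sup>2 + 1 \<or> int q dvd s\<^sup>2 + 2" by blast
  \<comment> \<open>A square root of 2 or of -2 is a root of u^4 - 4. The last identity is Sophie
    Germain's: a square root s of -1 makes s + 1 a root of u^4 + 4.\<close>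
  have 1: "u ^ 8 - 16 = (u ^ 4 + 4) * (u ^ 4 - 4)" "u ^ 4 - 4 = (u\<^sup>2 - 2) * (u\<^sup>2 + 2)"
    "(u + 1) ^ 4 + 4 = (u\<^sup>2 + 1) * (u\<^sup>2 + 4 * u + 5)" for u :: int
    by (simp_all add: algebra_simps eval_nat_numeral)
  have "int q dvd s ^ 8 - 16 \<or> int q dvd (s + 1) ^ 8 - 16"
    using s(2)
  proof (elim disjE)
    assume "int q dvd s\<^sup>2 - 2"
    thus ?thesis unfolding 1(1)[of s] 1(2)[of s] by (intro disjI1 dvd_mult dvd_mult2)
  next
    assume "int q dvd s\<^sup>2 + 1"
    thus ?thesis unfolding 1(1)[of "s + 1"] 1(3)[of s] by (intro disjI2 dvd_mult2)
  next
    assume "int q dvd s\<^sup>2 + 2"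
    thus ?thesis unfolding 1(1)[of s] 1(2)[of s] by (intro disjI1 dvd_mult)
  qed
  then obtain e :: int where e: "e \<ge> 0" "int q dvd e ^ 8 - 16"
    using s(1) by (metis add_nonneg_nonneg zero_le_one)
  hence "[int (nat e ^ 8) = int 16] (mod int q)" by (simp add: cong_iff_dvd_diff)
  hence "[nat e ^ 8 = 16] (mod q)" by (simp only: cong_int_iff)
  thus ?thesis unfolding q_def by blast
qed

lemma eighth_root_16:
  assumes "odd m"
  shows "\<exists>e :: nat. [e ^ 8 = 16] (mod m)"
  using assms
proof (induction m rule: less_induct)
  case (less m)
  show ?case
  proof (cases "m = 1")
    case False
    then obtain p where p: "Factorial_Ring.prime p" "p dvd m"
      using prime_factor_nat by blast
    have "m \<noteq> 0" using less.prems by (intro notI) simp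
    define k where "k = multiplicity p m"
    have "k > 0" using p \<open>m \<noteq> 0\<close> by (simp add: k_def prime_multiplicity_gt_zero_iff)
    have "\<not> is_unit p" using p(1) not_prime_unit by blast
    then obtain m' where m': "m = p ^ k * m'" "\<not> p dvd m'"
      using multiplicity_decompose'[OF \<open>m \<noteq> 0\<close>] unfolding k_def by metis
    have "odd p" using p less.prems by (metis dvd_trans)
    have cop: "Rings.coprime (p ^ k) m'" using m'(2) p by (simp add: prime_imp_coprime)
    have "m' < m" using m' \<open>k > 0\<close> p \<open>m \<noteq> 0\<close>
      by (metis dvd_triv_right gr0I less_le m'(2) nat_dvd_not_less p(2) linorder_neqE_nat)
    moreover have "odd m'" using less.prems m' by simp
    ultimately obtain e1 where e1: "[e1 ^ 8 = 16] (mod m')" using less.IH by blast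
    obtain e2 where e2: "[e2 ^ 8 = 16] (mod p ^ k)"
      using eighth_root_16_odd_prime_power[OF p(1) \<open>odd p\<close> \<open>k > 0\<close>] by blast
    obtain e where e: "[e = e2] (mod p ^ k)" "[e = e1] (mod m')"
      using binary_chinese_remainder_nat[OF cop] by blast
    have "[e ^ 8 = 16] (mod p ^ k)" "[e ^ 8 = 16] (mod m')"
      using e e1 e2 cong_pow cong_trans by blast+
    hence "[e ^ 8 = 16] (mod p ^ k * m')" using cop by (rule coprime_cong_mult_nat)
    thus ?thesis using m' by auto
  qed auto
qed

text \<open>Pseudo-division by a polynomial with leading coefficient 1 is genuine division with
  remainder.\<close>

lemma monic_division_int:
  fixes f :: "int poly"
  obtains q r where "f = (Polynomial.monom 1 8 - [:17:]) * q + r" "\<And>i. i \<ge> 8 \<Longrightarrow> poly.coeff r i = 0"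
proof -
  define g :: "int poly" where "g = Polynomial.monom 1 8 - [:17:]"
  have cg: "poly.coeff g i = (if i = 8 then 1 else if i = 0 then -17 else 0)" for i
    by (auto simp: g_def coeff_monom coeff_pCons split: nat.splits)
  have deg: "Polynomial.degree g = 8"
    by (rule antisym) (auto intro!: degree_le le_degree simp: cg)
  obtain q r where qr: "pseudo_divmod f g = (q, r)" by force
  have "g \<noteq> 0" using deg by auto
  from pseudo_divmod[OF this qr] have "f = g * q + r" "r = 0 \<or> Polynomial.degree r < 8"
    by (auto simp: deg cg)
  moreover from this have "poly.coeff r i = 0" if "i \<ge> 8" for i using that by (auto intro: coeff_eq_0)
  ultimately show ?thesis using that unfolding g_def by blast
qed

context octic begin

lemma ev_int_R: "x \<in> R \<Longrightarrow> poly (of_int_poly f) x \<in> R"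
  using unit_subringD[OF subring_R] by (induction f) (auto simp: of_int_hom.map_poly_pCons_hom)

text \<open>
  The right-hand side below does not mention the field, which is how the two fields are compared;
  for \<open>c = 16\<close> the factor \<open>d\<close> is an inverse of an eighth root of 16 modulo \<open>m\<close>.
\<close>

lemma odd_ideal_vimage:
  assumes m: "odd m" and d: "[c * d ^ 8 = 1] (mod m)"
  shows "{p. poly (of_int_poly p) (of_nat d * \<beta>) \<in> principal_ideal R (of_nat m)} =
    {p. \<exists>q r. p = (Polynomial.monom 1 8 - [:17:]) * q + smult (int m) r}"
proof -
  let ?y = "of_nat d * \<beta>"
  let ?e = "\<lambda>p :: int poly. poly (of_int_poly p) ?y"
  let ?M = "principal_ideal R (of_nat m)"
  have M: "ideal_of R ?M" by (intro ideal_of_principal subring_R unit_subringD(8)[OF subring_R])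
  have y: "?y \<in> R" using unit_subringD(3,8)[OF subring_R] \<beta>_R by blast
  have "int m dvd int (c * d ^ 8) - 1"
    using d by (metis cong_iff_dvd_diff cong_int_iff of_nat_1)
  then obtain t where t: "int (c * d ^ 8) - 1 = int m * t" by blast
  \<comment> \<open>d \<beta> is a root of x^8 - 17 modulo m, since its eighth power is 17 c d^8 and
    c d^8 is 1 modulo m.\<close>
  have g: "?e (Polynomial.monom 1 8 - [:17:]) = of_nat m * of_int (17 * t)"
  proof -
    have "?e (Polynomial.monom 1 8 - [:17:]) = ?y ^ 8 - 17"
      by (simp add: of_int_poly_hom.hom_minus map_poly_monom poly_monom)
    also have "\<dots> = of_int (17 * (int (c * d ^ 8) - 1))" by (simp add: power_mult_distrib \<beta>8)
    also have "\<dots> = of_nat m * of_int (17 * t)" by (simp only: t of_int_mult of_int_of_nat_eq mult_ac)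
    finally show ?thesis .
  qed
  have M_mult: "of_nat m * x \<in> ?M" if "x \<in> R" for x using that by (auto simp: principal_ideal_def)
  have 1: "?e ((Polynomial.monom 1 8 - [:17:]) * q + smult (int m) r) \<in> ?M" for q r
  proof -
    have "?e ((Polynomial.monom 1 8 - [:17:]) * q + smult (int m) r) =
        of_nat m * (of_int (17 * t) * ?e q) + of_nat m * ?e r"
      by (simp only: of_int_poly_hom.hom_add of_int_poly_hom.hom_mult poly_add poly_mult g
          of_int_hom.map_poly_hom_smult poly_smult of_int_of_nat_eq mult.assoc)
    also have "\<dots> \<in> ?M"
      by (intro ideal_ofD(3)[OF M] M_mult unit_subringD(3)[OF subring_R] unit_subringD(9)[OF subring_R] ev_int_R[OF y])
    finally show ?thesis .
  qed
  have 2: "\<exists>q r. p = (Polynomial.monom 1 8 - [:17:]) * q + smult (int m) r" if p: "?e p \<in> ?M" for p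
  proof -
    obtain q r where qr: "p = (Polynomial.monom 1 8 - [:17:]) * q + r" "\<And>i. i \<ge> 8 \<Longrightarrow> poly.coeff r i = 0"
      using monic_division_int[of p] by metis
    have "?e r = ?e p - ?e ((Polynomial.monom 1 8 - [:17:]) * q)"
      by (simp add: qr(1) of_int_poly_hom.hom_add)
    also have "\<dots> \<in> ?M" using ideal_ofD(4)[OF M p] 1[of q 0] by simp
    finally obtain w where w: "w \<in> R" "?e r = of_nat m * w" by (auto simp: principal_ideal_def)
    \<comment> \<open>The cofactor \<open>w\<close> is only integral; 128 moves it into Z[\<beta>],
      where coefficients can be compared. The factors 128 and d^i so introduced are coprime to m, so
      m divides every coefficient of the remainder.\<close>
    obtain z :: "nat \<Rightarrow> int" where z: "128 * w = (\<Sum>i<8. of_int (z i) * \<beta> ^ i)"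
      using R_128[OF w(1)] by (auto simp: L_def)
    have "r = (\<Sum>i<8. Polynomial.monom (poly.coeff r i) i)"
      using qr(2) by (intro poly_eqI) (auto simp: coeff_sum coeff_monom)
    hence "?e r = (\<Sum>i<8. ?e (Polynomial.monom (poly.coeff r i) i))"
      by (metis (no_types, lifting) of_int_poly_hom.hom_sum poly_sum sum.cong)
    hence er: "?e r = (\<Sum>i<8. of_int (poly.coeff r i * int d ^ i) * \<beta> ^ i)"
      by (simp add: map_poly_monom poly_monom power_mult_distrib mult.assoc)
    have "(\<Sum>i<8. of_int (128 * (poly.coeff r i * int d ^ i) - int m * z i) * \<beta> ^ i) = 128 * ?e r - of_nat m * (128 * w)"
      by (simp only: z er) (simp add: sum_subtractf sum_distrib_left algebra_simps)
    also have "\<dots> = 0" using w by simp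
    finally have rel: "(\<Sum>i<8. of_int (128 * (poly.coeff r i * int d ^ i) - int m * z i) * \<beta> ^ i) = 0" .
    have "int m dvd 128 * (poly.coeff r i * int d ^ i)" if "i < 8" for i
      using independent_int[OF rel that] by simp
    moreover have "Rings.coprime (int m) 128"
    proof -
      have "Rings.coprime (int m) (2 ^ 7)" using m by (subst coprime_power_right_iff) simp
      thus ?thesis by simp
    qed
    moreover have "Rings.coprime (int m) (int d ^ i)" for i
    proof -
      have "Rings.coprime m (c * d ^ 8)" using d by (metis cong_imp_coprime cong_sym coprime_1_left coprime_commute)
      hence "Rings.coprime m d" by simp
      hence "Rings.coprime (int m) (int d)" by simp
      thus ?thesis by simp
    qed
    ultimately have "int m dvd poly.coeff r i" if "i < 8" for i
      using that by (simp only: coprime_dvd_mult_right_iff coprime_dvd_mult_left_iff)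
    hence "int m dvd poly.coeff r i" for i
      using qr(2)[of i] by (cases "i < 8") auto
    hence "[:int m:] dvd r" by (simp add: const_poly_dvd_iff)
    then obtain r' where "r = smult (int m) r'" by (auto elim!: dvdE)
    thus ?thesis using qr(1) by blast
  qed
  show ?thesis using 1 2 by blast
qed

text \<open>128 a is an integer combination of powers of \<open>\<beta>\<close>. With inverses
  \<open>s\<close> of 128 and d' of d modulo m, the polynomial with coefficients s z_i d'^i takes
  the value \<open>a\<close> modulo m at d \<beta>.\<close>

lemma odd_ideal_surj:
  assumes m: "odd m" and d: "[c * d ^ 8 = 1] (mod m)" and a: "a \<in> R"
  shows "\<exists>p. a - poly (of_int_poly p) (of_nat d * \<beta>) \<in> principal_ideal R (of_nat m)"
proof -
  have "Rings.coprime m (c * d ^ 8)" using d by (metis cong_imp_coprime cong_sym coprime_1_left coprime_commute)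
  hence "Rings.coprime m d" by simp
  hence "Rings.coprime (int d) (int m)" by (simp add: coprime_commute)
  then obtain d' where "[int d * d' = 1] (mod int m)" using cong_solve_coprime_int by blast
  hence dd': "[(d' * int d) ^ i = 1] (mod int m)" for i by (metis cong_pow mult.commute power_one)
  have "Rings.coprime (2 ^ 7) (int m)" using m by (subst coprime_power_left_iff) simp
  hence "Rings.coprime 128 (int m)" by simp
  then obtain s where "[128 * s = 1] (mod int m)" using cong_solve_coprime_int by blast
  then obtain u where u: "1 - 128 * s = int m * u"
    by (metis cong_iff_dvd_diff cong_sym dvdE)
  obtain z :: "nat \<Rightarrow> int" where z: "128 * a = (\<Sum>i<8. of_int (z i) * \<beta> ^ i)"
    using R_128[OF a] by (auto simp: L_def)
  have "\<exists>v. 1 - (d' * int d) ^ i = int m * v" for i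
    using dd'[of i] by (metis cong_iff_dvd_diff cong_sym dvdE)
  then obtain v where v: "\<And>i. 1 - (d' * int d) ^ i = int m * v i" by metis
  define p where "p = (\<Sum>i<8. Polynomial.monom (s * z i * d' ^ i) i)"
  have "poly (of_int_poly p) (of_nat d * \<beta>) = (\<Sum>i<8. of_int (s * z i * (d' * int d) ^ i) * \<beta> ^ i)"
    by (simp add: p_def of_int_poly_hom.hom_sum poly_sum map_poly_monom poly_monom power_mult_distrib mult_ac)
  also have "\<dots> = (\<Sum>i<8. of_int (s * z i * (1 - int m * v i)) * \<beta> ^ i)"
    by (simp add: v[symmetric])
  also have "\<dots> = of_int s * (128 * a) - of_nat m * (\<Sum>i<8. of_int (s * z i * v i) * \<beta> ^ i)"
    by (simp only: z) (simp add: sum_subtractf sum_distrib_left algebra_simps)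
  finally have "a - poly (of_int_poly p) (of_nat d * \<beta>) =
      of_int (1 - 128 * s) * a + of_nat m * (\<Sum>i<8. of_int (s * z i * v i) * \<beta> ^ i)"
    by (simp add: algebra_simps)
  also have "of_int (1 - 128 * s) = (of_nat m * of_int u :: complex)"
    unfolding u by simp
  also have "of_nat m * of_int u * a + of_nat m * (\<Sum>i<8. of_int (s * z i * v i) * \<beta> ^ i) = of_nat m * (of_int u * a + (\<Sum>i<8. of_int (s * z i * v i) * \<beta> ^ i))"
    by (simp add: algebra_simps)
  also have "\<dots> \<in> principal_ideal R (of_nat m)"
    unfolding principal_ideal_def
    by (intro imageI unit_subringD(4)[OF subring_R] unit_subringD(3)[OF subring_R] unit_subringD(9)[OF subring_R]
        a subsetD[OF L_sub_R LI])
  finally show ?thesis ..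
qed

text \<open>An ideal of index m contains m, so it is an ideal of the quotient by m, which is Z[x]
  modulo x^8 - 17 and m.\<close>

lemma odd_ideals:
  assumes m: "odd m" and d: "[c * d ^ 8 = 1] (mod m)"
  shows "{I. ideal_of R I \<and> idx R I = m} \<approx> {J :: int poly set. ideal_of UNIV J \<and>
    {p. \<exists>q r. p = (Polynomial.monom 1 8 - [:17:]) * q + smult (int m) r} \<subseteq> J \<and> idx UNIV J = m}"
proof -
  let ?M = "principal_ideal R (of_nat m)"
  have M: "ideal_of R ?M" by (intro ideal_of_principal subring_R unit_subringD(8)[OF subring_R])
  have y: "of_nat d * \<beta> \<in> R" using unit_subringD(3,8)[OF subring_R] \<beta>_R by blast
  have "?M \<subseteq> I" if "ideal_of R I" "idx R I = m" for I
    using idx_mem_ideal[OF subring_R that(1) unit_subringD(2)[OF subring_R]] that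
    by (intro principal_le_ideal) auto
  hence eq: "{I. ideal_of R I \<and> idx R I = m} = {I. ideal_of R I \<and> ?M \<subseteq> I \<and> idx R I = m}" by blast
  show ?thesis
    unfolding eq odd_ideal_vimage[OF m d, symmetric]
    using ideal_correspondence[of UNIV R ?M "\<lambda>p. poly (of_int_poly p) (of_nat d * \<beta>)" m]
      subring_R M odd_ideal_surj[OF m d] ev_int_R[OF y]
    by (simp add: unit_subring_def addgrp_def of_int_poly_hom.hom_minus of_int_poly_hom.hom_mult image_subset_iff)
qed

end

lemma odd_ideals_eqpoll:
  assumes "octic 1 \<alpha>" "octic 16 \<beta>" and m: "odd m"
  shows "{I. ideal_of (integers_of (octic.K \<alpha>)) I \<and> idx (integers_of (octic.K \<alpha>)) I = m} \<approx>
    {I. ideal_of (integers_of (octic.K \<beta>)) I \<and> idx (integers_of (octic.K \<beta>)) I = m}"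
proof -
  obtain e where e: "[e ^ 8 = 16] (mod m)" using eighth_root_16[OF m] by blast
  have "Rings.coprime m (2 ^ 4)" using m by (subst coprime_power_right_iff) simp
  hence "Rings.coprime m 16" by simp
  hence "Rings.coprime m (e ^ 8)" using e by (metis cong_imp_coprime cong_sym coprime_commute)
  hence "Rings.coprime e m" by (simp add: coprime_commute)
  then obtain d where d: "[e * d = 1] (mod m)" using cong_solve_coprime_nat by auto
  have "[16 * d ^ 8 = e ^ 8 * d ^ 8] (mod m)" using e by (intro cong_mult cong_sym[OF e] cong_refl)
  also have "e ^ 8 * d ^ 8 = (e * d) ^ 8" by (simp add: power_mult_distrib)
  also have "[(e * d) ^ 8 = 1] (mod m)" using cong_pow[OF d, of 8] by simp
  finally have d: "[16 * d ^ 8 = 1] (mod m)" .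
  show ?thesis
    using eqpoll_trans[OF octic.odd_ideals[OF assms(1) m, of 1] eqpoll_sym[OF octic.odd_ideals[OF assms(2) m d]]]
    by simp
qed

subsection \<open>Semilocal principal ideal rings\<close>

text \<open>Multiplication by \<open>x\<close> maps S modulo I isomorphically onto xS modulo xI; the
  rest is the tower S, xS, xI.\<close>

lemma principal_mult_idx:
  fixes S :: "'a::field set"
  assumes S: "unit_subring S" and x: "x \<in> S" "x \<noteq> 0" and I: "ideal_of S I"
  shows "idx S ((*) x ` I) = idx S (principal_ideal S x) * idx S I"
proof -
  have P: "addgrp (principal_ideal S x)" using ideal_ofD(1)[OF ideal_of_principal[OF S x(1)]] .
  have "idx (principal_ideal S x) ((*) x ` I) = idx S I"
    unfolding principal_ideal_def using x ideal_ofD(8)[OF I]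
    by (intro idx_inj_image unit_subringD(11)[OF S] ideal_ofD(1)[OF I]) (auto simp: inj_on_def algebra_simps)
  moreover have "addgrp ((*) x ` I)"
    unfolding addgrp_def using ideal_ofD(2,4)[OF I] by (auto simp flip: right_diff_distrib)
  hence "idx S ((*) x ` I) = idx S (principal_ideal S x) * idx (principal_ideal S x) ((*) x ` I)"
    using ideal_ofD(8)[OF I] unit_subringD(3)[OF S x(1)]
    by (intro idx_mult unit_subringD(11)[OF S] P) (auto simp: principal_ideal_def)
  ultimately show ?thesis by simp
qed

lemma idx_principal_mult:
  fixes S :: "'a::field set"
  assumes S: "unit_subring S" and x: "x \<in> S" "x \<noteq> 0" and y: "y \<in> S"
  shows "idx S (principal_ideal S (x * y)) = idx S (principal_ideal S x) * idx S (principal_ideal S y)"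
proof -
  have "principal_ideal S (x * y) = (*) x ` principal_ideal S y"
    by (simp add: principal_ideal_def image_image mult.assoc)
  thus ?thesis using principal_mult_idx[OF S x ideal_of_principal[OF S y]] by simp
qed

lemma principal_one: "principal_ideal S 1 = S"
  by (simp add: principal_ideal_def)

lemma idx_principal_power:
  fixes S :: "'a::field set"
  assumes S: "unit_subring S" and x: "x \<in> S" "x \<noteq> 0"
  shows "idx S (principal_ideal S (x ^ n)) = idx S (principal_ideal S x) ^ n"
  by (induction n) (simp_all add: idx_principal_mult[OF S x unit_subringD(7)[OF S x(1)]] principal_one
      idx_self[OF unit_subringD(11)[OF S]])

text \<open>
  Ideals of finite index that contain a power of \<open>d\<close> behave as in a principal ideal domain
  with the finitely many primes \<open>\<tau> i\<close>.
\<close>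

locale semilocal =
  fixes S :: "'a::field set" and \<tau> :: "nat \<Rightarrow> 'a" and q e :: "nat \<Rightarrow> nat" and n :: nat and u :: 'a and d :: nat
  assumes S: "unit_subring S"
    and \<tau>: "i < n \<Longrightarrow> \<tau> i \<in> S" "i < n \<Longrightarrow> \<tau> i \<noteq> 0"
    and idx_\<tau>: "i < n \<Longrightarrow> idx S (principal_ideal S (\<tau> i)) = q i" "i < n \<Longrightarrow> q i > 1"
    and maximal: "i < n \<Longrightarrow> x \<in> S \<Longrightarrow> x \<notin> principal_ideal S (\<tau> i) \<Longrightarrow> \<exists>a\<in>S. 1 - a * x \<in> principal_ideal S (\<tau> i)"
    and distinct: "i < n \<Longrightarrow> j < n \<Longrightarrow> i \<noteq> j \<Longrightarrow> \<tau> i \<notin> principal_ideal S (\<tau> j)"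
    and u: "u \<in> S" "inverse u \<in> S" "u \<noteq> 0"
    and d: "of_nat d = u * (\<Prod>i<n. \<tau> i ^ e i)"
begin

definition pprod :: "(nat \<Rightarrow> nat) \<Rightarrow> 'a" where "pprod \<epsilon> = (\<Prod>i<n. \<tau> i ^ \<epsilon> i)"

lemma prod_S: "(\<And>i. i \<in> J \<Longrightarrow> f i \<in> S) \<Longrightarrow> (\<Prod>i\<in>J. f i) \<in> S"
  using unit_subringD[OF S] by (induction J rule: infinite_finite_induct) auto

lemma pprod_S: "pprod \<epsilon> \<in> S"
  unfolding pprod_def using \<tau> unit_subringD(7)[OF S] by (intro prod_S) auto

lemma pprod_nz: "pprod \<epsilon> \<noteq> 0"
  using \<tau> by (auto simp: pprod_def)

lemma ideal_\<tau>: "i < n \<Longrightarrow> ideal_of S (principal_ideal S (\<tau> i))"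
  by (intro ideal_of_principal S \<tau>)

lemma prime_\<tau>:
  assumes i: "i < n" and xy: "x \<in> S" "y \<in> S" "x * y \<in> principal_ideal S (\<tau> i)"
  shows "x \<in> principal_ideal S (\<tau> i) \<or> y \<in> principal_ideal S (\<tau> i)"
proof (rule disjCI)
  note I = ideal_ofD[OF ideal_\<tau>[OF i]]
  assume "y \<notin> principal_ideal S (\<tau> i)"
  then obtain a where a: "a \<in> S" "1 - a * y \<in> principal_ideal S (\<tau> i)" using maximal[OF i xy(2)] by blast
  have "x = x * (1 - a * y) + a * (x * y)" by (simp add: algebra_simps)
  thus "x \<in> principal_ideal S (\<tau> i)" using I(3)[OF I(6)[OF xy(1) a(2)] I(6)[OF a(1) xy(3)]] by simp
qed

lemma one_notin: "i < n \<Longrightarrow> 1 \<notin> principal_ideal S (\<tau> i)"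
  using ideal_of_eqI_1[OF ideal_\<tau>] idx_\<tau> idx_self[OF unit_subringD(11)[OF S]] by fastforce

lemma prime_prod:
  assumes "i < n" "finite J" "\<And>j. j \<in> J \<Longrightarrow> f j \<in> S" "(\<Prod>j\<in>J. f j) \<in> principal_ideal S (\<tau> i)"
  shows "\<exists>j\<in>J. f j \<in> principal_ideal S (\<tau> i)"
  using assms(2,3,4)
proof (induction J)
  case (insert j J)
  have "(\<Prod>j\<in>J. f j) \<in> S" using insert by (intro prod_S) auto
  thus ?case using prime_\<tau>[OF assms(1), of "f j"] insert by auto
qed (use one_notin assms in auto)

text \<open>\<open>\<epsilon> i\<close> is the valuation of the product at \<tau>_i. Were m larger,
  cancelling the available powers of \<tau>_i would leave a product of the other generators
  divisible by \<tau>_i, against primality and \<open>distinct\<close>.\<close>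

lemma pprod_dvd_iff:
  assumes i: "i < n"
  shows "pprod \<epsilon> \<in> principal_ideal S (\<tau> i ^ m) \<longleftrightarrow> m \<le> \<epsilon> i"
proof
  assume m: "m \<le> \<epsilon> i"
  define r where "r = \<tau> i ^ (\<epsilon> i - m) * (\<Prod>j\<in>{..<n} - {i}. \<tau> j ^ \<epsilon> j)"
  have "r \<in> S" unfolding r_def using \<tau> i
    by (intro unit_subringD(3)[OF S] unit_subringD(7)[OF S] prod_S) auto
  moreover have "pprod \<epsilon> = \<tau> i ^ m * r"
    unfolding pprod_def r_def using i m by (subst prod.remove[of _ i]) (auto simp flip: power_add mult.assoc)
  ultimately show "pprod \<epsilon> \<in> principal_ideal S (\<tau> i ^ m)" by (auto simp: principal_ideal_def)
next
  assume "pprod \<epsilon> \<in> principal_ideal S (\<tau> i ^ m)"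
  then obtain s where s: "s \<in> S" "pprod \<epsilon> = \<tau> i ^ m * s" by (auto simp: principal_ideal_def)
  show "m \<le> \<epsilon> i"
  proof (rule ccontr)
    assume "\<not> m \<le> \<epsilon> i"
    hence "\<tau> i ^ m = \<tau> i ^ \<epsilon> i * (\<tau> i * \<tau> i ^ (m - Suc (\<epsilon> i)))"
      by (simp flip: power_Suc power_add)
    moreover have "pprod \<epsilon> = \<tau> i ^ \<epsilon> i * (\<Prod>j\<in>{..<n} - {i}. \<tau> j ^ \<epsilon> j)"
      unfolding pprod_def using i by (subst prod.remove[of _ i]) auto
    ultimately have "(\<Prod>j\<in>{..<n} - {i}. \<tau> j ^ \<epsilon> j) = \<tau> i * (\<tau> i ^ (m - Suc (\<epsilon> i)) * s)"
      using s \<tau>(2)[OF i] by (simp add: mult.assoc)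
    hence "(\<Prod>j\<in>{..<n} - {i}. \<tau> j ^ \<epsilon> j) \<in> principal_ideal S (\<tau> i)"
      unfolding principal_ideal_def using s(1) \<tau>(1)[OF i] unit_subringD(3,7)[OF S] by blast
    then obtain j where j: "j \<in> {..<n} - {i}" "\<tau> j ^ \<epsilon> j \<in> principal_ideal S (\<tau> i)"
      using prime_prod[OF i, of "{..<n} - {i}" "\<lambda>j. \<tau> j ^ \<epsilon> j"] \<tau> unit_subringD(7)[OF S] by auto
    have "\<tau> j ^ k \<in> principal_ideal S (\<tau> i) \<Longrightarrow> \<tau> j \<in> principal_ideal S (\<tau> i)" for k
    proof (induction k)
      case (Suc k)
      thus ?case using prime_\<tau>[OF i, of "\<tau> j" "\<tau> j ^ k"] j \<tau> unit_subringD(7)[OF S] by auto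
    qed (use one_notin i in auto)
    thus False using j distinct[of j i] i by auto
  qed
qed

lemma pprod_inj:
  assumes "principal_ideal S (pprod \<epsilon>) = principal_ideal S (pprod \<delta>)" "i < n"
  shows "\<epsilon> i = \<delta> i"
proof -
  have "pprod \<epsilon> \<in> principal_ideal S (\<tau> i ^ m) \<longleftrightarrow> pprod \<delta> \<in> principal_ideal S (\<tau> i ^ m)" for m
  proof -
    have I: "ideal_of S (principal_ideal S (\<tau> i ^ m))"
      using assms \<tau> unit_subringD(7)[OF S] by (intro ideal_of_principal S) auto
    have "x \<in> principal_ideal S (\<tau> i ^ m)" if "y \<in> principal_ideal S (\<tau> i ^ m)" "x \<in> principal_ideal S y" for x y
      using principal_le_ideal[OF I that(1)] that(2) by blast
    thus ?thesis using assms(1) principal_self[OF S] by metis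
  qed
  thus ?thesis using pprod_dvd_iff[OF assms(2)] by (metis order_antisym order_refl)
qed

lemma idx_pprod: "idx S (principal_ideal S (pprod \<epsilon>)) = (\<Prod>i<n. q i ^ \<epsilon> i)"
proof -
  have "idx S (principal_ideal S (\<Prod>i\<in>J. \<tau> i ^ \<epsilon> i)) = (\<Prod>i\<in>J. q i ^ \<epsilon> i)" if "J \<subseteq> {..<n}" for J
    using finite_subset[OF that finite_lessThan] that
  proof (induction J)
    case empty
    thus ?case by (simp add: principal_one idx_self[OF unit_subringD(11)[OF S]])
  next
    case (insert i J)
    have "(\<Prod>i\<in>J. \<tau> i ^ \<epsilon> i) \<in> S"
      using insert.prems \<tau> unit_subringD(7)[OF S] by (intro prod_S) auto
    thus ?case using insert \<tau> idx_\<tau> unit_subringD(7)[OF S]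
      by (simp add: idx_principal_mult[OF S] idx_principal_power[OF S])
  qed
  thus ?thesis by (simp add: pprod_def)
qed

text \<open>\<open>C\<close> consists of the elements invertible modulo \<open>I\<close> and is
  closed under products. If \<open>I\<close> is in none of the primes, then all \<tau>_i lie in
  \<open>C\<close>, hence so does a power of \<open>d\<close> that belongs to \<open>I\<close>,
  which forces 1 into \<open>I\<close>.\<close>

lemma ideal_in_prime:
  assumes I: "ideal_of S I" "of_nat d ^ k \<in> I" "1 \<notin> I"
  shows "\<exists>i<n. I \<subseteq> principal_ideal S (\<tau> i)"
proof (rule ccontr)
  assume neg: "\<not> ?thesis"
  define C where "C = {z \<in> S. \<exists>x\<in>I. \<exists>y\<in>S. x + z * y = 1}"
  have "0 + 1 * 1 = (1::'a)" by simp
  hence C_1: "1 \<in> C" using ideal_ofD(2)[OF I(1)] unit_subringD(2)[OF S] unfolding C_def by blast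
  have C_mult: "z * z' \<in> C" if z: "z \<in> C" "z' \<in> C" for z z'
  proof -
    from z obtain x y x' y' where *: "z \<in> S" "z' \<in> S" "x \<in> I" "x' \<in> I" "y \<in> S" "y' \<in> S" "x + z * y = 1" "x' + z' * y' = 1"
      by (auto simp: C_def)
    have "x + (z * y) * x' \<in> I" "y * y' \<in> S" "z * z' \<in> S"
      using * ideal_ofD(3,6)[OF I(1)] unit_subringD(3)[OF S] by auto
    moreover have "(x + (z * y) * x') + (z * z') * (y * y') = x + (z * y) * (x' + z' * y')"
      by (simp add: algebra_simps)
    hence "(x + (z * y) * x') + (z * z') * (y * y') = 1" using * by simp
    ultimately show ?thesis unfolding C_def by blast
  qed
  have C_\<tau>: "\<tau> i \<in> C" if i: "i < n" for i
  proof -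
    obtain x where x: "x \<in> I" "x \<notin> principal_ideal S (\<tau> i)" using neg i by blast
    then obtain a where a: "a \<in> S" "1 - a * x \<in> principal_ideal S (\<tau> i)"
      using maximal[OF i ideal_ofD(8)[OF I(1) x(1)] x(2)] by blast
    then obtain y where "y \<in> S" "1 - a * x = \<tau> i * y" by (auto simp: principal_ideal_def)
    moreover from this have "a * x + \<tau> i * y = 1" by (simp add: algebra_simps)
    ultimately show ?thesis using ideal_ofD(6)[OF I(1) a(1) x(1)] \<tau>(1)[OF i] unfolding C_def by blast
  qed
  have C_pow: "z ^ m \<in> C" if "z \<in> C" for z m
    using that by (induction m) (auto intro: C_1 C_mult)
  have "0 + u * inverse u = 1" using u by simp
  hence "u \<in> C" using u ideal_ofD(2)[OF I(1)] unfolding C_def by blast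
  moreover have "(\<Prod>i\<in>J. \<tau> i ^ e i) \<in> C" if "J \<subseteq> {..<n}" for J
    using finite_subset[OF that finite_lessThan] that
    by (induction J) (auto intro: C_1 C_mult C_pow C_\<tau>)
  ultimately have "of_nat d ^ k \<in> C" by (simp add: d C_pow C_mult)
  then obtain x y where "x \<in> I" "y \<in> S" "x + of_nat d ^ k * y = 1" by (auto simp: C_def)
  hence "1 \<in> I" using ideal_ofD(3)[OF I(1) _ ideal_ofD(7)[OF I(1) _ I(2)]] by metis
  with I(3) show False by blast
qed

text \<open>Induction on the index: a proper ideal lies in some \<tau>_i S, hence is \<tau>_i J, and
  the index of J is smaller by the factor q_i > 1.\<close>

lemma ideal_classification:
  assumes "ideal_of S I" "of_nat d ^ k \<in> I" "idx S I > 0"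
  shows "\<exists>\<epsilon>. I = principal_ideal S (pprod \<epsilon>)"
  using assms
proof (induction "idx S I" arbitrary: I rule: less_induct)
  case less
  note I = ideal_ofD[OF less.prems(1)]
  show ?case
  proof (cases "1 \<in> I")
    case True
    hence "I = principal_ideal S (pprod (\<lambda>_. 0))"
      using ideal_of_eqI_1[OF less.prems(1)] by (simp add: pprod_def principal_one)
    thus ?thesis by blast
  next
    case False
    then obtain i where i: "i < n" "I \<subseteq> principal_ideal S (\<tau> i)"
      using ideal_in_prime less.prems by blast
    define J where "J = {s \<in> S. \<tau> i * s \<in> I}"
    have J: "ideal_of S J"
      unfolding ideal_of_def addgrp_def J_def
      using I unit_subringD[OF S] by (auto simp: right_diff_distrib mult.left_commute[of "\<tau> i"])
    have IJ: "I = (*) (\<tau> i) ` J" using i(2) by (auto simp: J_def principal_ideal_def)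
    have "of_nat d ^ k \<in> J"
      using I(6)[OF \<tau>(1)[OF i(1)] less.prems(2)] unit_subringD(7,8)[OF S] by (auto simp: J_def)
    moreover have idx: "idx S I = q i * idx S J"
      using principal_mult_idx[OF S \<tau>(1)[OF i(1)] \<tau>(2)[OF i(1)] J] idx_\<tau>[OF i(1)] IJ by simp
    hence "idx S J > 0" "idx S J < idx S I" using less.prems(3) idx_\<tau>(2)[OF i(1)] by auto
    ultimately obtain \<epsilon> where "J = principal_ideal S (pprod \<epsilon>)" using less.hyps[OF _ J] by blast
    hence "I = principal_ideal S (\<tau> i * pprod \<epsilon>)" unfolding IJ by (simp add: principal_ideal_def image_image mult.assoc)
    also have "\<tau> i * pprod \<epsilon> = pprod (\<epsilon>(i := Suc (\<epsilon> i)))"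
    proof -
      have "(\<Prod>j\<in>{..<n} - {i}. \<tau> j ^ (\<epsilon>(i := Suc (\<epsilon> i))) j) = (\<Prod>j\<in>{..<n} - {i}. \<tau> j ^ \<epsilon> j)"
        by (rule prod.cong) auto
      thus ?thesis unfolding pprod_def using i(1) by (simp add: prod.remove[of "{..<n}" i] mult_ac)
    qed
    finally show ?thesis by blast
  qed
qed

text \<open>The right-hand side involves the residue sizes \<open>q\<close> and not the exponents
  \<open>e\<close>. So two rings with the same residue sizes but different ramification have equally
  many ideals of each index \<open>d ^ k\<close>, which is where ramification escapes the zeta
  function.\<close>

lemma ideals_eqpoll:
  "{I. ideal_of S I \<and> idx S I = d ^ k} \<approx> {\<epsilon> \<in> {..<n} \<rightarrow>\<^sub>E UNIV. (\<Prod>i<n. q i ^ \<epsilon> i) = d ^ k}"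
proof -
  have "d > 0"
  proof (rule gr0I)
    assume "d = 0"
    thus False using d u pprod_nz[of e] by (simp add: pprod_def)
  qed
  let ?f = "\<lambda>\<epsilon>. principal_ideal S (pprod \<epsilon>)"
  have ideal: "ideal_of S (?f \<epsilon>)" for \<epsilon> by (intro ideal_of_principal S pprod_S)
  have "bij_betw ?f {\<epsilon> \<in> {..<n} \<rightarrow>\<^sub>E UNIV. (\<Prod>i<n. q i ^ \<epsilon> i) = d ^ k} {I. ideal_of S I \<and> idx S I = d ^ k}"
  proof (intro bij_betw_imageI inj_onI)
    fix \<epsilon> \<delta> assume *: "\<epsilon> \<in> {\<epsilon> \<in> {..<n} \<rightarrow>\<^sub>E UNIV. (\<Prod>i<n. q i ^ \<epsilon> i) = d ^ k}"
      "\<delta> \<in> {\<epsilon> \<in> {..<n} \<rightarrow>\<^sub>E UNIV. (\<Prod>i<n. q i ^ \<epsilon> i) = d ^ k}" "?f \<epsilon> = ?f \<delta>"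
    show "\<epsilon> = \<delta>" using * pprod_inj[OF *(3)] by (intro PiE_ext[of \<epsilon> "{..<n}" "\<lambda>_. UNIV" \<delta>]) auto
  next
    have "I \<in> ?f ` {\<epsilon> \<in> {..<n} \<rightarrow>\<^sub>E UNIV. (\<Prod>i<n. q i ^ \<epsilon> i) = d ^ k}"
      if I: "ideal_of S I" "idx S I = d ^ k" for I
    proof -
      have "of_nat d ^ k \<in> I" using idx_mem_ideal[OF S I(1) unit_subringD(2)[OF S]] I(2) by simp
      then obtain \<epsilon> where \<epsilon>: "I = ?f \<epsilon>" using ideal_classification[OF I(1)] I(2) \<open>d > 0\<close> by auto
      define \<delta> where "\<delta> = restrict \<epsilon> {..<n}"
      have "pprod \<delta> = pprod \<epsilon>" by (simp add: pprod_def \<delta>_def)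
      moreover have "\<delta> \<in> {..<n} \<rightarrow>\<^sub>E UNIV" by (simp add: \<delta>_def)
      ultimately show ?thesis using \<epsilon> I(2) idx_pprod[of \<delta>] by (intro image_eqI[of _ _ \<delta>]) auto
    qed
    thus "?f ` {\<epsilon> \<in> {..<n} \<rightarrow>\<^sub>E UNIV. (\<Prod>i<n. q i ^ \<epsilon> i) = d ^ k} = {I. ideal_of S I \<and> idx S I = d ^ k}"
      using ideal idx_pprod by auto
  qed
  thus ?thesis using eqpoll_sym unfolding eqpoll_def by blast
qed

end

subsection \<open>Localisation at 2\<close>

lemma odd_bezout:
  assumes "odd m"
  obtains a b :: int where "a * int m + b * 2 ^ k = 1"
proof -
  have "Rings.coprime (int m) (2 ^ k)" using assms by (cases "k = 0") (simp_all add: coprime_power_right_iff)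
  thus ?thesis using bezout_int[of "int m" "2 ^ k"] that by (metis coprime_imp_gcd_eq_1)
qed

context octic begin

definition S :: "complex set" where
  "S = {x \<in> K. \<exists>m. odd m \<and> of_nat m * x \<in> R}"

lemma SE:
  assumes "x \<in> S"
  obtains m where "odd m" "of_nat m * x \<in> R"
  using assms by (auto simp: S_def)

lemma R_sub_S: "R \<subseteq> S"
proof
  fix x assume "x \<in> R"
  thus "x \<in> S" by (auto simp: S_def integers_of_def intro!: exI[of _ 1])
qed

lemma S_sub_K: "S \<subseteq> K" by (auto simp: S_def)

lemma S_divide_odd:
  assumes "x \<in> S" "odd k"
  shows "x / of_int k \<in> S"
proof -
  from assms obtain m where m: "odd m" "of_nat m * x \<in> R" by (auto elim: SE)
  have "k \<noteq> 0" using assms by auto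
  have "of_nat (m * nat \<bar>k\<bar>) * (x / of_int k) = of_int (sgn k) * (of_nat m * x)"
    using \<open>k \<noteq> 0\<close> by (cases "k > 0") (auto simp: field_simps)
  hence "of_nat (m * nat \<bar>k\<bar>) * (x / of_int k) \<in> R"
    using unit_subringD(3,9)[OF subring_R] m(2) by metis
  moreover have "x / of_int k = of_rat (1 / of_int k) * x" by (simp add: of_rat_divide)
  hence "x / of_int k \<in> K" using S_sub_K assms(1) of_rat_K unit_subringD(3)[OF subring_K] by auto
  moreover have "odd (m * nat \<bar>k\<bar>)" using m(1) assms(2) by (auto simp: even_nat_iff)
  ultimately show ?thesis unfolding S_def by blast
qed

lemma subring_S: "unit_subring S"
  unfolding unit_subring_def addgrp_def
proof (intro conjI ballI)
  show "1 \<in> S" "0 \<in> S" using R_sub_S unit_subringD(1,2)[OF subring_R] by auto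
  fix x y assume xy: "x \<in> S" "y \<in> S"
  obtain k where k: "odd k" "of_nat k * x \<in> R" using xy(1) by (rule SE)
  obtain l where l: "odd l" "of_nat l * y \<in> R" using xy(2) by (rule SE)
  have "of_nat (k * l) * (x - y) = of_nat l * (of_nat k * x) - of_nat k * (of_nat l * y)"
    "of_nat (k * l) * (x * y) = (of_nat k * x) * (of_nat l * y)"
    by (simp_all add: algebra_simps)
  hence "of_nat (k * l) * (x - y) \<in> R" "of_nat (k * l) * (x * y) \<in> R"
    using k l unit_subringD(3,5,8)[OF subring_R] by metis+
  moreover have "odd (k * l)" using k l by simp
  moreover have xyK: "x \<in> K" "y \<in> K" using xy S_sub_K by blast+
  ultimately show "x - y \<in> S" "x * y \<in> S"
    using unit_subringD(3,5)[OF subring_K xyK] unfolding S_def by blast+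
qed

lemma S_cases_mod:
  assumes "x \<in> S"
  obtains m a b :: int and y where "y \<in> R" "y = of_int m * x" "a * m + b * 2 ^ k = 1"
proof -
  obtain m where "odd m" "of_nat m * x \<in> R" using assms by (rule SE)
  moreover obtain a b where "a * int m + b * 2 ^ k = 1" using odd_bezout[OF \<open>odd m\<close>] by blast
  moreover have "of_nat m * x = of_int (int m) * x" by simp
  ultimately show ?thesis using that by blast
qed

text \<open>Injectivity of the map from R modulo 2^k to S modulo 2^k; \<open>S_mod_two_power\<close>
  is the surjectivity. Both combine an odd denominator with 2^k by Bezout.\<close>

lemma principal_S_Int_R: "{p \<in> R. p \<in> principal_ideal S (2 ^ k)} = principal_ideal R (2 ^ k)"
proof (intro equalityI subsetI)
  fix p assume "p \<in> {p \<in> R. p \<in> principal_ideal S (2 ^ k)}"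
  then obtain s where s: "p \<in> R" "s \<in> S" "p = 2 ^ k * s" by (auto simp: principal_ideal_def)
  obtain m a b :: int and y where y: "y \<in> R" "y = of_int m * s" "a * m + b * 2 ^ k = 1"
    using S_cases_mod[OF s(2)] by metis
  have "of_int (a * m + b * 2 ^ k) * p = p" using y(3) by simp
  hence "p = 2 ^ k * (of_int a * y + of_int b * p)" using s(3) y(2) by (simp add: algebra_simps)
  moreover have "of_int a * y + of_int b * p \<in> R" using s y unit_subringD(3,4,9)[OF subring_R] by simp
  ultimately show "p \<in> principal_ideal R (2 ^ k)" unfolding principal_ideal_def by blast
next
  fix p assume "p \<in> principal_ideal R (2 ^ k)"
  thus "p \<in> {p \<in> R. p \<in> principal_ideal S (2 ^ k)}"
    using R_sub_S unit_subringD(3,7,10)[OF subring_R] by (auto simp: principal_ideal_def)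
qed

text \<open>The explicit \<open>id\<close> matches the map \<open>h\<close> of
  \<open>idx_vimage\<close> and \<open>ideal_correspondence\<close>, here the inclusion of R into
  S.\<close>

lemma S_mod_two_power:
  assumes "x \<in> S"
  shows "\<exists>p\<in>R. x - id p \<in> principal_ideal S (2 ^ k)"
proof -
  obtain m a b :: int and y where y: "y \<in> R" "y = of_int m * x" "a * m + b * 2 ^ k = 1"
    using S_cases_mod[OF assms] by metis
  have "of_int (a * m + b * 2 ^ k) * x = x" using y(3) by simp
  hence "x - id (of_int a * y) = 2 ^ k * (of_int b * x)" using y(2) by (simp add: algebra_simps)
  moreover have "of_int b * x \<in> S" "of_int a * y \<in> R"
    using assms y(1) unit_subringD(3,9)[OF subring_S] unit_subringD(3,9)[OF subring_R] by auto
  ultimately show ?thesis unfolding principal_ideal_def by blast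
qed

lemma ideal_S_two_power: "ideal_of S (principal_ideal S (2 ^ k))"
  by (intro ideal_of_principal subring_S unit_subringD(7)[OF subring_S] unit_subringD(10)[OF subring_S])

lemma idx_S_two: "idx S (principal_ideal S 2) = 256"
proof -
  have "idx R {p \<in> R. id p \<in> principal_ideal S (2 ^ 1)} = idx S (principal_ideal S (2 ^ 1))"
    by (rule idx_vimage[OF unit_subringD(11)[OF subring_R] ideal_ofD(1)[OF ideal_S_two_power]])
       (use R_sub_S S_mod_two_power[of _ 1] in auto)
  thus ?thesis using idx_R[of 2] principal_S_Int_R[of 1] by simp
qed

lemma two_power_ideals:
  "{I. ideal_of R I \<and> idx R I = 2 ^ k} \<approx> {J. ideal_of S J \<and> idx S J = 2 ^ k}"
proof -
  have *: "2 ^ k \<in> I" if "ideal_of A I" "unit_subring A" "idx A I = 2 ^ k" for A I :: "complex set"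
    using idx_mem_ideal[OF that(2,1) unit_subringD(2)[OF that(2)]] that(3) by simp
  have 1: "{I. ideal_of R I \<and> idx R I = 2 ^ k} = {I. ideal_of R I \<and> {p \<in> R. id p \<in> principal_ideal S (2 ^ k)} \<subseteq> I \<and> idx R I = 2 ^ k}"
    using *[OF _ subring_R] principal_le_ideal[of R] by (auto simp: principal_S_Int_R)
  have 2: "{I. ideal_of S I \<and> idx S I = 2 ^ k} = {I. ideal_of S I \<and> principal_ideal S (2 ^ k) \<subseteq> I \<and> idx S I = 2 ^ k}"
    using *[OF _ subring_S] principal_le_ideal[of S] by auto
  have "{I. ideal_of S I \<and> idx S I = 2 ^ k} \<approx> {I. ideal_of R I \<and> idx R I = 2 ^ k}"
    unfolding 1 2
    by (rule ideal_correspondence[OF subring_R subring_S ideal_S_two_power])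
       (use R_sub_S S_mod_two_power in auto)
  thus ?thesis by (rule eqpoll_sym)
qed

text \<open>Used contrapositively, as a test for not lying in \<open>S\<close>: a coefficient whose
  denominator is divisible by 2^8 is impossible.\<close>

lemma coeff_S:
  assumes "(\<Sum>i<8. of_rat (a i) * \<beta> ^ i) \<in> S" "k < 8"
  shows "\<exists>m. odd m \<and> of_nat (128 * m) * a k \<in> \<int>"
proof -
  obtain m where m: "odd m" "of_nat m * (\<Sum>i<8. of_rat (a i) * \<beta> ^ i) \<in> R" using assms(1) by (rule SE)
  have "of_nat m * (\<Sum>i<8. of_rat (a i) * \<beta> ^ i) = (\<Sum>i<8. of_rat (of_nat m * a i) * \<beta> ^ i)"
    by (simp add: sum_distrib_left of_rat_mult mult.assoc)
  hence "128 * (of_nat m * a k) \<in> \<int>"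
    using coeff_bound[of "\<lambda>i. of_nat m * a i" k] m(2) assms(2) by (simp add: integers_of_def)
  with m(1) show ?thesis by (intro exI[of _ m]) (simp add: mult.assoc)
qed

end

lemma idx_ge_card_image:
  assumes "idx G H > 0" "A \<subseteq> G" "inj_on (coset H) A"
  shows "card A \<le> idx G H"
proof -
  have "finite (coset H ` G)" using assms(1) by (auto simp: idx_def card_ge_0_finite)
  hence "card (coset H ` A) \<le> idx G H" unfolding idx_def using assms(2) by (intro card_mono) auto
  thus ?thesis using card_image[OF assms(3)] by simp
qed

lemma idx_exhaust:
  assumes "idx G H > 0" "A \<subseteq> G" "inj_on (coset H) A" "card A = idx G H" "x \<in> G"
  shows "\<exists>y\<in>A. coset H x = coset H y"
proof -
  have "finite (coset H ` G)" using assms(1) by (auto simp: idx_def card_ge_0_finite)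
  hence "coset H ` A = coset H ` G"
    using assms by (intro card_subset_eq) (auto simp: card_image idx_def)
  thus ?thesis using assms(5) by (metis imageE imageI)
qed

text \<open>
  The assumption on \<open>\<omega>\<close> says that the residue ring of \<open>\<tau>\<^sub>0\<close> contains a primitive
  cube root of unity; \<open>2 * e\<^sub>0 + e\<^sub>1 + e\<^sub>2 = 8\<close> then leaves 4, 2, 2 as the only
  possible sizes of the three residue rings.
\<close>

locale dyadic = octic +
  fixes \<tau>\<^sub>0 \<tau>\<^sub>1 \<tau>\<^sub>2 \<omega> u :: complex and e\<^sub>0 e\<^sub>1 e\<^sub>2 :: nat
  assumes \<tau>_S: "\<tau>\<^sub>0 \<in> S" "\<tau>\<^sub>1 \<in> S" "\<tau>\<^sub>2 \<in> S"
    and nonunit: "1 \<notin> principal_ideal S \<tau>\<^sub>0" "1 \<notin> principal_ideal S \<tau>\<^sub>1" "1 \<notin> principal_ideal S \<tau>\<^sub>2"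
    and \<omega>: "\<omega> \<in> S" "\<omega>\<^sup>2 + \<omega> + 1 \<in> principal_ideal S \<tau>\<^sub>0"
    and comaximal: "\<exists>x\<in>principal_ideal S \<tau>\<^sub>1. \<exists>y\<in>principal_ideal S \<tau>\<^sub>2. x + y = 1"
    and e: "e\<^sub>0 > 0" "e\<^sub>1 > 0" "e\<^sub>2 > 0" "2 * e\<^sub>0 + e\<^sub>1 + e\<^sub>2 = 8"
    and two: "u \<in> S" "2 = u * (\<tau>\<^sub>0 ^ e\<^sub>0 * \<tau>\<^sub>1 ^ e\<^sub>1 * \<tau>\<^sub>2 ^ e\<^sub>2)"
begin

lemma nz: "\<tau>\<^sub>0 \<noteq> 0" "\<tau>\<^sub>1 \<noteq> 0" "\<tau>\<^sub>2 \<noteq> 0" "u \<noteq> 0"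
proof -
  have "u * (\<tau>\<^sub>0 ^ e\<^sub>0 * \<tau>\<^sub>1 ^ e\<^sub>1 * \<tau>\<^sub>2 ^ e\<^sub>2) \<noteq> 0" using two(2) by (metis zero_neq_numeral)
  thus "\<tau>\<^sub>0 \<noteq> 0" "\<tau>\<^sub>1 \<noteq> 0" "\<tau>\<^sub>2 \<noteq> 0" "u \<noteq> 0" using e by (auto simp: zero_power)
qed

lemma ideal_pr: "x \<in> S \<Longrightarrow> ideal_of S (principal_ideal S x)"
  by (rule ideal_of_principal[OF subring_S])

lemma two_mem: "2 \<in> principal_ideal S \<tau>\<^sub>0" "2 \<in> principal_ideal S \<tau>\<^sub>1" "2 \<in> principal_ideal S \<tau>\<^sub>2"
proof -
  note m = unit_subringD(3)[OF subring_S] and p = unit_subringD(7)[OF subring_S]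
  have pw: "x ^ k = x * x ^ (k - 1)" if "k > 0" for x :: complex and k using that by (cases k) auto
  have "2 = \<tau>\<^sub>0 * (u * (\<tau>\<^sub>0 ^ (e\<^sub>0 - 1) * \<tau>\<^sub>1 ^ e\<^sub>1 * \<tau>\<^sub>2 ^ e\<^sub>2))"
    "2 = \<tau>\<^sub>1 * (u * (\<tau>\<^sub>0 ^ e\<^sub>0 * \<tau>\<^sub>1 ^ (e\<^sub>1 - 1) * \<tau>\<^sub>2 ^ e\<^sub>2))"
    "2 = \<tau>\<^sub>2 * (u * (\<tau>\<^sub>0 ^ e\<^sub>0 * \<tau>\<^sub>1 ^ e\<^sub>1 * \<tau>\<^sub>2 ^ (e\<^sub>2 - 1)))"
    using two(2) pw[OF e(1), of \<tau>\<^sub>0] pw[OF e(2), of \<tau>\<^sub>1] pw[OF e(3), of \<tau>\<^sub>2] by (simp_all add: mult_ac)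
  moreover have "u * (\<tau>\<^sub>0 ^ (e\<^sub>0 - 1) * \<tau>\<^sub>1 ^ e\<^sub>1 * \<tau>\<^sub>2 ^ e\<^sub>2) \<in> S"
    "u * (\<tau>\<^sub>0 ^ e\<^sub>0 * \<tau>\<^sub>1 ^ (e\<^sub>1 - 1) * \<tau>\<^sub>2 ^ e\<^sub>2) \<in> S"
    "u * (\<tau>\<^sub>0 ^ e\<^sub>0 * \<tau>\<^sub>1 ^ e\<^sub>1 * \<tau>\<^sub>2 ^ (e\<^sub>2 - 1)) \<in> S"
    by (intro m p two \<tau>_S)+
  ultimately show "2 \<in> principal_ideal S \<tau>\<^sub>0" "2 \<in> principal_ideal S \<tau>\<^sub>1" "2 \<in> principal_ideal S \<tau>\<^sub>2"
    unfolding principal_ideal_def by blast+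
qed

text \<open>These are the four elements of the field with 4 elements. Modulo \<tau>_0 the product of
  \<omega> and \<omega> + 1 is -1, so neither vanishes, and 2 = 0 settles the remaining
  differences.\<close>

lemma \<omega>_cosets: "inj_on (coset (principal_ideal S \<tau>\<^sub>0)) {0, 1, \<omega>, \<omega> + 1}" "card {0, 1, \<omega>, \<omega> + 1} = 4"
proof -
  let ?I = "principal_ideal S \<tau>\<^sub>0"
  note I = ideal_ofD[OF ideal_pr[OF \<tau>_S(1)]] and S = unit_subringD[OF subring_S]
  have 1: "\<omega> \<notin> ?I"
  proof
    assume "\<omega> \<in> ?I"
    hence "(\<omega>\<^sup>2 + \<omega> + 1) - (\<omega> + 1) * \<omega> \<in> ?I" using \<omega> by (intro I(4,6) S(4) S(2)) auto
    thus False using nonunit(1) by (simp add: algebra_simps power2_eq_square)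
  qed
  have 2: "\<omega> + 1 \<notin> ?I"
  proof
    assume "\<omega> + 1 \<in> ?I"
    hence "(\<omega>\<^sup>2 + \<omega> + 1) - \<omega> * (\<omega> + 1) \<in> ?I" using \<omega> by (intro I(4,6)) auto
    thus False using nonunit(1) by (simp add: algebra_simps power2_eq_square)
  qed
  have 3: "\<omega> - 1 \<notin> ?I"
  proof
    assume "\<omega> - 1 \<in> ?I"
    hence "(\<omega> - 1) + 2 \<in> ?I" using two_mem(1) by (intro I(3))
    thus False using 2 by (simp add: algebra_simps)
  qed
  have m: "- x \<in> ?I \<longleftrightarrow> x \<in> ?I" for x using I(5)[of x] I(5)[of "-x"] by auto
  have *: "0 - 1 \<notin> ?I" "1 - 0 \<notin> ?I" "0 - \<omega> \<notin> ?I" "\<omega> - 0 \<notin> ?I" "0 - (\<omega> + 1) \<notin> ?I" "(\<omega> + 1) - 0 \<notin> ?I"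
    "1 - \<omega> \<notin> ?I" "\<omega> - 1 \<notin> ?I" "1 - (\<omega> + 1) \<notin> ?I" "(\<omega> + 1) - 1 \<notin> ?I" "\<omega> - (\<omega> + 1) \<notin> ?I" "(\<omega> + 1) - \<omega> \<notin> ?I"
    using nonunit(1) 1 2 3 m[of 1] m[of \<omega>] m[of "\<omega> + 1"] m[of "\<omega> - 1"] by (simp_all add: algebra_simps)
  show "inj_on (coset ?I) {0, 1, \<omega>, \<omega> + 1}"
    using * by (simp add: inj_on_def coset_eq_iff[OF I(1)])
  have "0 \<noteq> \<omega>" "0 \<noteq> \<omega> + 1" "1 \<noteq> \<omega>" using 1 2 3 I(2) by auto
  thus "card {0, 1, \<omega>, \<omega> + 1} = 4" by auto
qed

text \<open>The four indices, with their exponents, multiply to 256, the index of 2S. The lower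
  bounds 4, 2, 2 already have the product 4^e0 2^e1 2^e2 = 256, so equality holds throughout; in
  particular \<open>u\<close> comes out as a unit.\<close>

lemma idx_eqs: "idx S (principal_ideal S \<tau>\<^sub>0) = 4" "idx S (principal_ideal S \<tau>\<^sub>1) = 2" "idx S (principal_ideal S \<tau>\<^sub>2) = 2"
    "idx S (principal_ideal S u) = 1"
proof -
  let ?N = "\<lambda>x. idx S (principal_ideal S x)"
  note S = unit_subringD[OF subring_S]
  have "?N (u * (\<tau>\<^sub>0 ^ e\<^sub>0 * (\<tau>\<^sub>1 ^ e\<^sub>1 * \<tau>\<^sub>2 ^ e\<^sub>2))) = ?N u * (?N \<tau>\<^sub>0 ^ e\<^sub>0 * (?N \<tau>\<^sub>1 ^ e\<^sub>1 * ?N \<tau>\<^sub>2 ^ e\<^sub>2))"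
    using nz \<tau>_S two(1) S(3,7) by (simp add: idx_principal_mult[OF subring_S] idx_principal_power[OF subring_S])
  hence eq: "?N u * (?N \<tau>\<^sub>0 ^ e\<^sub>0 * (?N \<tau>\<^sub>1 ^ e\<^sub>1 * ?N \<tau>\<^sub>2 ^ e\<^sub>2)) = 256"
    using two(2) idx_S_two by (simp add: mult.assoc)
  have pos: "?N u > 0" "?N \<tau>\<^sub>0 > 0" "?N \<tau>\<^sub>1 > 0" "?N \<tau>\<^sub>2 > 0"
    using eq e by (auto intro!: gr0I simp: zero_power)
  have ge: "?N x \<ge> 2" if "x \<in> S" "1 \<notin> principal_ideal S x" "?N x > 0" for x
  proof -
    have "?N x \<noteq> 1"
      using idx_eq_1_iff[OF S(11) ideal_ofD(1)[OF ideal_pr[OF that(1)]]] ideal_ofD(8)[OF ideal_pr[OF that(1)]] that(2) S(2) by blast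
    thus ?thesis using that(3) by linarith
  qed
  have "{0, 1, \<omega>, \<omega> + 1} \<subseteq> S" using S \<omega>(1) by auto
  hence N0: "?N \<tau>\<^sub>0 \<ge> 4"
    using idx_ge_card_image[OF pos(2) _ \<omega>_cosets(1)] \<omega>_cosets(2) by simp
  have N1: "?N \<tau>\<^sub>1 \<ge> 2" and N2: "?N \<tau>\<^sub>2 \<ge> 2" using ge \<tau>_S nonunit pos by auto
  define A B C where "A = ?N \<tau>\<^sub>0 ^ e\<^sub>0" "B = ?N \<tau>\<^sub>1 ^ e\<^sub>1" "C = ?N \<tau>\<^sub>2 ^ e\<^sub>2"
  have ge: "A \<ge> 4 ^ e\<^sub>0" "B \<ge> 2 ^ e\<^sub>1" "C \<ge> 2 ^ e\<^sub>2"
    using N0 N1 N2 by (simp_all add: A_B_C_def power_mono)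
  have "(4::nat) ^ e\<^sub>0 = 2 ^ (2 * e\<^sub>0)" by (simp add: power_mult)
  hence t: "(4::nat) ^ e\<^sub>0 * (2 ^ e\<^sub>1 * 2 ^ e\<^sub>2) = 256"
    using e(4) by (simp flip: power_add add: add.assoc)
  have prod: "A * (B * C) \<le> 256" "A * (B * C) = 256 \<Longrightarrow> ?N u = 1"
    using eq pos by (auto simp: A_B_C_def intro: mult_le_mono)
       (metis One_nat_def mult_le_mono1 Suc_leI mult_1)
  have pw: "(4::nat) ^ e\<^sub>0 > 0" "(2::nat) ^ e\<^sub>1 > 0" "(2::nat) ^ e\<^sub>2 > 0" by simp_all
  have bc: "B * C \<ge> 2 ^ e\<^sub>1 * 2 ^ e\<^sub>2" using ge by (intro mult_le_mono)
  have A: "A = 4 ^ e\<^sub>0"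
  proof (rule ccontr)
    assume "A \<noteq> 4 ^ e\<^sub>0"
    hence "A * (B * C) > 4 ^ e\<^sub>0 * (2 ^ e\<^sub>1 * 2 ^ e\<^sub>2)"
      using mult_less_le_imp_less[of "4 ^ e\<^sub>0" A, OF _ bc] ge(1) by simp
    thus False using t prod by simp
  qed
  have "B * C = 2 ^ e\<^sub>1 * 2 ^ e\<^sub>2"
  proof (rule ccontr)
    assume "B * C \<noteq> 2 ^ e\<^sub>1 * 2 ^ e\<^sub>2"
    hence "A * (B * C) > 4 ^ e\<^sub>0 * (2 ^ e\<^sub>1 * 2 ^ e\<^sub>2)"
      using mult_le_less_imp_less[OF ge(1), of "2 ^ e\<^sub>1 * 2 ^ e\<^sub>2" "B * C"] bc pw by linarith
    thus False using t prod by simp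
  qed
  moreover from this have B: "B = 2 ^ e\<^sub>1"
  proof -
    have "\<not> B > 2 ^ e\<^sub>1"
    proof
      assume "B > 2 ^ e\<^sub>1"
      hence "2 ^ e\<^sub>1 * 2 ^ e\<^sub>2 < B * C" using ge(3) by (intro mult_less_le_imp_less) auto
      thus False using \<open>B * C = 2 ^ e\<^sub>1 * 2 ^ e\<^sub>2\<close> by linarith
    qed
    hence "B \<le> 2 ^ e\<^sub>1" by (simp only: not_less)
    thus ?thesis using ge(2) by (rule antisym)
  qed
  ultimately have C: "C = 2 ^ e\<^sub>2" by simp
  show "?N \<tau>\<^sub>0 = 4" "?N \<tau>\<^sub>1 = 2" "?N \<tau>\<^sub>2 = 2"
    using A B C e unfolding A_B_C_def by (auto dest: power_eq_imp_eq_base)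
  show "?N u = 1" using prod(2) A B C t by simp
qed

lemma maximal_two:
  assumes "y \<in> S" "1 \<notin> principal_ideal S y" "idx S (principal_ideal S y) = 2" "x \<in> S" "x \<notin> principal_ideal S y"
  shows "\<exists>a\<in>S. 1 - a * x \<in> principal_ideal S y"
proof -
  note I = ideal_ofD[OF ideal_pr[OF assms(1)]] and S = unit_subringD[OF subring_S]
  have "\<exists>z\<in>{0, 1}. coset (principal_ideal S y) x = coset (principal_ideal S y) z"
    using assms S(1,2) I(5)[of "-1"] by (intro idx_exhaust[of S]) (auto simp: coset_eq_iff[OF I(1)])
  hence "x - 1 \<in> principal_ideal S y" using assms(5) by (auto simp: coset_eq_iff[OF I(1)])
  hence "1 - 1 * x \<in> principal_ideal S y" using I(5) by fastforce
  thus ?thesis using S(2) by blast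
qed

text \<open>Representatives of the nonzero residues are 1, \<omega> and \<omega> + 1, and the last
  two are inverse to each other modulo \<tau>_0 because 2 vanishes there.\<close>

lemma maximal_four:
  assumes "x \<in> S" "x \<notin> principal_ideal S \<tau>\<^sub>0"
  shows "\<exists>a\<in>S. 1 - a * x \<in> principal_ideal S \<tau>\<^sub>0"
proof -
  let ?I = "principal_ideal S \<tau>\<^sub>0"
  note I = ideal_ofD[OF ideal_pr[OF \<tau>_S(1)]] and S = unit_subringD[OF subring_S]
  have "\<exists>z\<in>{0, 1, \<omega>, \<omega> + 1}. coset ?I x = coset ?I z"
    using assms S \<omega>(1) idx_eqs(1) \<omega>_cosets by (intro idx_exhaust[of S]) auto
  then obtain z where z: "z \<in> {1, \<omega>, \<omega> + 1}" "x - z \<in> ?I" using assms(2) by (auto simp: coset_eq_iff[OF I(1)])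
  have "\<exists>a\<in>S. 1 - a * z \<in> ?I"
  proof -
    have "1 - (\<omega> + 1) * \<omega> = 2 - (\<omega>\<^sup>2 + \<omega> + 1)" "1 - \<omega> * (\<omega> + 1) = 2 - (\<omega>\<^sup>2 + \<omega> + 1)"
      by (simp_all add: algebra_simps power2_eq_square)
    hence "1 - (\<omega> + 1) * \<omega> \<in> ?I" "1 - \<omega> * (\<omega> + 1) \<in> ?I"
      using I(4)[OF two_mem(1) \<omega>(2)] by (simp_all only:)
    moreover have "1 - 1 * 1 \<in> ?I" using I(2) by simp
    ultimately show ?thesis using z(1) S(2,4) \<omega>(1) by blast
  qed
  then obtain a where a: "a \<in> S" "1 - a * z \<in> ?I" by blast
  have "1 - a * x = (1 - a * z) - a * (x - z)" by (simp add: algebra_simps)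
  thus ?thesis using I(4)[OF a(2) I(6)[OF a(1) z(2)]] a(1) by metis
qed

end

sublocale dyadic \<subseteq> semilocal S "\<lambda>i. if i = 0 then \<tau>\<^sub>0 else if i = 1 then \<tau>\<^sub>1 else \<tau>\<^sub>2" "\<lambda>i. if i = 0 then 4 else 2"
  "\<lambda>i. if i = 0 then e\<^sub>0 else if i = 1 then e\<^sub>1 else e\<^sub>2" 3 u 2
proof
  note S = unit_subringD[OF subring_S]
  show "unit_subring S" by (rule subring_S)
  show "u \<in> S" "u \<noteq> 0" using two nz by auto
  show "inverse u \<in> S"
  proof -
    have "principal_ideal S u = S"
      using idx_eq_1_iff[OF S(11) ideal_ofD(1)[OF ideal_pr[OF two(1)]]] ideal_ofD(8)[OF ideal_pr[OF two(1)]] idx_eqs(4) by blast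
    hence "1 \<in> principal_ideal S u" using S(2) by simp
    then obtain s where "s \<in> S" "1 = u * s" unfolding principal_ideal_def by blast
    thus ?thesis by (metis inverse_unique)
  qed
  show "of_nat 2 = u * (\<Prod>i<(3::nat). (if i = 0 then \<tau>\<^sub>0 else if i = 1 then \<tau>\<^sub>1 else \<tau>\<^sub>2) ^ (if i = 0 then e\<^sub>0 else if i = 1 then e\<^sub>1 else e\<^sub>2))"
    using two(2) by (simp add: eval_nat_numeral)
  fix i :: nat assume i: "i < 3"
  show "(if i = 0 then \<tau>\<^sub>0 else if i = 1 then \<tau>\<^sub>1 else \<tau>\<^sub>2) \<in> S" "(if i = 0 then \<tau>\<^sub>0 else if i = 1 then \<tau>\<^sub>1 else \<tau>\<^sub>2) \<noteq> 0"
    "(if i = 0 then 4 else 2) > (1::nat)"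
    "idx S (principal_ideal S (if i = 0 then \<tau>\<^sub>0 else if i = 1 then \<tau>\<^sub>1 else \<tau>\<^sub>2)) = (if i = 0 then 4 else 2)"
    using \<tau>_S nz idx_eqs by auto
  show "\<exists>a\<in>S. 1 - a * x \<in> principal_ideal S (if i = 0 then \<tau>\<^sub>0 else if i = 1 then \<tau>\<^sub>1 else \<tau>\<^sub>2)"
    if "x \<in> S" "x \<notin> principal_ideal S (if i = 0 then \<tau>\<^sub>0 else if i = 1 then \<tau>\<^sub>1 else \<tau>\<^sub>2)" for x
    using that maximal_four maximal_two[OF \<tau>_S(2) nonunit(2) idx_eqs(2)] maximal_two[OF \<tau>_S(3) nonunit(3) idx_eqs(3)]
    by (auto split: if_splits)
  fix j :: nat assume j: "j < 3" "i \<noteq> j"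
  have sub: "principal_ideal S x \<subseteq> principal_ideal S y" if "x \<in> principal_ideal S y" "y \<in> S" for x y
    using that principal_le_ideal[OF ideal_pr] by blast
  have a: "\<tau>\<^sub>1 \<notin> principal_ideal S \<tau>\<^sub>2" and b: "\<tau>\<^sub>2 \<notin> principal_ideal S \<tau>\<^sub>1"
  proof -
    obtain x y where xy: "x \<in> principal_ideal S \<tau>\<^sub>1" "y \<in> principal_ideal S \<tau>\<^sub>2" "x + y = 1" using comaximal by blast
    show "\<tau>\<^sub>1 \<notin> principal_ideal S \<tau>\<^sub>2"
      using sub[of \<tau>\<^sub>1 \<tau>\<^sub>2] xy \<tau>_S(3) nonunit(3) ideal_ofD(3)[OF ideal_pr[OF \<tau>_S(3)], of x y] by auto
    show "\<tau>\<^sub>2 \<notin> principal_ideal S \<tau>\<^sub>1"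
      using sub[of \<tau>\<^sub>2 \<tau>\<^sub>1] xy \<tau>_S(2) nonunit(2) ideal_ofD(3)[OF ideal_pr[OF \<tau>_S(2)], of x y] by auto
  qed
  \<comment> \<open>Ideals of index 4 and 2 cannot be nested: an ideal of index 2 inside one of
    index 4 would make 4 divide 2, and the other inclusion fails because modulo \<tau>_0 the element
    y is invertible.\<close>
  have c: "\<tau>\<^sub>0 \<notin> principal_ideal S y" "y \<notin> principal_ideal S \<tau>\<^sub>0" if y: "y \<in> S" "idx S (principal_ideal S y) = 2" "1 \<notin> principal_ideal S y" for y
  proof -
    have "\<not> principal_ideal S y \<subseteq> principal_ideal S \<tau>\<^sub>0"
    proof
      assume "principal_ideal S y \<subseteq> principal_ideal S \<tau>\<^sub>0"
      hence "idx S (principal_ideal S y) = idx S (principal_ideal S \<tau>\<^sub>0) * idx (principal_ideal S \<tau>\<^sub>0) (principal_ideal S y)"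
        using ideal_ofD(8)[OF ideal_pr[OF \<tau>_S(1)]] by (intro idx_mult S(11) ideal_ofD(1)[OF ideal_pr] y \<tau>_S) auto
      hence "2 = 4 * idx (principal_ideal S \<tau>\<^sub>0) (principal_ideal S y)" using y idx_eqs by simp
      thus False by presburger
    qed
    thus y0: "y \<notin> principal_ideal S \<tau>\<^sub>0" using sub \<tau>_S by blast
    show "\<tau>\<^sub>0 \<notin> principal_ideal S y"
    proof
      assume *: "\<tau>\<^sub>0 \<in> principal_ideal S y"
      obtain a where "a \<in> S" "1 - a * y \<in> principal_ideal S \<tau>\<^sub>0" using maximal_four[OF y(1) y0] by blast
      hence "(1 - a * y) + a * y \<in> principal_ideal S y"
        using sub[OF * y(1)] ideal_ofD(3,6)[OF ideal_pr[OF y(1)]] principal_self[OF subring_S] by blast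
      thus False using y(3) by simp
    qed
  qed
  show "(if i = 0 then \<tau>\<^sub>0 else if i = 1 then \<tau>\<^sub>1 else \<tau>\<^sub>2) \<notin> principal_ideal S (if j = 0 then \<tau>\<^sub>0 else if j = 1 then \<tau>\<^sub>1 else \<tau>\<^sub>2)"
    using i j a b c[OF \<tau>_S(2) idx_eqs(2) nonunit(2)] c[OF \<tau>_S(3) idx_eqs(3) nonunit(3)]
    by (auto split: if_splits)
qed

subsection \<open>Primes above 2\<close>

context dyadic begin

abbreviation \<tau> :: "nat \<Rightarrow> complex" where
  "\<tau> \<equiv> \<lambda>i. if i = 0 then \<tau>\<^sub>0 else if i = 1 then \<tau>\<^sub>1 else \<tau>\<^sub>2"

abbreviation e :: "nat \<Rightarrow> nat" where
  "e \<equiv> \<lambda>i. if i = 0 then e\<^sub>0 else if i = 1 then e\<^sub>1 else e\<^sub>2"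

definition contract :: "complex \<Rightarrow> complex set" where "contract x = principal_ideal S x \<inter> R"

lemma ideal_contract:
  assumes "x \<in> S"
  shows "ideal_of R (contract x)"
  unfolding ideal_of_def addgrp_def
proof (intro conjI ballI)
  note I = ideal_ofD[OF ideal_pr[OF assms]] and R = unit_subringD[OF subring_R]
  show "0 \<in> contract x" using I(2) R(1) unfolding contract_def by blast
  show "contract x \<subseteq> R" unfolding contract_def by blast
  show "y - z \<in> contract x" if "y \<in> contract x" "z \<in> contract x" for y z
    using that I(4) R(5) unfolding contract_def by blast
  show "a * z \<in> contract x" if "a \<in> R" "z \<in> contract x" for a z
    using that I(6) R(3) R_sub_S unfolding contract_def by blast
qed

lemma two_eq_pprod: "2 = u * pprod e"
  using d by (simp only: pprod_def) simp

lemma odd_notin_contract: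
  assumes "i < 3" "odd k"
  shows "of_int k \<notin> contract (\<tau> i)"
proof
  assume "of_int k \<in> contract (\<tau> i)"
  hence "of_int k * (1 / of_int k) \<in> principal_ideal S (\<tau> i)"
    using ideal_ofD(7)[OF ideal_\<tau>[OF assms(1)]] S_divide_odd[OF unit_subringD(2)[OF subring_S] assms(2)]
    unfolding contract_def by blast
  moreover have "k \<noteq> 0" using assms(2) by auto
  ultimately show False using one_notin[OF assms(1)] by simp
qed

lemma two_mem_contract: "i < 3 \<Longrightarrow> 2 \<in> contract (\<tau> i)"
  using two_mem unit_subringD(10)[OF subring_R] by (auto simp: contract_def)

lemma contract_Int_Ints:
  assumes "i < 3"
  shows "contract (\<tau> i) \<inter> \<int> = range (\<lambda>k::int. of_int (int 2 * k))"
proof (intro equalityI subsetI)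
  fix x assume "x \<in> contract (\<tau> i) \<inter> \<int>"
  then obtain k where k: "x = of_int k" "of_int k \<in> contract (\<tau> i)" by (auto elim!: Ints_cases)
  with odd_notin_contract[OF assms] have "even k" by blast
  then obtain l where "k = 2 * l" by (rule evenE)
  thus "x \<in> range (\<lambda>k::int. of_int (int 2 * k))" using k by auto
next
  fix x :: complex assume "x \<in> range (\<lambda>k::int. of_int (int 2 * k))"
  then obtain k :: int where "x = of_int (int 2 * k)" by blast
  hence "x = 2 * of_int k" "x \<in> \<int>" by simp_all
  thus "x \<in> contract (\<tau> i) \<inter> \<int>"
    using ideal_ofD(7)[OF ideal_contract[OF local.\<tau>(1)[OF assms]] unit_subringD(9)[OF subring_R] two_mem_contract[OF assms]]
    by simp
qed

lemma contract_in_primes_above: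
  assumes i: "i < 3"
  shows "contract (\<tau> i) \<in> primes_above K 2"
proof -
  have "primeideal (contract (\<tau> i)) (ring_of_integers K)"
  proof (rule primeidealI)
    show "ideal (contract (\<tau> i)) (ring_of_integers K)"
      unfolding ideal_ring_of_integers_iff[OF subring_K] by (rule ideal_contract[OF local.\<tau>(1)[OF i]])
    show "cring (ring_of_integers K)" by (rule cring_ring_of_integers[OF subring_K])
    show "carrier (ring_of_integers K) \<noteq> contract (\<tau> i)"
      using one_notin[OF i] unit_subringD(2)[OF subring_R] unfolding ring_of_integers_simps contract_def by blast
    fix a b assume "a \<in> carrier (ring_of_integers K)" "b \<in> carrier (ring_of_integers K)"
      "a \<otimes>\<^bsub>ring_of_integers K\<^esub> b \<in> contract (\<tau> i)"
    thus "a \<in> contract (\<tau> i) \<or> b \<in> contract (\<tau> i)"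
      using prime_\<tau>[OF i, of a b] R_sub_S unfolding ring_of_integers_simps contract_def by blast
  qed
  thus ?thesis using contract_Int_Ints[OF i] by (simp only: primes_above_def) simp
qed

text \<open>The extension J of Q to S is again a proper prime ideal and contracts back to Q, because
  Q contains no odd integer. It lies in some \<tau>_i S, and it contains some \<tau>_j; then j = i
  and J = \<tau>_i S.\<close>

lemma primes_above_cases:
  assumes "Q \<in> primes_above K 2"
  shows "\<exists>i<3. Q = contract (\<tau> i)"
proof -
  from assms have pr: "primeideal Q (ring_of_integers K)" and QZ: "Q \<inter> \<int> = range (\<lambda>k::int. of_int (int 2 * k))"
    by (auto simp: primes_above_def)
  have Q: "ideal_of R Q"
    using primeideal.axioms(1)[OF pr] ideal_ring_of_integers_iff[OF subring_K] by blast
  have Q_prime: "a \<in> Q \<or> b \<in> Q" if "a \<in> R" "b \<in> R" "a * b \<in> Q" for a b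
    using primeideal.I_prime[OF pr, of a b] that by (simp only: ring_of_integers_simps)
  have "of_int (int 2 * 1) \<in> Q" using QZ by blast
  hence two_Q: "2 \<in> Q" by simp
  have odd_Q: "of_nat m \<notin> Q" if "odd m" for m
  proof
    assume "of_nat m \<in> Q"
    hence "of_nat m \<in> range (\<lambda>k::int. of_int (int 2 * k) :: complex)" using QZ by (metis IntI Ints_of_nat)
    then obtain k :: int where "(of_nat m :: complex) = of_int (int 2 * k)" by blast
    hence "of_int (int m) = (of_int (2 * k) :: complex)" by simp
    hence "int m = 2 * k" by (simp only: of_int_eq_iff)
    thus False using that by presburger
  qed
  define J where "J = {x \<in> S. \<exists>m. odd m \<and> of_nat m * x \<in> Q}"
  have Q_J: "Q \<subseteq> J"
  proof
    fix x assume "x \<in> Q"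
    thus "x \<in> J" using ideal_ofD(8)[OF Q] R_sub_S by (auto simp: J_def intro!: exI[of _ 1])
  qed
  have J_R: "x \<in> Q" if "x \<in> J" "x \<in> R" for x
    using that Q_prime[of "of_nat _" x] odd_Q unit_subringD(8)[OF subring_R] by (auto simp: J_def)
  have J: "ideal_of S J"
    unfolding ideal_of_def addgrp_def
  proof (intro conjI ballI)
    show "0 \<in> J" using Q_J ideal_ofD(2)[OF Q] by blast
    show "J \<subseteq> S" by (auto simp: J_def)
  next
    fix x y assume "x \<in> J" "y \<in> J"
    then obtain k l where *: "x \<in> S" "y \<in> S" "odd k" "odd l" "of_nat k * x \<in> Q" "of_nat l * y \<in> Q"
      by (auto simp: J_def)
    have "of_nat (k * l) * (x - y) = of_nat l * (of_nat k * x) - of_nat k * (of_nat l * y)"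
      by (simp add: algebra_simps)
    hence "of_nat (k * l) * (x - y) \<in> Q"
      using * ideal_ofD(4,6)[OF Q] unit_subringD(8)[OF subring_R] by metis
    moreover have "odd (k * l)" using * by simp
    ultimately show "x - y \<in> J" using * unit_subringD(5)[OF subring_S] unfolding J_def by blast
  next
    fix a x assume "a \<in> S" "x \<in> J"
    then obtain k where k: "x \<in> S" "odd k" "of_nat k * x \<in> Q" by (auto simp: J_def)
    obtain l where l: "odd l" "of_nat l * a \<in> R" using SE[OF \<open>a \<in> S\<close>] .
    have "of_nat (k * l) * (a * x) = (of_nat l * a) * (of_nat k * x)" by (simp add: algebra_simps)
    hence "of_nat (k * l) * (a * x) \<in> Q" using k l ideal_ofD(6)[OF Q] by metis
    moreover have "odd (k * l)" using k l by simp
    ultimately show "a * x \<in> J" using k \<open>a \<in> S\<close> unit_subringD(3)[OF subring_S] unfolding J_def by blast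
  qed
  have J_1: "1 \<notin> J" using odd_Q by (auto simp: J_def)
  have J_prime: "x \<in> J \<or> y \<in> J" if xy: "x \<in> S" "y \<in> S" "x * y \<in> J" for x y
  proof -
    obtain k where k: "odd k" "of_nat k * x \<in> R" using SE[OF xy(1)] .
    obtain l where l: "odd l" "of_nat l * y \<in> R" using SE[OF xy(2)] .
    obtain m where m: "odd m" "of_nat m * (x * y) \<in> Q" using xy(3) by (auto simp: J_def)
    have "of_nat m * ((of_nat k * x) * (of_nat l * y)) = of_nat (k * l) * (of_nat m * (x * y))"
      by (simp add: algebra_simps)
    hence "of_nat m * ((of_nat k * x) * (of_nat l * y)) \<in> Q"
      using m ideal_ofD(6)[OF Q] unit_subringD(8)[OF subring_R] by metis
    hence "(of_nat k * x) * (of_nat l * y) \<in> Q"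
      using Q_prime[OF unit_subringD(8)[OF subring_R] unit_subringD(3)[OF subring_R k(2) l(2)]] odd_Q[OF m(1)] by blast
    hence "(of_nat k * x) \<in> Q \<or> (of_nat l * y) \<in> Q"
      by (rule Q_prime[OF k(2) l(2)])
    thus ?thesis using xy k l unfolding J_def by blast
  qed
  obtain i where i: "i < 3" "J \<subseteq> principal_ideal S (\<tau> i)"
    using ideal_in_prime[OF J, of 1] Q_J two_Q J_1 by (auto simp del: One_nat_def)
  \<comment> \<open>2 is in J and is a unit times a product of the \<tau>_j, so primality of J picks
    out one of them.\<close>
  have "\<exists>j<3. \<tau> j \<in> J"
  proof (rule ccontr)
    assume neg: "\<not> ?thesis"
    have pw: "\<tau> j ^ k \<notin> J" if "j < 3" for j k
    proof (induction k)
      case (Suc k)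
      have "\<tau> j \<notin> J" using neg that by blast
      hence "\<tau> j * \<tau> j ^ k \<notin> J"
        using J_prime[OF local.\<tau>(1)[OF that] unit_subringD(7)[OF subring_S local.\<tau>(1)[OF that]]] Suc by blast
      thus ?case unfolding power_Suc .
    qed (use J_1 in simp)
    have "(\<Prod>j\<in>A. \<tau> j ^ e j) \<notin> J" if "A \<subseteq> {..<3}" for A
      using finite_subset[OF that finite_lessThan] that
    proof (induction A)
      case (insert j A)
      have 1: "(\<Prod>j\<in>A. \<tau> j ^ e j) \<in> S"
        using insert.prems by (intro prod_S unit_subringD(7)[OF subring_S] local.\<tau>(1)) blast
      have 2: "\<tau> j ^ e j \<in> S" using insert.prems by (intro unit_subringD(7)[OF subring_S] local.\<tau>(1)) blast
      have "\<tau> j ^ e j \<notin> J" using pw[of j "e j"] insert.prems by blast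
      moreover have "(\<Prod>j\<in>A. \<tau> j ^ e j) \<notin> J" using insert.IH insert.prems by blast
      ultimately show ?case
        using J_prime[OF 2 1] unfolding prod.insert[OF insert.hyps] by blast
    qed (use J_1 in simp)
    hence "pprod e \<notin> J" unfolding pprod_def by blast
    moreover have "u * pprod e \<in> J" using two_eq_pprod Q_J two_Q by (metis subsetD)
    moreover have "u \<notin> J" using ideal_ofD(6)[OF J u(2)] J_1 u(3) by fastforce
    ultimately show False using J_prime[OF u(1) pprod_S] by blast
  qed
  then obtain j where j: "j < 3" "\<tau> j \<in> J" by blast
  hence "\<tau> j \<in> principal_ideal S (\<tau> i)" using i by blast
  hence "j = i" using distinct[OF j(1) i(1)] by blast
  hence "principal_ideal S (\<tau> i) \<subseteq> J" using principal_le_ideal[OF J j(2)] by blast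
  with i have J_eq: "J = principal_ideal S (\<tau> i)" by blast
  have "Q = contract (\<tau> i)"
    using Q_J J_R ideal_ofD(8)[OF Q] unfolding contract_def J_eq[symmetric] by blast
  thus ?thesis using i by blast
qed

lemma primes_above_two: "bij_betw (\<lambda>i. contract (\<tau> i)) {..<3} (primes_above K 2)"
proof (intro bij_betw_imageI inj_onI)
  fix i j assume ij: "i \<in> {..<3::nat}" "j \<in> {..<3::nat}" "contract (\<tau> i) = contract (\<tau> j)"
  have i: "i < 3" and j: "j < 3" using ij by simp_all
  obtain m where m: "odd m" "of_nat m * \<tau> i \<in> R" using SE[OF local.\<tau>(1)[OF i]] .
  have "of_nat m * \<tau> i \<in> contract (\<tau> i)"
    using m ideal_ofD(6)[OF ideal_\<tau>[OF i] unit_subringD(8)[OF subring_S] principal_self[OF subring_S]]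
    unfolding contract_def by blast
  hence "of_nat m * \<tau> i \<in> contract (\<tau> j)" using ij(3) by (simp only:)
  hence *: "of_nat m * \<tau> i \<in> principal_ideal S (\<tau> j)" unfolding contract_def by blast
  have "odd (int m)" using m(1) by simp
  hence "of_int (int m) \<notin> contract (\<tau> j)" by (rule odd_notin_contract[OF j])
  hence "of_nat m \<notin> principal_ideal S (\<tau> j)"
    using unit_subringD(8)[OF subring_R, of m] unfolding contract_def of_int_of_nat_eq by blast
  hence "\<tau> i \<in> principal_ideal S (\<tau> j)"
    using prime_\<tau>[OF j unit_subringD(8)[OF subring_S] local.\<tau>(1)[OF i] *] by blast
  thus "i = j" using distinct[OF i j] by blast
next
  show "(\<lambda>i. contract (\<tau> i)) ` {..<3} = primes_above K 2"
    using primes_above_cases contract_in_primes_above by blast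
qed

text \<open>Contraction is multiplicative on ideals that contain a power of 2. For the harder
  inclusion, both an odd multiple of z and a power of 2 times z lie in the product of the
  contractions, hence so does z by Bezout.\<close>

lemma ideal_prod_contract:
  assumes x: "x \<in> S" "2 ^ k \<in> principal_ideal S x" and y: "y \<in> S" "2 ^ l \<in> principal_ideal S y"
  shows "ideal_prod (ring_of_integers K) (contract x) (contract y) = contract (x * y)"
proof
  interpret T: cring "ring_of_integers K" by (rule cring_ring_of_integers[OF subring_K])
  note S = unit_subringD[OF subring_S] and R = unit_subringD[OF subring_R]
  have xy: "ideal_of R (contract (x * y))" by (intro ideal_contract S x y)
  show "ideal_prod (ring_of_integers K) (contract x) (contract y) \<subseteq> contract (x * y)"
  proof
    fix z assume "z \<in> ideal_prod (ring_of_integers K) (contract x) (contract y)"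
    thus "z \<in> contract (x * y)"
    proof (induction rule: ideal_prod.induct)
      case (prod i j)
      then obtain s t where *: "s \<in> S" "t \<in> S" "i = x * s" "j = y * t" "i \<in> R" "j \<in> R"
        by (auto simp: contract_def principal_ideal_def)
      have "i * j = (x * y) * (s * t)" using * by (simp add: algebra_simps)
      moreover have "s * t \<in> S" "i * j \<in> R" using * S(3) R(3) by auto
      ultimately show ?case unfolding ring_of_integers_simps contract_def principal_ideal_def by blast
    next
      case (sum s1 s2)
      thus ?case using ideal_ofD(3)[OF xy] by (simp only: ring_of_integers_simps)
    qed
  qed
  have "ideal (ideal_prod (ring_of_integers K) (contract x) (contract y)) (ring_of_integers K)"
    using T.ideal_prod_is_ideal[of "contract x" "contract y"] ideal_contract[OF x(1)] ideal_contract[OF y(1)]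
    unfolding ideal_ring_of_integers_iff[OF subring_K] by blast
  hence P: "ideal_of R (ideal_prod (ring_of_integers K) (contract x) (contract y))"
    unfolding ideal_ring_of_integers_iff[OF subring_K] .
  have PI: "a * b \<in> ideal_prod (ring_of_integers K) (contract x) (contract y)" if "a \<in> contract x" "b \<in> contract y" for a b
    using ideal_prod.prod[of a "contract x" b "contract y" "ring_of_integers K"] that by (simp only: ring_of_integers_simps)
  show "contract (x * y) \<subseteq> ideal_prod (ring_of_integers K) (contract x) (contract y)"
  proof
    fix z assume "z \<in> contract (x * y)"
    then obtain s where s: "s \<in> S" "z = x * y * s" "z \<in> R" by (auto simp: contract_def principal_ideal_def)
    obtain m1 where m1: "odd m1" "of_nat m1 * x \<in> R" using SE[OF x(1)] .
    obtain m2 where m2: "odd m2" "of_nat m2 * (y * s) \<in> R" using SE[OF S(3)[OF y(1) s(1)]] .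
    have "of_nat m1 * x \<in> contract x"
      using m1 S(8) unfolding contract_def principal_ideal_def by (auto simp: mult.commute)
    moreover have "of_nat m2 * (y * s) \<in> contract y"
      using m2 S(3)[OF s(1) S(8), of m2] unfolding contract_def principal_ideal_def by (auto simp: mult_ac)
    ultimately have 1: "of_nat (m1 * m2) * z \<in> ideal_prod (ring_of_integers K) (contract x) (contract y)"
      using PI[of "of_nat m1 * x" "of_nat m2 * (y * s)"] s(2) by (simp add: mult_ac)
    have two: "2 ^ k \<in> contract x" "2 ^ l \<in> contract y"
      using x y R(7,10) by (auto simp: contract_def)
    have 2: "2 ^ (k + l) * z \<in> ideal_prod (ring_of_integers K) (contract x) (contract y)"
      using ideal_ofD(7)[OF P s(3) PI[OF two]] by (simp add: power_add)
    have "odd (m1 * m2)" using m1 m2 by simp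
    then obtain a b where ab: "a * int (m1 * m2) + b * 2 ^ (k + l) = 1" using odd_bezout by blast
    have "of_int (a * int (m1 * m2) + b * 2 ^ (k + l)) * z = z" unfolding ab by simp
    hence "z = of_int a * (of_nat (m1 * m2) * z) + of_int b * (2 ^ (k + l) * z)"
      by (simp add: algebra_simps)
    also have "\<dots> \<in> ideal_prod (ring_of_integers K) (contract x) (contract y)"
      by (rule ideal_ofD(3)[OF P ideal_ofD(6)[OF P R(9) 1] ideal_ofD(6)[OF P R(9) 2]])
    finally show "z \<in> ideal_prod (ring_of_integers K) (contract x) (contract y)" .
  qed
qed

text \<open>Powers of the contracted prime are contractions of \<tau>_i^n, and dividing the ideal of
  2 becomes divisibility of 2 by \<tau>_i^n in S, which \<open>pprod_dvd_iff\<close> decides. A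
  factorisation of 2 in S yields the cofactor ideal; conversely a product of ideals lies in each
  factor.\<close>

lemma ramification_index_contract:
  assumes i: "i < 3"
  shows "ramification_index K 2 (contract (\<tau> i)) = e i"
proof -
  let ?T = "ring_of_integers K"
  let ?M = "ideals_set ?T"
  interpret T: cring ?T by (rule cring_ring_of_integers[OF subring_K])
  interpret M: comm_monoid ?M by (rule T.ideals_set_is_comm_monoid)
  note S = unit_subringD[OF subring_S] and R = unit_subringD[OF subring_R]
  have M_simps: "carrier ?M = {I. ideal_of R I}" "A \<otimes>\<^bsub>?M\<^esub> B = ideal_prod ?T A B" "\<one>\<^bsub>?M\<^esub> = R" for A B
    by (simp_all add: ideals_set_def ideal_ring_of_integers_iff[OF subring_K] ring_of_integers_simps)
  have \<tau>S: "\<tau> i ^ n \<in> S" for n using S(7)[OF local.\<tau>(1)[OF i]] .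
  have "2 \<in> principal_ideal S (\<tau> i)" using two_mem_contract[OF i] unfolding contract_def by blast
  then obtain t where t: "t \<in> S" "2 = \<tau> i * t" unfolding principal_ideal_def by blast
  have tn: "2 ^ n \<in> principal_ideal S (\<tau> i ^ n)" for n
    using S(7)[OF t(1), of n] unfolding t(2) power_mult_distrib principal_ideal_def by blast
  have pw: "contract (\<tau> i) [^]\<^bsub>?M\<^esub> n = contract (\<tau> i ^ n)" for n :: nat
  proof (induction n)
    case 0
    show ?case using R_sub_S by (auto simp: M_simps contract_def principal_one)
  next
    case (Suc n)
    have "contract (\<tau> i) [^]\<^bsub>?M\<^esub> Suc n = ideal_prod ?T (contract (\<tau> i ^ n)) (contract (\<tau> i))"
      by (simp only: M.nat_pow_Suc Suc M_simps)
    also have "\<dots> = contract (\<tau> i ^ n * \<tau> i)"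
      by (rule ideal_prod_contract[OF \<tau>S tn local.\<tau>(1)[OF i], of 1]) (use \<open>2 \<in> principal_ideal S (\<tau> i)\<close> in simp)
    finally show ?case by (simp only: power_Suc2)
  qed
  have PIdl: "PIdl\<^bsub>?T\<^esub> 2 = contract 2"
  proof -
    have "PIdl\<^bsub>?T\<^esub> 2 = principal_ideal R 2"
      by (auto simp: cgenideal_def principal_ideal_def ring_of_integers_simps mult.commute)
    thus ?thesis using principal_S_Int_R[of 1] unfolding contract_def by auto
  qed
  have dvd: "contract (\<tau> i) [^]\<^bsub>?M\<^esub> n divides\<^bsub>?M\<^esub> (PIdl\<^bsub>?T\<^esub> 2) \<longleftrightarrow> n \<le> e i" for n :: nat
  proof
    assume "n \<le> e i"
    hence "pprod e \<in> principal_ideal S (\<tau> i ^ n)" using pprod_dvd_iff[OF i] by blast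
    then obtain s where s: "s \<in> S" "pprod e = \<tau> i ^ n * s" unfolding principal_ideal_def by blast
    define y where "y = u * s"
    have y: "y \<in> S" "\<tau> i ^ n * y = 2" using s u S(3) two_eq_pprod by (simp_all add: y_def mult_ac)
    have "2 ^ 1 \<in> principal_ideal S y" using y \<tau>S[of n] unfolding principal_ideal_def by (auto simp: mult.commute intro!: image_eqI[of _ _ "\<tau> i ^ n"])
    from ideal_prod_contract[OF \<tau>S tn y(1) this] have "ideal_prod ?T (contract (\<tau> i ^ n)) (contract y) = contract 2"
      by (simp only: y(2))
    thus "contract (\<tau> i) [^]\<^bsub>?M\<^esub> n divides\<^bsub>?M\<^esub> (PIdl\<^bsub>?T\<^esub> 2)"
      unfolding factor_def pw PIdl M_simps using ideal_contract[OF y(1)] by blast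
  next
    assume "contract (\<tau> i) [^]\<^bsub>?M\<^esub> n divides\<^bsub>?M\<^esub> (PIdl\<^bsub>?T\<^esub> 2)"
    then obtain C where C: "ideal_of R C" "contract 2 = ideal_prod ?T (contract (\<tau> i ^ n)) C"
      unfolding factor_def pw PIdl M_simps by blast
    have "2 \<in> contract 2" using principal_self[OF subring_S] R(10) by (auto simp: contract_def)
    hence "2 \<in> ideal_prod ?T (contract (\<tau> i ^ n)) C" using C by simp
    also have "\<dots> \<subseteq> contract (\<tau> i ^ n)"
      using T.ideal_prod_inter[of "contract (\<tau> i ^ n)" C] C(1) ideal_contract[OF \<tau>S]
      unfolding ideal_ring_of_integers_iff[OF subring_K] by blast
    finally have "inverse u * 2 \<in> principal_ideal S (\<tau> i ^ n)"
      using ideal_ofD(6)[OF ideal_pr[OF \<tau>S] u(2)] unfolding contract_def by blast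
    moreover have "inverse u * 2 = pprod e" using two_eq_pprod u(3) by (simp add: field_simps)
    ultimately have "pprod e \<in> principal_ideal S (\<tau> i ^ n)" by (simp only:)
    thus "n \<le> e i" by (rule iffD1[OF pprod_dvd_iff[OF i, of e n]])
  qed
  have "(GREATEST n::nat. n \<le> e i) = e i" by (rule Greatest_equality, rule order_refl, assumption)
  thus ?thesis unfolding ramification_index_def Let_def of_nat_numeral dvd .
qed

lemma ramification_two:
  "(\<Prod>P\<in>primes_above K 2. ramification_index K 2 P) = e\<^sub>0 * e\<^sub>1 * e\<^sub>2"
  "(\<Sum>P\<in>primes_above K 2. ramification_index K 2 P) = e\<^sub>0 + e\<^sub>1 + e\<^sub>2"
proof -
  have "(\<Prod>P\<in>primes_above K 2. ramification_index K 2 P) = (\<Prod>i<3. e i)"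
    "(\<Sum>P\<in>primes_above K 2. ramification_index K 2 P) = (\<Sum>i<3. e i)"
    unfolding prod.reindex_bij_betw[OF primes_above_two, symmetric] sum.reindex_bij_betw[OF primes_above_two, symmetric]
    by (intro prod.cong sum.cong refl ramification_index_contract; simp)+
  thus "(\<Prod>P\<in>primes_above K 2. ramification_index K 2 P) = e\<^sub>0 * e\<^sub>1 * e\<^sub>2"
    "(\<Sum>P\<in>primes_above K 2. ramification_index K 2 P) = e\<^sub>0 + e\<^sub>1 + e\<^sub>2"
    by (simp_all add: eval_nat_numeral)
qed

end

subsection \<open>Explicit generators of the primes above 2\<close>

text \<open>For x = -\<theta> and x = \<theta> the first base is \<open>\<eta> / lam\<close> and its
  conjugate, and for x = \<theta> the second is \<open>lam / 2\<close>, with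
  \<open>\<theta>\<close>, \<open>lam\<close>, \<open>\<eta>\<close> as introduced below. The
  denominators 8 and 4 are within the bound 128, while the eighth powers have odd constant
  numerators over 2^10 and 2^9.\<close>

lemma fourth_root_17_power8:
  fixes x :: complex
  assumes x: "x ^ 4 = 17"
  shows "((13 + 13 * x - 3 * x\<^sup>2 - 3 * x ^ 3) / 8) ^ 8 =
    (- 3131513471 + 881594277 * x + 759503577 * x\<^sup>2 - 213818019 * x ^ 3) / 1024"
    and "((3 + x\<^sup>2) / 4) ^ 8 = (25889 + 6279 * x\<^sup>2) / 512"
proof -
  have r: "x * (x * (x * x)) = 17" "x * (x * (x * (x * y))) = 17 * y" for y
    using x by (simp_all add: eval_nat_numeral)
  have 1: "(13 + 13 * x - 3 * x\<^sup>2 - 3 * x ^ 3) * (13 + 13 * x - 3 * x\<^sup>2 - 3 * x ^ 3) =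
      4 * (- 251 + 161 * x + 61 * x\<^sup>2 - 39 * x ^ 3)"
    "(- 251 + 161 * x + 61 * x\<^sup>2 - 39 * x ^ 3) * (- 251 + 161 * x + 61 * x\<^sup>2 - 39 * x ^ 3) =
      4 * (- 21807 - 40427 * x + 5289 * x\<^sup>2 + 9805 * x ^ 3)"
    "(- 21807 - 40427 * x + 5289 * x\<^sup>2 + 9805 * x ^ 3) * (- 21807 - 40427 * x + 5289 * x\<^sup>2 + 9805 * x ^ 3) =
      4 * (- 3131513471 + 881594277 * x + 759503577 * x\<^sup>2 - 213818019 * x ^ 3)"
    "(3 + x\<^sup>2) * (3 + x\<^sup>2) = 2 * (13 + 3 * x\<^sup>2)"
    "(13 + 3 * x\<^sup>2) * (13 + 3 * x\<^sup>2) = 2 * (161 + 39 * x\<^sup>2)"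
    "(161 + 39 * x\<^sup>2) * (161 + 39 * x\<^sup>2) = 2 * (25889 + 6279 * x\<^sup>2)"
    by (simp_all add: algebra_simps power2_eq_square power3_eq_cube r)
  \<comment> \<open>Three squarings, each with a common factor extracted. The denominators run
    through 8, 16, 64, 1024 in the first case and 4, 8, 32, 512 in the second.\<close>
  have p8: "(z / p) ^ 8 = w' / s" if "z * z = p' * w" "w * w = q' * y" "y * y = s' * w'"
    "p' / (p * p) = 1 / q" "q' / (q * q) = 1 / r" "s' / (r * r) = 1 / s" for z p p' q q' r s s' w w' y :: complex
  proof -
    have "(z / p) ^ 8 = ((z * z / (p * p)) * (z * z / (p * p))) * ((z * z / (p * p)) * (z * z / (p * p)))"
      by (simp add: eval_nat_numeral mult.assoc)
    also have "z * z / (p * p) = w / q" unfolding that(1) using that(4) by (metis times_divide_eq_left mult.commute mult_1)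
    also have "w / q * (w / q) = y / r"
    proof -
      have "w / q * (w / q) = (q' / (q * q)) * y" using that(2) by (simp add: field_simps)
      thus ?thesis unfolding that(5) by simp
    qed
    also have "y / r * (y / r) = w' / s"
    proof -
      have "y / r * (y / r) = (s' / (r * r)) * w'" using that(3) by (simp add: field_simps)
      thus ?thesis unfolding that(6) by simp
    qed
    finally show ?thesis .
  qed
  show "((13 + 13 * x - 3 * x\<^sup>2 - 3 * x ^ 3) / 8) ^ 8 =
    (- 3131513471 + 881594277 * x + 759503577 * x\<^sup>2 - 213818019 * x ^ 3) / 1024"
    by (rule p8[OF 1(1,2,3), of _ 16 64]) simp_all
  show "((3 + x\<^sup>2) / 4) ^ 8 = (25889 + 6279 * x\<^sup>2) / 512"
    by (rule p8[OF 1(4,5,6), of _ 8 32]) simp_all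
qed

section \<open>Units, nonunits and the common quartic subfield\<close>

context octic begin

text \<open>If \<open>x\<close> were a unit of S, then y = x^(-k) (x^k y) would lie in S. The known
  elements \<open>y\<close> outside S thus certify that the generators are nonunits.\<close>

lemma S_nonunit:
  assumes "y \<notin> S" "x ^ k * y \<in> S"
  shows "1 \<notin> principal_ideal S x"
proof
  assume "1 \<in> principal_ideal S x"
  then obtain s where s: "s \<in> S" "1 = x * s" unfolding principal_ideal_def by blast
  have "s ^ k * (x ^ k * y) = (x * s) ^ k * y" by (simp only: power_mult_distrib mult_ac)
  also have "\<dots> = y" unfolding s(2)[symmetric] by simp
  finally show False
    using assms unit_subringD(3)[OF subring_S unit_subringD(7)[OF subring_S s(1)] assms(2)] by metis
qed

text \<open>Elements dividing an odd integer are units of S; the cofactor \<open>y\<close> can be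
  taken as the product of the other conjugates, \<open>k\<close> being the norm.\<close>

lemma S_inverse:
  assumes "x \<in> R" "y \<in> R" "x * y = of_int k" "odd k"
  shows "inverse x \<in> S" "x \<noteq> 0"
proof -
  have "k \<noteq> 0" using assms(4) by auto
  thus "x \<noteq> 0" using assms(3) by auto
  hence "inverse x = y / of_int k" using assms(3) \<open>k \<noteq> 0\<close> by (simp add: field_simps)
  thus "inverse x \<in> S" using S_divide_odd[of y k] assms R_sub_S by auto
qed

text \<open>Normalised so that \<open>\<theta>\<close> is a fourth root of 17 in both cases: the two
  octic fields contain isomorphic quartic fields, and \<open>lam\<close> and \<open>\<eta>\<close>
  obey the same relations in both.\<close>

definition \<theta> :: complex where "\<theta> = (if c = 1 then \<beta>\<^sup>2 else \<beta>\<^sup>2 / 2)"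

lemma \<theta>4: "\<theta> ^ 4 = 17"
proof -
  have "(\<beta>\<^sup>2) ^ 4 = of_nat (17 * c)" using \<beta>8 by (simp flip: power_mult)
  thus ?thesis using c by (auto simp: \<theta>_def power_divide)
qed

text \<open>
  In the quadratic subfield, 2 factors as \<open>- lam * (3 - lam)\<close>. In the quartic subfield, \<open>lam\<close>
  splits and \<open>3 - lam\<close> ramifies, and \<open>\<eta>\<close> is divisible by one of the two primes above \<open>lam\<close>
  only.
\<close>

definition lam :: complex where "lam = (3 + \<theta>\<^sup>2) / 2"

definition \<eta> :: complex where "\<eta> = (1 - \<theta>) / lam"

lemma \<theta>2_sq: "\<theta>\<^sup>2 * \<theta>\<^sup>2 = 17"
  using \<theta>4 by (simp flip: power_add)

lemma lam_sq: "lam * lam = 3 * lam + 2"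
  using \<theta>2_sq by (simp add: lam_def field_simps)

lemma lam_nz: "lam \<noteq> 0"
proof
  assume "lam = 0"
  thus False using lam_sq by simp
qed

lemma \<theta>_eq: "\<theta> = 1 - lam * \<eta>"
  using lam_nz by (simp add: \<eta>_def)

lemma \<theta>2_eq: "\<theta>\<^sup>2 = 2 * lam - 3"
  by (simp add: lam_def)

lemma \<eta>_sq: "\<eta> * \<eta> = lam * \<eta> - 3 * \<eta> - 14 + 4 * lam"
proof -
  have "(lam * lam) * (\<eta> * \<eta> - (lam * \<eta> - 3 * \<eta> - 14 + 4 * lam)) =
      (lam * \<eta>) * (lam * \<eta>) - ((lam * lam - 3 * lam) * (lam * \<eta>) + (lam * lam) * (4 * lam - 14))"
    by (simp add: algebra_simps)
  also have "\<dots> = (lam * \<eta>) * (lam * \<eta>) - (2 * (lam * \<eta>) + (3 * lam + 2) * (4 * lam - 14))"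
    by (simp add: lam_sq)
  also have "lam * \<eta> = 1 - \<theta>" by (simp add: \<theta>_eq)
  also have "(1 - \<theta>) * (1 - \<theta>) - (2 * (1 - \<theta>) + (3 * lam + 2) * (4 * lam - 14)) =
      \<theta>\<^sup>2 - 1 - (12 * (lam * lam) - 34 * lam - 28)"
    by (simp add: algebra_simps power2_eq_square)
  also have "\<dots> = 0" by (simp add: \<theta>2_eq lam_sq)
  finally have "\<eta> * \<eta> - (1 - \<theta> - 3 * \<eta> - 14 + 4 * lam) = 0"
    using lam_nz by (metis mult_eq_0_iff)
  thus ?thesis by (simp add: \<theta>_eq algebra_simps)
qed

lemma K_divide: "x \<in> K \<Longrightarrow> y \<in> K \<Longrightarrow> x / y \<in> K"
  using unit_subringD(3)[OF subring_K] inverse_K by (simp add: divide_inverse)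

lemma \<theta>_K: "\<theta> \<in> K"
  unfolding \<theta>_def using unit_subringD(7)[OF subring_K \<beta>_K]
  by (auto intro!: K_divide unit_subringD(10)[OF subring_K])

lemma lam_R: "lam \<in> R"
proof -
  have "lam \<in> K" unfolding lam_def
    by (intro K_divide unit_subringD(4)[OF subring_K] unit_subringD(7)[OF subring_K] unit_subringD(10)[OF subring_K] \<theta>_K)
  moreover have "algebraic_int lam"
    by (rule algebraic_int_quadratic[of 3 2]) (use lam_sq in \<open>auto simp: power2_eq_square int_imp_algebraic_int\<close>)
  ultimately show ?thesis by (simp add: integers_of_def)
qed

lemma R_quadratic:
  assumes "x \<in> K" "b \<in> R" "d \<in> R" "x * x = b * x + d"
  shows "x \<in> R"
  using assms algebraic_int_quadratic[of b d x] by (simp add: integers_of_def power2_eq_square)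

lemmas R_intros = unit_subringD(3)[OF subring_R] unit_subringD(4)[OF subring_R] unit_subringD(5)[OF subring_R]
  unit_subringD(6)[OF subring_R] unit_subringD(10)[OF subring_R] unit_subringD(2)[OF subring_R] lam_R \<beta>_R

lemma R_K: "x \<in> R \<Longrightarrow> x \<in> K" by (simp add: integers_of_def)

lemma \<eta>_R: "\<eta> \<in> R"
proof (rule R_quadratic)
  show "\<eta> \<in> K" unfolding \<eta>_def
    by (intro K_divide unit_subringD(5)[OF subring_K] unit_subringD(2)[OF subring_K] \<theta>_K R_K lam_R)
  show "\<eta> * \<eta> = (lam - 3) * \<eta> + (4 * lam - 14)" using \<eta>_sq by (simp add: algebra_simps)
qed (intro R_intros)+

lemmas F_simps = lam_sq \<eta>_sq

text \<open>Variants of \<open>F_simps\<close> for right-nested products. Together they reduce every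
  polynomial in \<open>lam\<close> and \<open>\<eta>\<close> to a combination of 1, lam, \<eta> and
  lam \<eta>, so that \<open>simp\<close> decides the identities below.\<close>

lemma F_simps': "lam * (lam * x) = 3 * (lam * x) + 2 * x"
  "\<eta> * (\<eta> * x) = lam * (\<eta> * x) - 3 * (\<eta> * x) - 14 * x + 4 * (lam * x)"
proof -
  have "lam * (lam * x) = (lam * lam) * x" "\<eta> * (\<eta> * x) = (\<eta> * \<eta>) * x" by (simp_all only: mult.assoc)
  thus "lam * (lam * x) = 3 * (lam * x) + 2 * x"
    "\<eta> * (\<eta> * x) = lam * (\<eta> * x) - 3 * (\<eta> * x) - 14 * x + 4 * (lam * x)"
    by (simp_all add: F_simps algebra_simps)
qed

lemma theta_coeff_S:
  assumes "of_rat p + of_rat q * \<theta> + of_rat r * \<theta>\<^sup>2 + of_rat s * \<theta> ^ 3 \<in> S"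
  shows "\<exists>m. odd m \<and> of_nat (128 * m) * p \<in> \<int>"
proof -
  define t :: rat where "t = (if c = 1 then 1 else 2)"
  define a where "a = (\<lambda>i::nat. if i = 0 then p else if i = 2 then q / t else if i = 4 then r / t\<^sup>2
    else if i = 6 then s / t ^ 3 else 0)"
  have \<theta>: "\<theta> = \<beta>\<^sup>2 / of_rat t" by (simp add: \<theta>_def t_def)
  have "(\<Sum>i<8. of_rat (a i) * \<beta> ^ i) = of_rat p + of_rat (q / t) * \<beta> ^ 2 + of_rat (r / t\<^sup>2) * \<beta> ^ 4 + of_rat (s / t ^ 3) * \<beta> ^ 6"
    by (simp add: eval_nat_numeral a_def)
  also have "\<dots> = of_rat p + of_rat q * \<theta> + of_rat r * \<theta>\<^sup>2 + of_rat s * \<theta> ^ 3"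
    by (simp add: \<theta> of_rat_divide of_rat_power power_divide flip: power_mult)
  finally show ?thesis using coeff_S[of a 0] assms by (simp add: a_def)
qed

text \<open>An odd numerator over 2^k with k \<ge> 8 exceeds the bound 128 = 2^7, and odd
  denominators cannot compensate.\<close>

lemma theta_notin_S:
  assumes "odd n" "k \<ge> 8"
  shows "of_rat (of_int n / 2 ^ k) + of_rat q * \<theta> + of_rat r * \<theta>\<^sup>2 + of_rat s * \<theta> ^ 3 \<notin> S"
proof
  assume "of_rat (of_int n / 2 ^ k) + of_rat q * \<theta> + of_rat r * \<theta>\<^sup>2 + of_rat s * \<theta> ^ 3 \<in> S"
  from theta_coeff_S[OF this] obtain m where m: "odd m" "of_nat (128 * m) * (of_int n / 2 ^ k) \<in> (\<int> :: rat set)" by blast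
  then obtain z where "of_nat (128 * m) * (of_int n / 2 ^ k) = (of_int z :: rat)" by (auto elim: Ints_cases)
  hence "of_int (int (128 * m) * n) = (of_int (z * 2 ^ k) :: rat)" by (simp add: field_simps)
  hence "int (128 * m) * n = z * 2 ^ k" by (simp only: of_int_eq_iff)
  moreover have "(2::int) ^ k = 128 * (2 * 2 ^ (k - 8))"
  proof -
    have "k = 8 + (k - 8)" using assms(2) by simp
    hence "(2::int) ^ k = 2 ^ 8 * 2 ^ (k - 8)" by (metis power_add)
    thus ?thesis by simp
  qed
  ultimately have "int m * n = 2 * (z * 2 ^ (k - 8))" by (simp add: mult_ac)
  moreover have "odd (int m * n)" using m(1) assms(1) by simp
  ultimately show False by simp
qed

text \<open>
  Eighth powers are taken until the denominators exceed the bound 128 from \<open>coeff_bound\<close>.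
\<close>

lemma lam_half_notin_S: "lam / 2 \<notin> S"
proof
  assume "lam / 2 \<in> S"
  hence "(lam / 2) ^ 8 \<in> S" by (rule unit_subringD(7)[OF subring_S])
  moreover have "(lam / 2) ^ 8 = of_rat (of_int 25889 / 2 ^ 9) + of_rat 0 * \<theta> + of_rat (6279 / 512) * \<theta>\<^sup>2 + of_rat 0 * \<theta> ^ 3"
    using fourth_root_17_power8(2)[OF \<theta>4] by (simp add: lam_def of_rat_divide add_divide_distrib)
  ultimately show False using theta_notin_S[of 25889 9 0 "6279 / 512" 0] by simp
qed

text \<open>With lam' = 3 - lam the inverse of lam^2 is lam'^2 / 4, and lam'^2 = 3 lam' + 2.\<close>

lemma inverse_lam_sq: "1 / (lam * lam) = (13 - 3 * \<theta>\<^sup>2) / 8"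
proof -
  have "(13 - 3 * \<theta>\<^sup>2) * (lam * lam) = 8"
    by (simp add: lam_sq \<theta>2_eq) (simp add: algebra_simps lam_sq F_simps'(1))
  thus ?thesis using lam_nz by (simp add: field_simps)
qed

text \<open>The two elements are (1 - \<theta>) / lam^2 and (1 + \<theta>) / lam^2, which \<theta>
  \<mapsto> -\<theta> interchanges, so one eighth power formula serves for both. Each is integral up
  to one of the two primes above \<open>lam\<close>, and so detects nonunits at that prime.\<close>

lemma \<eta>_lam_notin_S: "\<eta> / lam \<notin> S" "(lam - 3 - \<eta>) / lam \<notin> S"
proof -
  have 1: "\<eta> / lam = (13 + 13 * (- \<theta>) - 3 * (- \<theta>)\<^sup>2 - 3 * (- \<theta>) ^ 3) / 8"
  proof -
    have "\<eta> / lam = (1 - \<theta>) * (1 / (lam * lam))" by (simp add: \<eta>_def)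
    also have "\<dots> = (1 - \<theta>) * ((13 - 3 * \<theta>\<^sup>2) / 8)" by (simp only: inverse_lam_sq)
    finally show ?thesis by (simp add: algebra_simps power2_eq_square power3_eq_cube)
  qed
  have 2: "(lam - 3 - \<eta>) / lam = (13 + 13 * \<theta> - 3 * \<theta>\<^sup>2 - 3 * \<theta> ^ 3) / 8"
  proof -
    have "lam * (lam - 3 - \<eta>) = 1 + \<theta>" by (simp add: \<theta>_eq algebra_simps lam_sq)
    moreover have "(lam - 3 - \<eta>) / lam = (lam * (lam - 3 - \<eta>)) * (1 / (lam * lam))" using lam_nz by simp
    ultimately have "(lam - 3 - \<eta>) / lam = (1 + \<theta>) * (1 / (lam * lam))" by (simp only:)
    also have "\<dots> = (1 + \<theta>) * ((13 - 3 * \<theta>\<^sup>2) / 8)" by (simp only: inverse_lam_sq)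
    finally show ?thesis by (simp add: algebra_simps power2_eq_square power3_eq_cube)
  qed
  have "(- \<theta>) ^ 4 = 17" using \<theta>4 by simp
  note p = fourth_root_17_power8(1)[OF this] fourth_root_17_power8(1)[OF \<theta>4]
  show "\<eta> / lam \<notin> S"
  proof
    assume "\<eta> / lam \<in> S"
    hence "(\<eta> / lam) ^ 8 \<in> S" by (rule unit_subringD(7)[OF subring_S])
    moreover have "(\<eta> / lam) ^ 8 = of_rat (of_int (- 3131513471) / 2 ^ 10) + of_rat (- 881594277 / 1024) * \<theta> +
        of_rat (759503577 / 1024) * \<theta>\<^sup>2 + of_rat (213818019 / 1024) * \<theta> ^ 3"
      unfolding 1 p(1) by (simp add: of_rat_divide of_rat_minus add_divide_distrib diff_divide_distrib)
    ultimately show False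
      using theta_notin_S[of "- 3131513471" 10 "- 881594277 / 1024" "759503577 / 1024" "213818019 / 1024"] by simp
  qed
  show "(lam - 3 - \<eta>) / lam \<notin> S"
  proof
    assume "(lam - 3 - \<eta>) / lam \<in> S"
    hence "((lam - 3 - \<eta>) / lam) ^ 8 \<in> S" by (rule unit_subringD(7)[OF subring_S])
    moreover have "((lam - 3 - \<eta>) / lam) ^ 8 = of_rat (of_int (- 3131513471) / 2 ^ 10) + of_rat (881594277 / 1024) * \<theta> +
        of_rat (759503577 / 1024) * \<theta>\<^sup>2 + of_rat (- 213818019 / 1024) * \<theta> ^ 3"
      unfolding 2 p(2) by (simp add: of_rat_divide of_rat_minus add_divide_distrib diff_divide_distrib)
    ultimately show False
      using theta_notin_S[of "- 3131513471" 10 "881594277 / 1024" "759503577 / 1024" "- 213818019 / 1024"] by simp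
  qed
qed

end

section \<open>The factorisation of 2 in each of the two fields\<close>

context octic begin

lemma S_intros: "x \<in> S \<Longrightarrow> y \<in> S \<Longrightarrow> x * y \<in> S" "x \<in> S \<Longrightarrow> x ^ n \<in> S" "x \<in> S \<Longrightarrow> - x \<in> S" "x \<in> R \<Longrightarrow> x \<in> S"
  "x \<in> S \<Longrightarrow> y \<in> S \<Longrightarrow> x + y \<in> S"
  using unit_subringD[OF subring_S] R_sub_S by auto

lemma principal_S_I: "s \<in> S \<Longrightarrow> y = x * s \<Longrightarrow> y \<in> principal_ideal S x"
  by (auto simp: principal_ideal_def)

lemma quadratic_scale: "p * (b * (p * x)) + (p * p) * d = (p * p) * (b * x + d)" for p b d x :: complex
  by (simp add: algebra_simps)

lemma lam_conj: "lam * (3 - lam) = - 2"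
  by (simp add: algebra_simps F_simps)

text \<open>\<open>lam / 2\<close> equals -1 / (3 - lam), so \<open>lam_half_notin_S\<close> says
  that 3 - lam is not a unit of S.\<close>

lemma times_lam_half: "x = (3 - lam) * z \<Longrightarrow> x * (lam / 2) = - z"
proof -
  assume "x = (3 - lam) * z"
  hence "x * (lam / 2) = (lam * (3 - lam)) * z / 2" by simp
  thus ?thesis by (simp add: lam_conj)
qed

text \<open>In the quartic subfield, 2 + 3 lam + \<eta> and its conjugate 4 lam - 1 - \<eta> have
  product \<open>lam\<close> up to a unit of S. The first is \<open>\<tau>0\<close> and stays inert,
  with residue size 4. \<open>\<tau>1\<close> and \<open>\<tau>2\<close> arise from the conjugate
  and from 3 - lam by adding 1 - \<beta>, since \<beta> is 1 modulo a prime of residue size 2. The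
  exponents 1, 2, 4 belong to the 2-adic factors x^2 - 5, x^2 + 5, x^4 + 25.\<close>

lemma dyadic_17:
  assumes c1: "c = 1"
  shows "\<exists>\<tau>\<^sub>0 \<tau>\<^sub>1 \<tau>\<^sub>2 \<omega> u. dyadic c \<beta> \<tau>\<^sub>0 \<tau>\<^sub>1 \<tau>\<^sub>2 \<omega> u 1 2 4"
proof -
  have "\<theta> = \<beta> * \<beta>" unfolding \<theta>_def using c1 by (simp add: power2_eq_square)
  hence b2: "\<beta> * \<beta> = 1 - lam * \<eta>" using \<theta>_eq by simp
  have b2': "\<beta> * (\<beta> * x) = x - lam * (\<eta> * x)" for x
    by (simp add: b2 mult.assoc [symmetric]) (simp add: algebra_simps)
  note norm = algebra_simps F_simps F_simps' b2 b2'
  define \<tau>0 where "\<tau>0 = 2 + 3 * lam + \<eta>"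
  define \<tau>1 where "\<tau>1 = 4 * lam - \<eta> - \<beta>"
  define \<tau>2 where "\<tau>2 = 4 - lam - \<beta>"
  \<comment> \<open>Let g = 4 lam - 1 - \<eta> and let \<tau>1' be \<open>\<tau>1\<close> with
    -\<beta> for \<beta>. Then \<open>w\<close> is \<epsilon>3 \<tau>1'^2 / g and
    \<open>\<epsilon>1\<close> is \<epsilon>3 \<tau>1 \<tau>1' / g, where \<epsilon>3 = \<tau>0 g /
    lam; this is what \<open>lam_fac\<close> records.\<close>
  define w where "w = 141 + 164 * lam + 15 * \<eta> - 21 * lam * \<eta> - 34 * \<beta> + 38 * lam * \<beta> - 3 * \<eta> * \<beta> + lam * \<eta> * \<beta>"
  \<comment> \<open>\<open>\<epsilon>2\<close> is the relative norm of \<open>\<tau>2\<close> down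
    to the quadratic subfield divided by 3 - lam, and \<open>v\<close> is the fourth power of the
    product of the other three conjugates of \<open>\<tau>2\<close> divided by (3 - lam)^3.\<close>
  define v where "v = 1812609 - 509134 * lam + 401390 * \<eta> - 112509 * lam * \<eta> + 1552560 * \<beta> - 436020 * lam * \<beta> + 180220 * \<eta> * \<beta> - 50418 * lam * \<eta> * \<beta>"
  define \<epsilon>1 where "\<epsilon>1 = 113 + 170 * lam + 16 * \<eta> - 14 * lam * \<eta>"
  define \<epsilon>2 where "\<epsilon>2 = 107 - 28 * lam"
  define \<epsilon>3 where "\<epsilon>3 = 18 * lam - 17"
  have R: "\<tau>0 \<in> R" "\<tau>1 \<in> R" "\<tau>2 \<in> R" "w \<in> R" "v \<in> R" "\<epsilon>1 \<in> R" "\<epsilon>2 \<in> R" "\<epsilon>3 \<in> R"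
    unfolding \<tau>0_def \<tau>1_def \<tau>2_def w_def v_def \<epsilon>1_def \<epsilon>2_def \<epsilon>3_def by (intro R_intros \<eta>_R)+
  have "\<epsilon>1 * (- 28493615 + 9584706 * lam - 10315024 * \<eta> + 2972918 * lam * \<eta>) = of_int 4051886521"
    unfolding \<epsilon>1_def by (simp add: norm)
  hence \<epsilon>1: "inverse \<epsilon>1 \<in> S" "\<epsilon>1 \<noteq> 0"
    by (rule S_inverse[rotated 2]; (intro R \<eta>_R R_intros | simp))+
  have "\<epsilon>2 * (23 + 28 * lam) = of_int 893"
    unfolding \<epsilon>2_def by (simp add: norm)
  hence \<epsilon>2: "inverse \<epsilon>2 \<in> S" "\<epsilon>2 \<noteq> 0"
    by (rule S_inverse[rotated 2]; (intro R \<eta>_R R_intros | simp))+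
  have "\<epsilon>3 * (37 - 18 * lam) = of_int (- 1277)"
    unfolding \<epsilon>3_def by (simp add: norm)
  hence \<epsilon>3: "inverse \<epsilon>3 \<in> S" "\<epsilon>3 \<noteq> 0"
    by (rule S_inverse[rotated 2]; (intro R \<eta>_R R_intros | simp))+
  have t11: "\<tau>1 * \<tau>1 = 19 + 52 * lam - 3 * \<eta> - 8 * lam * \<eta> - 8 * lam * \<beta> + 2 * \<eta> * \<beta>"
    unfolding \<tau>1_def by (simp add: norm)
  have lam_fac: "lam * (\<epsilon>1 * \<epsilon>1) = \<tau>0 * (\<tau>1 * \<tau>1 * w)"
  proof -
    have f: "\<tau>1 * \<tau>1 * w = 19505 + 35370 * lam - 3527 * \<eta> - 5718 * lam * \<eta>"
      unfolding t11 w_def by (simp add: norm)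
    show ?thesis unfolding f \<tau>0_def \<epsilon>1_def by (simp add: norm)
  qed
  have t2: "\<tau>2 ^ 4 = 479 - 133 * lam + 60 * \<eta> - 18 * lam * \<eta> - 344 * \<beta> + 96 * lam * \<beta> - 8 * \<eta> * \<beta> + 4 * lam * \<eta> * \<beta>"
  proof -
    have 1: "\<tau>2 * \<tau>2 = 19 - 5 * lam - lam * \<eta> - 8 * \<beta> + 2 * lam * \<beta>"
      unfolding \<tau>2_def by (simp add: norm)
    have "\<tau>2 ^ 4 = (\<tau>2 * \<tau>2) * (\<tau>2 * \<tau>2)" by (simp add: eval_nat_numeral)
    thus ?thesis unfolding 1 by (simp add: norm)
  qed
  have lam'_fac: "(3 - lam) * \<epsilon>2 ^ 4 = \<tau>2 ^ 4 * v"
  proof -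
    have 1: "\<epsilon>2 * \<epsilon>2 = 13017 - 3640 * lam" unfolding \<epsilon>2_def by (simp add: norm)
    have "\<epsilon>2 ^ 4 = (\<epsilon>2 * \<epsilon>2) * (\<epsilon>2 * \<epsilon>2)" by (simp add: eval_nat_numeral)
    also have "\<dots> = 195941489 - 55014960 * lam" unfolding 1 by (simp add: norm)
    finally have 2: "\<epsilon>2 ^ 4 = 195941489 - 55014960 * lam" .
    show ?thesis unfolding 2 t2 v_def by (simp add: norm)
  qed
  define u where "u = - (w * v * (inverse \<epsilon>1)\<^sup>2 * inverse \<epsilon>2 ^ 4)"
  have "2 * (\<epsilon>1 * \<epsilon>1) * \<epsilon>2 ^ 4 = - (lam * (\<epsilon>1 * \<epsilon>1)) * ((3 - lam) * \<epsilon>2 ^ 4)"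
    using arg_cong[OF lam_conj, of "\<lambda>z. - z * (\<epsilon>1 * \<epsilon>1) * \<epsilon>2 ^ 4"] by (simp add: mult_ac)
  also have "\<dots> = - (w * v) * (\<tau>0 * \<tau>1\<^sup>2 * \<tau>2 ^ 4)"
    unfolding lam_fac lam'_fac by (simp add: power2_eq_square mult_ac)
  finally have two: "2 = u * (\<tau>0 ^ 1 * \<tau>1\<^sup>2 * \<tau>2 ^ 4)"
    using \<epsilon>1(2) \<epsilon>2(2) by (simp add: u_def power2_eq_square field_simps)
  have u: "u \<in> S"
    unfolding u_def by (intro S_intros(1,2,3) S_intros(4)[OF R(4)] S_intros(4)[OF R(5)] \<epsilon>1 \<epsilon>2)
  have n0: "1 \<notin> principal_ideal S \<tau>0"
  proof (rule S_nonunit[OF \<eta>_lam_notin_S(2), of _ 1])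
    have "\<tau>0 * (lam - 3 - \<eta>) = lam * (- 23 + 7 * lam - lam * \<eta>)"
      unfolding \<tau>0_def by (simp add: norm)
    hence "\<tau>0 ^ 1 * ((lam - 3 - \<eta>) / lam) = - 23 + 7 * lam - lam * \<eta>"
      using lam_nz by (simp add: field_simps)
    moreover have "- 23 + 7 * lam - lam * \<eta> \<in> R" by (intro R_intros \<eta>_R)
    ultimately show "\<tau>0 ^ 1 * ((lam - 3 - \<eta>) / lam) \<in> S" using R_sub_S by (simp only: subset_iff)
  qed
  have n1: "1 \<notin> principal_ideal S \<tau>1"
  proof (rule S_nonunit[OF \<eta>_lam_notin_S(1), of _ 2])
    let ?z = "37 - 11 * lam + 31 * \<eta> + 6 * lam * \<eta> + 50 * \<beta> - 14 * lam * \<beta> + 3 * \<eta> * \<beta> - 3 * lam * \<eta> * \<beta>"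
    have "\<tau>1 * \<tau>1 * \<eta> = lam * ?z" unfolding t11 by (simp add: norm)
    hence "\<tau>1\<^sup>2 * (\<eta> / lam) = ?z" using lam_nz by (simp add: power2_eq_square nonzero_divide_eq_eq mult.commute[of lam])
    moreover have "?z \<in> R" by (intro R_intros \<eta>_R)
    ultimately show "\<tau>1\<^sup>2 * (\<eta> / lam) \<in> S" using R_sub_S by (simp only: subset_iff)
  qed
  have n2: "1 \<notin> principal_ideal S \<tau>2"
  proof (rule S_nonunit[OF lam_half_notin_S, of _ 4])
    let ?z = "133 - 40 * lam + 18 * \<eta> - 3 * lam * \<eta> - 96 * \<beta> + 28 * lam * \<beta> - 4 * \<eta> * \<beta> - 2 * lam * \<eta> * \<beta>"
    have "\<tau>2 ^ 4 = (3 - lam) * ?z" unfolding t2 by (simp add: norm)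
    hence "\<tau>2 ^ 4 * (lam / 2) = - ?z" by (rule times_lam_half)
    moreover have "- ?z \<in> R" by (intro R_intros \<eta>_R)
    ultimately show "\<tau>2 ^ 4 * (lam / 2) \<in> S" using R_sub_S by (simp only: subset_iff)
  qed
  \<comment> \<open>As the proof of \<open>n0\<close> shows, (lam - 3 - \<eta>) / lam becomes
    integral after multiplication by \<open>\<tau>0\<close>. So \<omega> is essentially (1 +
    \<beta>) / \<tau>0, an analogue of the generator (1 + sqrt 5) / 2 of the unramified quadratic
    extension.\<close>
  define \<omega> where "\<omega> = (1 + \<beta>) * (lam - 3 - \<eta>) / lam"
  have l\<omega>: "lam * \<omega> = (1 + \<beta>) * (lam - 3 - \<eta>)" using lam_nz by (simp add: \<omega>_def)
  have \<omega>2: "\<omega> * \<omega> = (11 - 3 * lam + 3 * \<eta> - lam * \<eta>) * \<omega> + (- 89 + 25 * lam - 25 * \<eta> + 7 * lam * \<eta>)"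
  proof -
    have "(lam * lam) * (\<omega> * \<omega>) = (lam * \<omega>) * (lam * \<omega>)" by (simp only: mult_ac)
    also have "\<dots> = lam * ((11 - 3 * lam + 3 * \<eta> - lam * \<eta>) * (lam * \<omega>)) + (lam * lam) * (- 89 + 25 * lam - 25 * \<eta> + 7 * lam * \<eta>)"
      unfolding l\<omega> by (simp add: norm)
    also have "\<dots> = (lam * lam) * ((11 - 3 * lam + 3 * \<eta> - lam * \<eta>) * \<omega> + (- 89 + 25 * lam - 25 * \<eta> + 7 * lam * \<eta>))"
      by (simp only: distrib_left mult_ac)
    finally show ?thesis using lam_nz by simp
  qed
  have \<omega>R: "\<omega> \<in> R"
  proof (rule R_quadratic[OF _ _ _ \<omega>2])
    show "\<omega> \<in> K" unfolding \<omega>_def by (intro K_divide R_K R_intros \<eta>_R)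
  qed (intro R_intros \<eta>_R)+
  have \<omega>_mem: "\<omega>\<^sup>2 + \<omega> + 1 \<in> principal_ideal S \<tau>0"
  proof (rule principal_S_I)
    \<comment> \<open>Both coefficients of the quadratic equation for \<omega> are -1 modulo
      \<open>\<tau>0\<close>; the unit \<open>\<epsilon>3\<close> clears denominators in the
      division by \<open>\<tau>0\<close>.\<close>
    have 1: "(12 - 3 * lam + 3 * \<eta> - lam * \<eta>) * \<epsilon>3 = \<tau>0 * (- 20 + 7 * lam + 19 * \<eta> - 6 * lam * \<eta>)"
      "(- 88 + 25 * lam - 25 * \<eta> + 7 * lam * \<eta>) * \<epsilon>3 = \<tau>0 * (214 - 59 * lam - 143 * \<eta> + 40 * lam * \<eta>)"
      unfolding \<epsilon>3_def \<tau>0_def by (simp_all add: norm)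
    have "(\<omega>\<^sup>2 + \<omega> + 1) * \<epsilon>3 = (12 - 3 * lam + 3 * \<eta> - lam * \<eta>) * \<epsilon>3 * \<omega> + (- 88 + 25 * lam - 25 * \<eta> + 7 * lam * \<eta>) * \<epsilon>3"
      unfolding power2_eq_square \<omega>2 by (simp add: algebra_simps)
    also have "\<dots> = \<tau>0 * ((- 20 + 7 * lam + 19 * \<eta> - 6 * lam * \<eta>) * \<omega> + (214 - 59 * lam - 143 * \<eta> + 40 * lam * \<eta>))"
      unfolding 1 by (simp only: distrib_left mult.assoc)
    finally show "\<omega>\<^sup>2 + \<omega> + 1 = \<tau>0 * (((- 20 + 7 * lam + 19 * \<eta> - 6 * lam * \<eta>) * \<omega> + (214 - 59 * lam - 143 * \<eta> + 40 * lam * \<eta>)) * inverse \<epsilon>3)"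
      using \<epsilon>3(2) by (simp add: field_simps)
    show "((- 20 + 7 * lam + 19 * \<eta> - 6 * lam * \<eta>) * \<omega> + (214 - 59 * lam - 143 * \<eta> + 40 * lam * \<eta>)) * inverse \<epsilon>3 \<in> S"
      by (rule S_intros(1)[OF S_intros(4) \<epsilon>3(1)]) (intro R_intros \<eta>_R \<omega>R)
  qed
  \<comment> \<open>\<open>lam\<close> and 3 - lam lie in the two ideals and add up to 3, a unit of
    S.\<close>
  have "lam / 3 = \<tau>1 * (\<tau>0 * \<tau>1 * w * (inverse \<epsilon>1)\<^sup>2 / of_int 3)"
    using lam_fac \<epsilon>1(2) by (simp add: power2_eq_square field_simps)
  moreover have "\<tau>0 * \<tau>1 * w * (inverse \<epsilon>1)\<^sup>2 / of_int 3 \<in> S"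
    by (rule S_divide_odd, intro S_intros(1,2) S_intros(4)[OF R(1)] S_intros(4)[OF R(2)] S_intros(4)[OF R(4)] \<epsilon>1) simp
  ultimately have x: "lam / 3 \<in> principal_ideal S \<tau>1" by (rule principal_S_I[rotated])
  have "3 - lam = ((3 - lam) * \<epsilon>2 ^ 4) * inverse \<epsilon>2 ^ 4"
    using \<epsilon>2(2) by (simp add: power_inverse)
  also have "\<dots> = \<tau>2 * (\<tau>2 ^ 3 * v * inverse \<epsilon>2 ^ 4)"
    unfolding lam'_fac by (simp add: eval_nat_numeral mult_ac)
  finally have "(3 - lam) / 3 = \<tau>2 * (\<tau>2 ^ 3 * v * inverse \<epsilon>2 ^ 4 / of_int 3)"
    by (metis times_divide_eq_right of_int_numeral)
  moreover have "\<tau>2 ^ 3 * v * inverse \<epsilon>2 ^ 4 / of_int 3 \<in> S"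
    by (rule S_divide_odd, intro S_intros(1,2) S_intros(4)[OF R(3)] S_intros(4)[OF R(5)] \<epsilon>2) simp
  ultimately have y: "(3 - lam) / 3 \<in> principal_ideal S \<tau>2" by (rule principal_S_I[rotated])
  have "lam / 3 + (3 - lam) / 3 = 1" by (simp add: field_simps)
  hence comax: "\<exists>x\<in>principal_ideal S \<tau>1. \<exists>y\<in>principal_ideal S \<tau>2. x + y = 1" using x y by blast
  have "dyadic c \<beta> \<tau>0 \<tau>1 \<tau>2 \<omega> u 1 2 4"
    by unfold_locales (use R \<omega>R R_sub_S n0 n1 n2 \<omega>_mem comax u two in auto)
  thus ?thesis by blast
qed

text \<open>Here \<beta>^2 = 2 \<theta>, so \<beta> lies in every prime above 2, and adding it to 3
  - lam, \<open>g1\<close> and \<open>g2\<close> gives the three generators. \<open>\<tau>0\<close>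
  belongs to the 2-adic factor x^4 + 100 and has residue size 4: the ramification over 3 - lam
  already happens in the quartic subfield. The other two belong to x^2 - 10 and x^2 + 10.\<close>

lemma dyadic_272:
  assumes c16: "c = 16"
  shows "\<exists>\<tau>\<^sub>0 \<tau>\<^sub>1 \<tau>\<^sub>2 \<omega> u. dyadic c \<beta> \<tau>\<^sub>0 \<tau>\<^sub>1 \<tau>\<^sub>2 \<omega> u 2 2 2"
proof -
  have "2 * \<theta> = \<beta> * \<beta>" unfolding \<theta>_def using c16 by (simp add: power2_eq_square)
  hence b2: "\<beta> * \<beta> = 2 - 2 * (lam * \<eta>)" unfolding \<theta>_eq by (simp add: algebra_simps)
  have b2': "\<beta> * (\<beta> * x) = 2 * x - 2 * (lam * (\<eta> * x))" for x
    by (simp add: b2 mult.assoc [symmetric]) (simp add: algebra_simps)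
  note norm = algebra_simps F_simps F_simps' b2 b2'
  define \<tau>0 where "\<tau>0 = 3 - lam + \<beta>"
  define \<tau>1 where "\<tau>1 = 2 + 3 * lam + \<eta> + \<beta>"
  define \<tau>2 where "\<tau>2 = - 1 + 4 * lam - \<eta> + \<beta>"
  \<comment> \<open>Let a dash denote the substitution of -\<beta> for \<beta>. Then
    \<open>w0\<close> = \<tau>0'^2 / (3 - lam) and \<open>\<epsilon>0\<close> = \<tau>0 \<tau>0' /
    (3 - lam). For i = 1, 2 the element wi is \<epsilon>3 \<tau>i'^2 / gi and \<epsilon>i is
    \<epsilon>3 \<tau>i \<tau>i' / gi. The identities \<open>f0\<close>, \<open>f1\<close>,
    \<open>f2\<close> follow this pattern.\<close>
  define w0 where "w0 = 3 - 2 * lam + 2 * \<eta> + 3 * lam * \<eta> - 2 * \<beta>"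
  define w1 where "w1 = 57 + 154 * lam - 18 * \<eta> + 11 * lam * \<eta> + 34 * \<beta> - 36 * lam * \<beta>"
  define w2 where "w2 = 189 + 124 * lam + 16 * \<eta> - 25 * lam * \<eta> + 34 * \<beta> - 36 * lam * \<beta>"
  define \<epsilon>0 where "\<epsilon>0 = 3 - 2 * \<eta> - 3 * lam * \<eta>"
  define \<epsilon>1 where "\<epsilon>1 = 91 + 140 * lam - 16 * \<eta> + 25 * lam * \<eta>"
  define \<epsilon>2 where "\<epsilon>2 = 133 + 136 * lam + 18 * \<eta> - 11 * lam * \<eta>"
  define \<epsilon>3 where "\<epsilon>3 = 18 * lam - 17"
  define g1 where "g1 = 2 + 3 * lam + \<eta>"
  define g2 where "g2 = - 1 + 4 * lam - \<eta>"
  have R: "\<tau>0 \<in> R" "\<tau>1 \<in> R" "\<tau>2 \<in> R" "w0 \<in> R" "w1 \<in> R" "w2 \<in> R" "\<epsilon>0 \<in> R" "\<epsilon>1 \<in> R" "\<epsilon>2 \<in> R" "\<epsilon>3 \<in> R"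
    unfolding \<tau>0_def \<tau>1_def \<tau>2_def w0_def w1_def w2_def \<epsilon>0_def \<epsilon>1_def \<epsilon>2_def \<epsilon>3_def by (intro R_intros \<eta>_R)+
  have "\<epsilon>0 * (- 193 + 38 * lam + 10 * \<eta> + 47 * lam * \<eta>) = of_int (- 727)"
    unfolding \<epsilon>0_def by (simp add: norm)
  hence \<epsilon>0: "inverse \<epsilon>0 \<in> S" "\<epsilon>0 \<noteq> 0"
    by (rule S_inverse[rotated 2]; (intro R \<eta>_R R_intros | simp))+
  have "\<epsilon>1 * (39590217 - 8258578 * lam + 9453548 * \<eta> - 2985275 * lam * \<eta>) = of_int 5979254959"
    unfolding \<epsilon>1_def by (simp add: norm)
  hence \<epsilon>1: "inverse \<epsilon>1 \<in> S" "\<epsilon>1 \<noteq> 0"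
    by (rule S_inverse[rotated 2]; (intro R \<eta>_R R_intros | simp))+
  have "\<epsilon>2 * (- 8870383 + 3821226 * lam - 7781762 * \<eta> + 2231475 * lam * \<eta>) = of_int 2924928913"
    unfolding \<epsilon>2_def by (simp add: norm)
  hence \<epsilon>2: "inverse \<epsilon>2 \<in> S" "\<epsilon>2 \<noteq> 0"
    by (rule S_inverse[rotated 2]; (intro R \<eta>_R R_intros | simp))+
  have "\<epsilon>3 * (37 - 18 * lam) = of_int (- 1277)"
    unfolding \<epsilon>3_def by (simp add: norm)
  hence \<epsilon>3: "inverse \<epsilon>3 \<in> S" "\<epsilon>3 \<noteq> 0"
    by (rule S_inverse[rotated 2]; (intro R \<eta>_R R_intros | simp))+
  have t00: "\<tau>0\<^sup>2 = 13 - 3 * lam - 2 * lam * \<eta> + 6 * \<beta> - 2 * lam * \<beta>"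
    unfolding \<tau>0_def power2_eq_square by (simp add: norm)
  have t11: "\<tau>1\<^sup>2 = 10 + 43 * lam + \<eta> + 5 * lam * \<eta> + 4 * \<beta> + 6 * lam * \<beta> + 2 * \<eta> * \<beta>"
    unfolding \<tau>1_def power2_eq_square by (simp add: norm)
  have t22: "\<tau>2\<^sup>2 = 21 + 44 * lam - \<eta> - 9 * lam * \<eta> - 2 * \<beta> + 8 * lam * \<beta> - 2 * \<eta> * \<beta>"
    unfolding \<tau>2_def power2_eq_square by (simp add: norm)
  have f0: "(3 - lam) * \<epsilon>0\<^sup>2 = \<tau>0\<^sup>2 * w0"
    unfolding t00 w0_def \<epsilon>0_def by (simp add: norm power2_eq_square)
  have f1: "g1 * \<epsilon>1\<^sup>2 = \<tau>1\<^sup>2 * (w1 * \<epsilon>3)"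
  proof -
    have f: "\<tau>1\<^sup>2 * w1 = 10958 + 23437 * lam + 4475 * \<eta> + 7860 * lam * \<eta>"
      unfolding t11 w1_def by (simp add: norm)
    have g: "\<epsilon>1\<^sup>2 = 34997 + 88154 * lam + 8720 * \<eta> + 22576 * lam * \<eta>"
      unfolding \<epsilon>1_def power2_eq_square by (simp add: norm)
    show ?thesis unfolding g1_def \<epsilon>3_def g mult.assoc[symmetric] f by (simp add: norm)
  qed
  have f2: "g2 * \<epsilon>2\<^sup>2 = \<tau>2\<^sup>2 * (w2 * \<epsilon>3)"
  proof -
    have f: "\<tau>2\<^sup>2 * w2 = 13629 + 26312 * lam - 2259 * \<eta> - 3596 * lam * \<eta>"
      unfolding t22 w2_def by (simp add: norm)
    have g: "\<epsilon>2\<^sup>2 = 46493 + 93994 * lam - 2960 * \<eta> - 6440 * lam * \<eta>"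
      unfolding \<epsilon>2_def power2_eq_square by (simp add: norm)
    show ?thesis unfolding g2_def \<epsilon>3_def g mult.assoc[symmetric] f by (simp add: norm)
  qed
  \<comment> \<open>\<open>g1\<close> and \<open>g2\<close> are conjugate over the quadratic
    subfield and stand for the two primes above \<open>lam\<close>; \<open>\<epsilon>3\<close> is a
    unit of S.\<close>
  have g12: "lam * \<epsilon>3 = g1 * g2" unfolding g1_def g2_def \<epsilon>3_def by (simp add: norm)
  define u where "u = - (w0 * w1 * w2 * \<epsilon>3 * (inverse \<epsilon>0)\<^sup>2 * (inverse \<epsilon>1)\<^sup>2 * (inverse \<epsilon>2)\<^sup>2)"
  have "\<epsilon>3 * (2 * \<epsilon>0\<^sup>2 * \<epsilon>1\<^sup>2 * \<epsilon>2\<^sup>2) = - (lam * \<epsilon>3) * ((3 - lam) * \<epsilon>0\<^sup>2) * \<epsilon>1\<^sup>2 * \<epsilon>2\<^sup>2"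
    using arg_cong[OF lam_conj, of "\<lambda>z. - z * \<epsilon>3 * \<epsilon>0\<^sup>2 * \<epsilon>1\<^sup>2 * \<epsilon>2\<^sup>2"] by (simp add: mult_ac)
  also have "\<dots> = - ((g1 * \<epsilon>1\<^sup>2) * (g2 * \<epsilon>2\<^sup>2) * ((3 - lam) * \<epsilon>0\<^sup>2))"
    unfolding g12 by (simp add: mult_ac)
  also have "\<dots> = \<epsilon>3 * (- (w0 * w1 * w2 * \<epsilon>3) * (\<tau>0\<^sup>2 * \<tau>1\<^sup>2 * \<tau>2\<^sup>2))"
    unfolding f0 f1 f2 by (simp add: mult_ac)
  finally have "2 * \<epsilon>0\<^sup>2 * \<epsilon>1\<^sup>2 * \<epsilon>2\<^sup>2 = - (w0 * w1 * w2 * \<epsilon>3) * (\<tau>0\<^sup>2 * \<tau>1\<^sup>2 * \<tau>2\<^sup>2)"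
    using \<epsilon>3(2) by (simp only: mult_cancel_left simp_thms)
  hence two: "2 = u * (\<tau>0\<^sup>2 * \<tau>1\<^sup>2 * \<tau>2\<^sup>2)"
    using \<epsilon>0(2) \<epsilon>1(2) \<epsilon>2(2) by (simp add: u_def field_simps)
  have u: "u \<in> S"
    unfolding u_def by (intro S_intros(1,2,3) S_intros(4)[OF R(4)] S_intros(4)[OF R(5)] S_intros(4)[OF R(6)] S_intros(4)[OF R(10)] \<epsilon>0 \<epsilon>1 \<epsilon>2)
  have n0: "1 \<notin> principal_ideal S \<tau>0"
  proof (rule S_nonunit[OF lam_half_notin_S, of _ 2])
    let ?z = "3 - 2 * lam + 2 * \<eta> + 3 * lam * \<eta> + 2 * \<beta>"
    have "\<tau>0\<^sup>2 = (3 - lam) * ?z" unfolding t00 by (simp add: norm)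
    hence "\<tau>0\<^sup>2 * (lam / 2) = - ?z" by (rule times_lam_half)
    moreover have "- ?z \<in> R" by (intro R_intros \<eta>_R)
    ultimately show "\<tau>0\<^sup>2 * (lam / 2) \<in> S" using R_sub_S by (simp only: subset_iff)
  qed
  have n1: "1 \<notin> principal_ideal S \<tau>1"
  proof (rule S_nonunit[OF \<eta>_lam_notin_S(2), of _ 2])
    let ?z = "- 29 + 15 * lam - 28 * \<eta> - 5 * lam * \<eta> - 46 * \<beta> + 14 * lam * \<beta> - 2 * lam * \<eta> * \<beta>"
    have "\<tau>1\<^sup>2 * (lam - 3 - \<eta>) = lam * ?z" unfolding t11 by (simp add: norm)
    hence "\<tau>1\<^sup>2 * ((lam - 3 - \<eta>) / lam) = ?z" using lam_nz by (simp add: nonzero_divide_eq_eq mult.commute[of lam])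
    moreover have "?z \<in> R" by (intro R_intros \<eta>_R)
    ultimately show "\<tau>1\<^sup>2 * ((lam - 3 - \<eta>) / lam) \<in> S" using R_sub_S by (simp only: subset_iff)
  qed
  have n2: "1 \<notin> principal_ideal S \<tau>2"
  proof (rule S_nonunit[OF \<eta>_lam_notin_S(1), of _ 2])
    let ?z = "101 - 29 * lam + 34 * \<eta> + 3 * lam * \<eta> - 50 * \<beta> + 14 * lam * \<beta> + 2 * lam * \<eta> * \<beta>"
    have "\<tau>2\<^sup>2 * \<eta> = lam * ?z" unfolding t22 by (simp add: norm)
    hence "\<tau>2\<^sup>2 * (\<eta> / lam) = ?z" using lam_nz by (simp add: nonzero_divide_eq_eq mult.commute[of lam])
    moreover have "?z \<in> R" by (intro R_intros \<eta>_R)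
    ultimately show "\<tau>2\<^sup>2 * (\<eta> / lam) \<in> S" using R_sub_S by (simp only: subset_iff)
  qed
  have lp: "3 - lam \<noteq> 0" using lam_conj by auto
  \<comment> \<open>Integrality of \<omega> is reached in two stages, each a division by 3 - lam
    justified by a monic quadratic equation over integral elements: first \<xi>, then \<xi> - 1 -
    \<eta>.\<close>
  define \<xi> where "\<xi> = \<beta> * (lam - 3 - \<eta>) / (3 - lam)"
  have l\<xi>: "(3 - lam) * \<xi> = \<beta> * (lam - 3 - \<eta>)" using lp by (simp add: \<xi>_def)
  have \<xi>2: "\<xi> * \<xi> = 0 * \<xi> + (- 4 + 3 * lam - 2 * \<eta> - 2 * lam * \<eta>)"
  proof -
    have "((3 - lam) * (3 - lam)) * (\<xi> * \<xi>) = ((3 - lam) * \<xi>) * ((3 - lam) * \<xi>)" by (simp only: mult_ac)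
    also have "\<dots> = ((3 - lam) * (3 - lam)) * (- 4 + 3 * lam - 2 * \<eta> - 2 * lam * \<eta>)"
      unfolding l\<xi> by (simp add: norm)
    finally show ?thesis using lp by simp
  qed
  have \<xi>R: "\<xi> \<in> R"
  proof (rule R_quadratic[OF _ _ _ \<xi>2])
    show "\<xi> \<in> K" unfolding \<xi>_def by (intro K_divide R_K R_intros \<eta>_R)
    show "0 \<in> R" by (rule unit_subringD(1)[OF subring_R])
  qed (intro R_intros \<eta>_R)
  define \<omega> where "\<omega> = (\<xi> - 1 - \<eta>) / (3 - lam)"
  have l\<omega>: "(3 - lam) * \<omega> = \<xi> - 1 - \<eta>" using lp by (simp add: \<omega>_def)
  have \<omega>2: "\<omega> * \<omega> = (lam + lam * \<eta>) * \<omega> + (3 + 4 * lam - 5 * \<eta> - 9 * lam * \<eta>)"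
  proof -
    have "((3 - lam) * (3 - lam)) * (\<omega> * \<omega>) = ((3 - lam) * \<omega>) * ((3 - lam) * \<omega>)" by (simp only: mult_ac)
    also have "\<dots> = (3 - lam) * ((lam + lam * \<eta>) * ((3 - lam) * \<omega>)) + ((3 - lam) * (3 - lam)) * (3 + 4 * lam - 5 * \<eta> - 9 * lam * \<eta>)"
      unfolding l\<omega> using \<xi>2 by (simp add: norm)
    also have "\<dots> = ((3 - lam) * (3 - lam)) * ((lam + lam * \<eta>) * \<omega> + (3 + 4 * lam - 5 * \<eta> - 9 * lam * \<eta>))"
      by (rule quadratic_scale)
    finally show ?thesis using lp by simp
  qed
  have \<omega>R: "\<omega> \<in> R"
  proof (rule R_quadratic[OF _ _ _ \<omega>2])
    show "\<omega> \<in> K" unfolding \<omega>_def by (intro K_divide R_K R_intros \<eta>_R \<xi>R)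
  qed (intro R_intros \<eta>_R)+
  have I: "ideal_of S (principal_ideal S x)" if "x \<in> R" for x
    using ideal_of_principal[OF subring_S] that R_sub_S by blast
  have \<beta>\<xi>: "\<beta> * \<xi> = 2 - 2 * lam + lam * \<eta>"
  proof -
    have "(3 - lam) * (\<beta> * \<xi>) = \<beta> * ((3 - lam) * \<xi>)" by (simp only: mult_ac)
    also have "\<dots> = (3 - lam) * (2 - 2 * lam + lam * \<eta>)" unfolding l\<xi> by (simp add: norm)
    finally show ?thesis using lp by simp
  qed
  have mem_\<eta>: "\<eta> \<in> principal_ideal S \<tau>0"
  proof (rule principal_S_I)
    have "\<tau>0 * (\<eta> + \<beta> + \<xi>) = (3 - lam) * \<xi> + \<beta> * \<xi> + (3 - lam + \<beta>) * (\<eta> + \<beta>)"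
      unfolding \<tau>0_def by (simp add: algebra_simps)
    also have "\<dots> = \<eta> * \<epsilon>0"
      unfolding \<beta>\<xi> l\<xi> \<epsilon>0_def by (simp add: norm)
    finally have "\<eta> * \<epsilon>0 = \<tau>0 * (\<eta> + \<beta> + \<xi>)" by (rule sym)
    thus "\<eta> = \<tau>0 * ((\<eta> + \<beta> + \<xi>) * inverse \<epsilon>0)" using \<epsilon>0(2) by (simp add: field_simps)
    show "(\<eta> + \<beta> + \<xi>) * inverse \<epsilon>0 \<in> S"
      by (rule S_intros(1)[OF S_intros(4) \<epsilon>0(1)]) (intro R_intros \<eta>_R \<xi>R)
  qed
  have mem_lam': "3 - lam \<in> principal_ideal S \<tau>0"
  proof (rule principal_S_I)
    show "3 - lam = \<tau>0 * (\<tau>0 * w0 * (inverse \<epsilon>0)\<^sup>2)"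
      using f0 \<epsilon>0(2) by (simp add: power2_eq_square field_simps)
    show "\<tau>0 * w0 * (inverse \<epsilon>0)\<^sup>2 \<in> S"
      by (intro S_intros(1,2) S_intros(4)[OF R(1)] S_intros(4)[OF R(4)] \<epsilon>0)
  qed
  have \<omega>_mem: "\<omega>\<^sup>2 + \<omega> + 1 \<in> principal_ideal S \<tau>0"
  proof -
    \<comment> \<open>After substituting the equation for \<omega>, both coefficients are rewritten
      as combinations of 3 - lam and \<eta>, which lie in the ideal of \<open>\<tau>0\<close> by
      \<open>mem_lam'\<close> and \<open>mem_\<eta>\<close>.\<close>
    have "\<omega>\<^sup>2 + \<omega> + 1 = (1 + lam + lam * \<eta>) * \<omega> + (4 + 4 * lam - 5 * \<eta> - 9 * lam * \<eta>)"
      unfolding power2_eq_square \<omega>2 by (simp add: algebra_simps)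
    also have "1 + lam + lam * \<eta> = (- 2 * lam - 1) * (3 - lam) + lam * \<eta>" by (simp add: norm)
    also have "4 + 4 * lam - 5 * \<eta> - 9 * lam * \<eta> = (- 2 * lam * (1 + lam)) * (3 - lam) + (- 5 - 9 * lam) * \<eta>" by (simp add: norm)
    also have "((- 2 * lam - 1) * (3 - lam) + lam * \<eta>) * \<omega> + ((- 2 * lam * (1 + lam)) * (3 - lam) + (- 5 - 9 * lam) * \<eta>) =
        ((- 2 * lam - 1) * \<omega> + (- 2 * lam * (1 + lam))) * (3 - lam) + (lam * \<omega> + (- 5 - 9 * lam)) * \<eta>"
      by (simp add: algebra_simps)
    also have "\<dots> \<in> principal_ideal S \<tau>0"
      by (rule ideal_ofD(3)[OF I[OF R(1)] ideal_ofD(6)[OF I[OF R(1)] S_intros(4) mem_lam'] ideal_ofD(6)[OF I[OF R(1)] S_intros(4) mem_\<eta>]];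
          intro R_intros \<omega>R)
    finally show ?thesis .
  qed
  have g1_mem: "g1 \<in> principal_ideal S \<tau>1"
  proof (rule principal_S_I)
    show "g1 = \<tau>1 * (\<tau>1 * (w1 * \<epsilon>3) * (inverse \<epsilon>1)\<^sup>2)"
      using f1 \<epsilon>1(2) by (simp add: power2_eq_square field_simps)
    show "\<tau>1 * (w1 * \<epsilon>3) * (inverse \<epsilon>1)\<^sup>2 \<in> S"
      by (intro S_intros(1,2) S_intros(4)[OF R(2)] S_intros(4)[OF R(5)] S_intros(4)[OF R(10)] \<epsilon>1)
  qed
  have g2_mem: "g2 \<in> principal_ideal S \<tau>2"
  proof (rule principal_S_I)
    show "g2 = \<tau>2 * (\<tau>2 * (w2 * \<epsilon>3) * (inverse \<epsilon>2)\<^sup>2)"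
      using f2 \<epsilon>2(2) by (simp add: power2_eq_square field_simps)
    show "\<tau>2 * (w2 * \<epsilon>3) * (inverse \<epsilon>2)\<^sup>2 \<in> S"
      by (intro S_intros(1,2) S_intros(4)[OF R(3)] S_intros(4)[OF R(6)] S_intros(4)[OF R(10)] \<epsilon>2)
  qed
  have "g1 * inverse \<epsilon>3 \<in> S" unfolding g1_def by (rule S_intros(1)[OF S_intros(4) \<epsilon>3(1)]) (intro R_intros \<eta>_R)
  moreover have "lam = (g1 * inverse \<epsilon>3) * g2" using g12 \<epsilon>3(2) by (simp add: field_simps)
  ultimately have "lam \<in> principal_ideal S \<tau>2" using ideal_ofD(6)[OF I[OF R(3)] _ g2_mem] by metis
  \<comment> \<open>g1 + g2 = 1 + 7 lam, and \<open>lam\<close> is a multiple of \<open>g2\<close>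
    in S.\<close>
  hence "g2 - 7 * lam \<in> principal_ideal S \<tau>2"
    using ideal_ofD(4)[OF I[OF R(3)] g2_mem ideal_ofD(6)[OF I[OF R(3)] unit_subringD(10)[OF subring_S]]] by blast
  moreover have "g1 + (g2 - 7 * lam) = 1" by (simp add: g1_def g2_def)
  ultimately have comax: "\<exists>x\<in>principal_ideal S \<tau>1. \<exists>y\<in>principal_ideal S \<tau>2. x + y = 1" using g1_mem by blast
  have "dyadic c \<beta> \<tau>0 \<tau>1 \<tau>2 \<omega> u 2 2 2"
    by unfold_locales (use R \<omega>R R_sub_S n0 n1 n2 \<omega>_mem comax u two in auto)
  thus ?thesis by blast
qed

end

subsection \<open>The theorem\<close>

lemma (in dyadic) two_power_ideals_eqpoll:
  "{I. ideal_of R I \<and> idx R I = 2 ^ k} \<approx>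
    {\<epsilon> \<in> {..<3} \<rightarrow>\<^sub>E UNIV. (\<Prod>i<(3::nat). (if i = 0 then 4 else 2) ^ \<epsilon> i) = (2::nat) ^ k}"
  using eqpoll_trans[OF two_power_ideals ideals_eqpoll] .

lemma octic_arithmetically_equivalent:
  assumes "dyadic 1 \<alpha> \<tau>\<^sub>0 \<tau>\<^sub>1 \<tau>\<^sub>2 \<omega> u e\<^sub>0 e\<^sub>1 e\<^sub>2" "dyadic 16 \<beta> \<tau>\<^sub>0' \<tau>\<^sub>1' \<tau>\<^sub>2' \<omega>' u' e\<^sub>0' e\<^sub>1' e\<^sub>2'"
  shows "arithmetically_equivalent (octic.K \<alpha>) (octic.K \<beta>)"
proof -
  interpret A: dyadic 1 \<alpha> \<tau>\<^sub>0 \<tau>\<^sub>1 \<tau>\<^sub>2 \<omega> u e\<^sub>0 e\<^sub>1 e\<^sub>2 by fact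
  interpret B: dyadic 16 \<beta> \<tau>\<^sub>0' \<tau>\<^sub>1' \<tau>\<^sub>2' \<omega>' u' e\<^sub>0' e\<^sub>1' e\<^sub>2' by fact
  show ?thesis
  proof (rule arithmetically_equivalentI[OF A.subring_K B.subring_K A.idx_ideal_pos B.idx_ideal_pos])
    fix n :: nat assume "n > 0"
    then obtain m where m: "n = 2 ^ multiplicity 2 n * m" "\<not> 2 dvd m"
      using multiplicity_decompose'[of n 2] by auto
    define k where "k = multiplicity 2 n"
    have "odd m" "m > 0" using m \<open>n > 0\<close> by (auto intro: gr0I)
    have cop: "Rings.coprime (2 ^ k) m" using \<open>odd m\<close> by (cases "k = 0") (simp_all add: coprime_power_left_iff)
    have "{I. ideal_of A.R I \<and> idx A.R I = 2 ^ k * m} \<approx>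
        {I. ideal_of A.R I \<and> idx A.R I = 2 ^ k} \<times> {I. ideal_of A.R I \<and> idx A.R I = m}"
      using \<open>m > 0\<close> by (intro ideals_of_coprime_index[OF A.subring_R cop, of 8] A.idx_R) auto
    also have "\<dots> \<approx> {I. ideal_of B.R I \<and> idx B.R I = 2 ^ k} \<times> {I. ideal_of B.R I \<and> idx B.R I = m}"
      using eqpoll_trans[OF A.two_power_ideals_eqpoll eqpoll_sym[OF B.two_power_ideals_eqpoll]]
        odd_ideals_eqpoll[OF A.octic_axioms B.octic_axioms \<open>odd m\<close>]
      by (rule times_eqpoll_cong)
    also have "\<dots> \<approx> {I. ideal_of B.R I \<and> idx B.R I = 2 ^ k * m}"
      using \<open>m > 0\<close> by (intro eqpoll_sym[OF ideals_of_coprime_index[OF B.subring_R cop, of 8]] B.idx_R) auto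
    finally show "{I. ideal_of A.R I \<and> idx A.R I = n} \<approx> {I. ideal_of B.R I \<and> idx B.R I = n}"
      using m(1) by (simp only: k_def[symmetric])
  qed
qed

theorem mainTheorem4:
  shows "\<exists>(K1 :: complex set) (K2 :: complex set) (p :: nat).
    number_field K1 \<and> number_field K2 \<and> arithmetically_equivalent K1 K2 \<and>
    Factorial_Ring.prime p \<and>
    (\<Prod>P\<in>primes_above K1 p. ramification_index K1 p P) =
      (\<Prod>P\<in>primes_above K2 p. ramification_index K2 p P) \<and>
    (\<Sum>P\<in>primes_above K1 p. ramification_index K1 p P) \<noteq>
      (\<Sum>P\<in>primes_above K2 p. ramification_index K2 p P)"
proof -
  define \<alpha> where "\<alpha> = complex_of_real (root 8 17)"
  define \<beta> where "\<beta> = complex_of_real (root 8 272)"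
  have "\<alpha> ^ 8 = of_real (root 8 17 ^ 8)" "\<beta> ^ 8 = of_real (root 8 272 ^ 8)"
    by (simp_all only: \<alpha>_def \<beta>_def of_real_power)
  hence "octic 1 \<alpha>" "octic 16 \<beta>" by (unfold_locales; simp)+
  then interpret A: octic 1 \<alpha> + B: octic 16 \<beta> .
  obtain \<tau>\<^sub>0 \<tau>\<^sub>1 \<tau>\<^sub>2 \<omega> u where A: "dyadic 1 \<alpha> \<tau>\<^sub>0 \<tau>\<^sub>1 \<tau>\<^sub>2 \<omega> u 1 2 4"
    using A.dyadic_17[OF refl] by blast
  obtain \<tau>\<^sub>0' \<tau>\<^sub>1' \<tau>\<^sub>2' \<omega>' u' where B: "dyadic 16 \<beta> \<tau>\<^sub>0' \<tau>\<^sub>1' \<tau>\<^sub>2' \<omega>' u' 2 2 2"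
    using B.dyadic_272[OF refl] by blast
  show ?thesis
    using A.number_field_K B.number_field_K octic_arithmetically_equivalent[OF A B] two_is_prime_nat
      dyadic.ramification_two[OF A] dyadic.ramification_two[OF B]
    by (intro exI[of _ "octic.K \<alpha>"] exI[of _ "octic.K \<beta>"] exI[of _ 2]) simp
qed

end
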